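(* Suppose $\mu_j\in\sigma(\hat A_2)\setminus\sigma(A_1)$. Then the eigenfunction $u_{\varepsilon,j}$ of (P$_\varepsilon$) with eigenvalue $\lambda_j^\varepsilon$ converges in $H^1(a,b)$, as $\varepsilon\to0$, to a function $u$ with $u=0$ on $I_a$ and $u=z$ on $I_b$, where $z$ is an eigenfunction of the problem $$(\kappa z')'+\mu\rho z=0\ \text{ in } I_b,\qquad z(0)=0,\quad z(b)=0$$ with eigenvalue $\mu=\mu_j$. Moreover, $\lambda_j^\varepsilon$ and $u_{\varepsilon,j}$ admit the asymptotic expansions $\lambda_j^\varepsilon\sim\varepsilon(\mu_j+\varepsilon\nu_1+\cdots+\varepsilon^n\nu_n+\cdots)$, $u_{\varepsilon,j}\sim y_0+\varepsilon y_1+\cdots+\varepsilon^n y_n+\cdots$ on $I_a$ and $u_{\varepsilon,j}\sim z_0+\varepsilon z_1+\cdots+\varepsilon^n z_n+\cdots$ on $I_b$ (the latter two up to a normalizing multiplier), with coefficients $\nu_n,y_n,z_n$ constructed in the context for $\mu=\mu_j$, with the following estimates of the remainder terms: for every $n\in\mathbb{N}$ there are constants $c_n,C_n$ such that for all sufficiently small $\varepsilon>0$ $$\bigl|\varepsilon^{-1}\lambda_j^\varepsilon-(\mu_j+\varepsilon\nu_1+\cdots+\varepsilon^n\nu_n)\bigr|\le c_n\varepsilon^{n+1},\qquad \|u_{\varepsilon,j}-\vartheta_\varepsilon U_{\varepsilon,n}\|_{H^1(a,b)}\le C_n\varepsilon^{n+1},$$ where $U_{\varepsilon,n}=\sum_{i=0}^n\varepsilon^i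 y_i$ on $I_a$, $U_{\varepsilon,n}=\sum_{i=0}^n\varepsilon^i z_i$ on $I_b$, and $\vartheta_\varepsilon$ is a normalizing multiplier (a real number, which may depend on $n$) that converges to a positive constant as $\varepsilon\to0$.
   Context: Let $a<0<b$, $I_a=(a,0)$, $I_b=(0,b)$. Let $k,r$ be smooth positive functions on $[a,0]$ and $\kappa,\rho$ smooth positive functions on $[0,b]$. Let $R=r$ on $I_a$ and $R=\rho$ on $I_b$. Perturbed problem (P$_\varepsilon$), $\varepsilon>0$: $(k u_\varepsilon')'+\varepsilon^{-1}\lambda^\varepsilon r u_\varepsilon=0$ in $I_a$; $\ \varepsilon(\kappa u_\varepsilon')'+\lambda^\varepsilon\rho u_\varepsilon=0$ in $I_b$; $\ u_\varepsilon(-0)=u_\varepsilon(+0)$, $\ (ku_\varepsilon')(-0)=\varepsilon(\kappa u_\varepsilon')(+0)$; $\ u_\varepsilon(a)=0$, $u_\varepsilon(b)=0$. Its spectrum is real, discrete and simple, $0<\lambda_1^\varepsilon<\lambda_2^\varepsilon<\dots\to\infty$. The corresponding real-valued eigenfunctions $u_{\varepsilon,j}$ are normalized by $\int_a^b R\,u_{\varepsilon,j}^2\,dx=1$ and $u_{\varepsilon,j}'(b)>0$. Operators: $A_1=-\frac1r\frac{d}{dx}k\frac{d}{dx}$ in $L_2(r,I_a)$ with domain $\{u\in H^2(I_a):u(a)=0,\ u'(0)=0\}$; $\hat A_2=-\frac1\rho\frac{d}{dx}\kappa\frac{d}{dx}$ in $L_2(\rho,I_b)$ with domain $\{u\in H^2(I_b):u(0)=u(b)=0\}$;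 $\mathcal{A}(u_1,u_2)=\bigl(-\frac1r(ku_1')',-\frac1\rho(\kappa u_2')'\bigr)$ in $L_2(r,I_a)\oplus L_2(\rho,I_b)$ with domain $\{(u_1,u_2)\in H^2(I_a)\oplus H^2(I_b): u_1(a)=u_1'(0)=0,\ u_2(b)=0,\ u_1(0)=u_2(0)\}$. The spectrum of $\mathcal{A}$ is real and discrete and equals $\sigma(A_1)\cup\sigma(\hat A_2)$; $\mu_1\le\mu_2\le\cdots$ are the eigenvalues of $\mathcal{A}$ in increasing order, repeated according to algebraic multiplicity. Construction of coefficients for $\mu\in\sigma(\hat A_2)\setminus\sigma(A_1)$. Put $y_0=0$ and let $z_0$ be a real eigenfunction of $\hat A_2$ with eigenvalue $\mu$, $\int_0^b\rho z_0^2\,dx=1$, with sign fixed so that $z_0'(b)>0$. For $n=1,2,\dots$ let $y_n$ be the unique solution of $$(ky_n')'+\mu r y_n=-r\sum_{i=1}^{n-1}\nu_i y_{n-i}\ \text{ in } I_a,\quad y_n(a)=0,\quad (ky_n')(0)=(\kappa z_{n-1}')(0),$$ put $\nu_n=-(\kappa z_0')(0)\,y_n(0)$, and let $z_n$ be the unique solution of $$(\kappa z_n')'+\mu\rho z_n=-\nu_n\rho z_0-\rho\sum_{i=1}^{n-1}\nu_i z_{n-i}\ \text{ in } I_b,\quad z_n(0)=y_n(0),\quad z_n(b)=0,\quad \int_0^b\rho z_n z_0\,dx=0.$$ *)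

theory Defs
  imports "HOL-Analysis.Analysis" "HOL-Library.Function_Algebras"
begin

section \<open>Functions on a compact interval\<close>

text \<open>Derivatives are taken within the closed interval, hence are one-sided at its endpoints.\<close>

definition Dv :: "real \<Rightarrow> real \<Rightarrow> (real \<Rightarrow> 'a::euclidean_space) \<Rightarrow> real \<Rightarrow> 'a" where
  "Dv c d u x = vector_derivative u (at x within {c..d})"

definition smooth_on_Icc :: "real \<Rightarrow> real \<Rightarrow> (real \<Rightarrow> real) \<Rightarrow> bool" where
  "smooth_on_Icc c d f \<longleftrightarrow>
     (\<exists>D :: nat \<Rightarrow> real \<Rightarrow> real.
        (\<forall>x\<in>{c..d}. D 0 x = f x) \<and>
        (\<forall>n. \<forall>x\<in>{c..d}. (D n has_real_derivative D (Suc n) x) (at x within {c..d})))"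

definition L2 :: "real \<Rightarrow> real \<Rightarrow> (real \<Rightarrow> 'a::euclidean_space) set" where
  "L2 c d = {f. f \<in> borel_measurable (lebesgue_on {c..d}) \<and>
                integrable (lebesgue_on {c..d}) (\<lambda>x. (norm (f x))\<^sup>2)}"

definition L2_norm :: "real \<Rightarrow> real \<Rightarrow> (real \<Rightarrow> real) \<Rightarrow> (real \<Rightarrow> 'a::euclidean_space) \<Rightarrow> real" where
  "L2_norm c d w f = sqrt (integral {c..d} (\<lambda>x. w x * (norm (f x))\<^sup>2))"

text \<open>
  In one dimension, the functions having a square-integrable weak derivative \<open>g\<close> are, up to null
  sets, the indefinite integrals of \<open>g\<close>. Elements of Sobolev spaces are always represented by
  these (absolutely continuous) functions, so that the traces at the endpoints are values.
\<close>

definition has_weak_deriv ::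
    "real \<Rightarrow> real \<Rightarrow> (real \<Rightarrow> 'a::euclidean_space) \<Rightarrow> (real \<Rightarrow> 'a) \<Rightarrow> bool" where
  "has_weak_deriv c d u g \<longleftrightarrow> g \<in> L2 c d \<and> (\<forall>x\<in>{c..d}. u x = u c + integral {c..x} g)"

definition H1 :: "real \<Rightarrow> real \<Rightarrow> (real \<Rightarrow> 'a::euclidean_space) set" where
  "H1 c d = {u. \<exists>g. has_weak_deriv c d u g}"

definition H2 :: "real \<Rightarrow> real \<Rightarrow> (real \<Rightarrow> 'a::euclidean_space) set" where
  "H2 c d = {u. \<exists>v g. has_weak_deriv c d u v \<and> has_weak_deriv c d v g}"

text \<open>
  Meaningful for elements of \<^term>\<open>H1 c d\<close> only: these are differentiable almost everywhere,
  with derivative the weak derivative.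
\<close>

definition H1_norm :: "real \<Rightarrow> real \<Rightarrow> (real \<Rightarrow> real) \<Rightarrow> real" where
  "H1_norm c d f =
     sqrt (integral {c..d} (\<lambda>x. (f x)\<^sup>2) + integral {c..d} (\<lambda>x. (vector_derivative f (at x))\<^sup>2))"

section \<open>Unbounded operators in weighted spaces\<close>

text \<open>
  An operator is given by its graph, a set of pairs closed under changing the second component on a
  null set. Since elements of a domain are continuous on \<open>[c, d]\<close>, they become genuine (rather
  than almost everywhere) representatives by requiring them to vanish outside \<open>[c, d]\<close>.

  \<open>SL_graph c d p w\<close> is the maximal operator \<open>u \<mapsto> - (1/w) (p u')'\<close> with domain \<open>H2 c d\<close>.
\<close>

definition SL_graph ::
    "real \<Rightarrow> real \<Rightarrow> (real \<Rightarrow> real) \<Rightarrow> (real \<Rightarrow> real) \<Rightarrow> ((real \<Rightarrow> complex) \<times> (real \<Rightarrow> complex)) set" where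
  "SL_graph c d p w = {(u, f).
     u \<in> H2 c d \<and> (\<forall>x. x \<notin> {c..d} \<longrightarrow> u x = 0) \<and> f \<in> L2 c d \<and>
     (\<exists>g. has_weak_deriv c d (\<lambda>x. p x *\<^sub>R Dv c d u x) g \<and>
          (AE x in lebesgue_on {c..d}. f x = - (1 / w x) *\<^sub>R g x))}"

definition A1 ::
    "real \<Rightarrow> (real \<Rightarrow> real) \<Rightarrow> (real \<Rightarrow> real) \<Rightarrow> ((real \<Rightarrow> complex) \<times> (real \<Rightarrow> complex)) set" where
  "A1 a k r = {(u, f) \<in> SL_graph a 0 k r. u a = 0 \<and> Dv a 0 u 0 = 0}"

definition A2_hat ::
    "real \<Rightarrow> (real \<Rightarrow> real) \<Rightarrow> (real \<Rightarrow> real) \<Rightarrow> ((real \<Rightarrow> complex) \<times> (real \<Rightarrow> complex)) set" where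
  "A2_hat b \<kappa> \<rho> = {(u, f) \<in> SL_graph 0 b \<kappa> \<rho>. u 0 = 0 \<and> u b = 0}"

type_synonym cpair = "(real \<Rightarrow> complex) \<times> (real \<Rightarrow> complex)"

definition A_op ::
    "real \<Rightarrow> real \<Rightarrow> (real \<Rightarrow> real) \<Rightarrow> (real \<Rightarrow> real) \<Rightarrow> (real \<Rightarrow> real) \<Rightarrow> (real \<Rightarrow> real) \<Rightarrow>
     (cpair \<times> cpair) set" where
  "A_op a b k r \<kappa> \<rho> = {((u1, u2), (f1, f2)).
     (u1, f1) \<in> SL_graph a 0 k r \<and> (u2, f2) \<in> SL_graph 0 b \<kappa> \<rho> \<and>
     u1 a = 0 \<and> Dv a 0 u1 0 = 0 \<and> u2 b = 0 \<and> u1 0 = u2 0}"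

text \<open>
  \<open>(A - l) u = f\<close> is written as \<open>(u, f + l u) \<in> A\<close>. A number \<open>l\<close> belongs to the resolvent set if
  \<open>A - l\<close> is a bijection from the domain onto the weighted \<open>L2\<close> space with bounded inverse.
\<close>

definition resolvent_set ::
    "real \<Rightarrow> real \<Rightarrow> (real \<Rightarrow> real) \<Rightarrow> ((real \<Rightarrow> complex) \<times> (real \<Rightarrow> complex)) set \<Rightarrow> complex set" where
  "resolvent_set c d w A = {l.
     (\<forall>f \<in> L2 c d. \<exists>!u. (u, \<lambda>x. f x + l * u x) \<in> A) \<and>
     (\<exists>C. \<forall>f u. f \<in> L2 c d \<longrightarrow> (u, \<lambda>x. f x + l * u x) \<in> A \<longrightarrow>
            L2_norm c d w u \<le> C * L2_norm c d w f)}"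

definition op_spectrum ::
    "real \<Rightarrow> real \<Rightarrow> (real \<Rightarrow> real) \<Rightarrow> ((real \<Rightarrow> complex) \<times> (real \<Rightarrow> complex)) set \<Rightarrow> complex set" where
  "op_spectrum c d w A = - resolvent_set c d w A"

text \<open>
  \<open>root_vectors A l m\<close> is the kernel of \<open>(A - l)\<^sup>m\<close>; the algebraic multiplicity of \<open>l\<close> is the
  dimension of the union of these kernels.
\<close>

primrec root_vectors :: "(cpair \<times> cpair) set \<Rightarrow> complex \<Rightarrow> nat \<Rightarrow> cpair set" where
  "root_vectors A l 0 = {(\<lambda>x. 0, \<lambda>x. 0)}"
| "root_vectors A l (Suc m) = {(u1, u2). \<exists>v1 v2. (v1, v2) \<in> root_vectors A l m \<and>
     ((u1, u2), (\<lambda>x. v1 x + l * u1 x, \<lambda>x. v2 x + l * u2 x)) \<in> A}"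

definition cpair_scale :: "complex \<Rightarrow> cpair \<Rightarrow> cpair" where
  "cpair_scale s = (\<lambda>(u1, u2). (\<lambda>x. s * u1 x, \<lambda>x. s * u2 x))"

lemma vector_space_cpair_scale: "vector_space cpair_scale"
  by unfold_locales
    (auto simp: cpair_scale_def case_prod_beta prod_eq_iff fun_eq_iff algebra_simps)

definition alg_mult :: "(cpair \<times> cpair) set \<Rightarrow> complex \<Rightarrow> nat" where
  "alg_mult A l = vector_space.dim cpair_scale (\<Union>m. root_vectors A l m)"

text \<open>Sequences of eigenvalues are indexed from 1; their value at 0 is irrelevant.\<close>

definition eigenvalue_enumeration :: "(cpair \<times> cpair) set \<Rightarrow> (nat \<Rightarrow> real) \<Rightarrow> bool" where
  "eigenvalue_enumeration A \<mu> \<longleftrightarrow>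
     mono_on {1..} \<mu> \<and>
     (\<forall>l :: complex. finite {j. 1 \<le> j \<and> complex_of_real (\<mu> j) = l} \<and>
                     card {j. 1 \<le> j \<and> complex_of_real (\<mu> j) = l} = alg_mult A l)"

section \<open>Boundary value problems\<close>

text \<open>
  \<open>u\<close> is a classical solution, up to the endpoints, of \<open>(p u')' + q u = g\<close>. For smooth coefficients
  and right-hand sides this is the same as being a solution in the interior belonging to \<open>H2\<close>.
\<close>

definition solves_SL ::
    "real \<Rightarrow> real \<Rightarrow> (real \<Rightarrow> real) \<Rightarrow> (real \<Rightarrow> real) \<Rightarrow> (real \<Rightarrow> real) \<Rightarrow> (real \<Rightarrow> real) \<Rightarrow> bool" where
  "solves_SL c d p q g u \<longleftrightarrow>
     (\<forall>x\<in>{c..d}. u differentiable (at x within {c..d})) \<and>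
     (\<forall>x\<in>{c..d}. ((\<lambda>t. p t * Dv c d u t) has_real_derivative (g x - q x * u x)) (at x within {c..d}))"

text \<open>
  An eigenfunction is one function on \<open>[a, b]\<close> which is differentiable from both sides at 0; this
  includes the condition \<open>u(-0) = u(+0)\<close>.
\<close>

definition perturbed_eigenfunction ::
    "real \<Rightarrow> real \<Rightarrow> (real \<Rightarrow> real) \<Rightarrow> (real \<Rightarrow> real) \<Rightarrow> (real \<Rightarrow> real) \<Rightarrow> (real \<Rightarrow> real) \<Rightarrow>
     real \<Rightarrow> real \<Rightarrow> (real \<Rightarrow> real) \<Rightarrow> bool" where
  "perturbed_eigenfunction a b k r \<kappa> \<rho> \<epsilon> l u \<longleftrightarrow>
     solves_SL a 0 k (\<lambda>x. l / \<epsilon> * r x) (\<lambda>x. 0) u \<and>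
     solves_SL 0 b (\<lambda>x. \<epsilon> * \<kappa> x) (\<lambda>x. l * \<rho> x) (\<lambda>x. 0) u \<and>
     k 0 * Dv a 0 u 0 = \<epsilon> * (\<kappa> 0 * Dv 0 b u 0) \<and>
     u a = 0 \<and> u b = 0 \<and> (\<exists>x\<in>{a..b}. u x \<noteq> 0)"

definition normalized_eigenfunction ::
    "real \<Rightarrow> real \<Rightarrow> (real \<Rightarrow> real) \<Rightarrow> (real \<Rightarrow> real) \<Rightarrow> (real \<Rightarrow> real) \<Rightarrow> (real \<Rightarrow> real) \<Rightarrow>
     real \<Rightarrow> real \<Rightarrow> (real \<Rightarrow> real) \<Rightarrow> bool" where
  "normalized_eigenfunction a b k r \<kappa> \<rho> \<epsilon> l u \<longleftrightarrow>
     perturbed_eigenfunction a b k r \<kappa> \<rho> \<epsilon> l u \<and>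
     integral {a..b} (\<lambda>x. (if x < 0 then r x else \<rho> x) * (u x)\<^sup>2) = 1 \<and>
     Dv 0 b u b > 0"

definition perturbed_enumeration ::
    "real \<Rightarrow> real \<Rightarrow> (real \<Rightarrow> real) \<Rightarrow> (real \<Rightarrow> real) \<Rightarrow> (real \<Rightarrow> real) \<Rightarrow> (real \<Rightarrow> real) \<Rightarrow>
     real \<Rightarrow> (nat \<Rightarrow> real) \<Rightarrow> bool" where
  "perturbed_enumeration a b k r \<kappa> \<rho> \<epsilon> ls \<longleftrightarrow>
     strict_mono_on {1..} ls \<and>
     ls ` {1..} = {l. \<exists>u. perturbed_eigenfunction a b k r \<kappa> \<rho> \<epsilon> l u}"

definition dirichlet_eigenfunction ::
    "real \<Rightarrow> (real \<Rightarrow> real) \<Rightarrow> (real \<Rightarrow> real) \<Rightarrow> real \<Rightarrow> (real \<Rightarrow> real) \<Rightarrow> bool" where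
  "dirichlet_eigenfunction b \<kappa> \<rho> \<mu> z \<longleftrightarrow>
     solves_SL 0 b \<kappa> (\<lambda>x. \<mu> * \<rho> x) (\<lambda>x. 0) z \<and> z 0 = 0 \<and> z b = 0 \<and> (\<exists>x\<in>{0..b}. z x \<noteq> 0)"

section \<open>Coefficients of the asymptotic expansions\<close>

definition zero_ext :: "real \<Rightarrow> real \<Rightarrow> (real \<Rightarrow> real) \<Rightarrow> real \<Rightarrow> complex" where
  "zero_ext c d f x = (if x \<in> {c..d} then complex_of_real (f x) else 0)"

text \<open>
  The conditions determine \<open>y n\<close> on \<open>[a, 0]\<close> and \<open>z n\<close> on \<open>[0, b]\<close> only; \<open>\<nu> 0\<close> plays no role.
\<close>

definition expansion_coeffs ::
    "real \<Rightarrow> real \<Rightarrow> (real \<Rightarrow> real) \<Rightarrow> (real \<Rightarrow> real) \<Rightarrow> (real \<Rightarrow> real) \<Rightarrow> (real \<Rightarrow> real) \<Rightarrow> real \<Rightarrow>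
     (nat \<Rightarrow> real) \<Rightarrow> (nat \<Rightarrow> real \<Rightarrow> real) \<Rightarrow> (nat \<Rightarrow> real \<Rightarrow> real) \<Rightarrow> bool" where
  "expansion_coeffs a b k r \<kappa> \<rho> \<mu> \<nu> y z \<longleftrightarrow>
     (\<forall>x\<in>{a..0}. y 0 x = 0) \<and>
     (zero_ext 0 b (z 0), \<lambda>x. complex_of_real \<mu> * zero_ext 0 b (z 0) x) \<in> A2_hat b \<kappa> \<rho> \<and>
     integral {0..b} (\<lambda>x. \<rho> x * (z 0 x)\<^sup>2) = 1 \<and> Dv 0 b (z 0) b > 0 \<and>
     (\<forall>n\<ge>1.
        solves_SL a 0 k (\<lambda>x. \<mu> * r x) (\<lambda>x. - r x * (\<Sum>i = 1..n - 1. \<nu> i * y (n - i) x)) (y n) \<and>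
        y n a = 0 \<and> k 0 * Dv a 0 (y n) 0 = \<kappa> 0 * Dv 0 b (z (n - 1)) 0 \<and>
        \<nu> n = - (\<kappa> 0 * Dv 0 b (z 0) 0) * y n 0 \<and>
        solves_SL 0 b \<kappa> (\<lambda>x. \<mu> * \<rho> x)
          (\<lambda>x. - \<nu> n * \<rho> x * z 0 x - \<rho> x * (\<Sum>i = 1..n - 1. \<nu> i * z (n - i) x)) (z n) \<and>
        z n 0 = y n 0 \<and> z n b = 0 \<and> integral {0..b} (\<lambda>x. \<rho> x * z n x * z 0 x) = 0)"

definition partial_expansion ::
    "(nat \<Rightarrow> real \<Rightarrow> real) \<Rightarrow> (nat \<Rightarrow> real \<Rightarrow> real) \<Rightarrow> nat \<Rightarrow> real \<Rightarrow> real \<Rightarrow> real" where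
  "partial_expansion y z n \<epsilon> x =
     (if x < 0 then (\<Sum>i\<le>n. \<epsilon> ^ i * y i x) else (\<Sum>i\<le>n. \<epsilon> ^ i * z i x))"

end

theory Submission
  imports Defs
begin

text \<open>
  Put \<open>\<Lambda> = \<lambda> / \<epsilon>\<close>. On each half the perturbed equation becomes independent of \<open>\<epsilon>\<close>, namely
  \<open>(k u')' + \<Lambda> r u = 0\<close> and \<open>(\<kappa> u')' + \<Lambda> \<rho> u = 0\<close>; the small parameter survives only in the flux
  condition at 0. Shooting from the two outer ends, with value 0 and flux 1, produces at the
  interface the values \<open>F, G\<close> and the fluxes \<open>f, g\<close> of the left and of the reflected right solution,
  and \<open>\<Lambda>\<close> is an eigenvalue iff \<open>\<epsilon> F g + f G = 0\<close> (the function \<open>matching\<close>). For \<open>\<epsilon> = 0\<close> the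
  equation splits into \<open>f = 0\<close>, the spectrum of \<open>A1\<close>, and \<open>G = 0\<close>, the spectrum of \<open>A2_hat\<close>.

  Convergence of the eigenvalues with their numbering is a matter of counting zeros. By the Lagrange
  identity the vectors \<open>(F, f)\<close> and \<open>(G, g)\<close> rotate in one direction as \<open>\<Lambda>\<close> grows. Hence near a zero
  of exactly one of \<open>f\<close> and \<open>G\<close> there is exactly one perturbed zero, near a common zero there are
  exactly two, and there are no others below a given bound (\<open>count_below\<close>). These numbers are
  the algebraic multiplicities of the limit operator (\<open>alg_mult_eq_limit_mult\<close>): at a common zero it
  has a Jordan block of size two. So the \<open>j\<close>-th perturbed \<open>\<Lambda>\<close> converges to \<open>\<mu> j\<close>
  (\<open>scaled_eigenvalue_tendsto\<close>).

  If \<open>\<mu> j\<close> is not in the spectrum of \<open>A1\<close>, then \<open>f \<noteq> 0\<close> there, so \<open>\<alpha> f = \<epsilon> \<beta> g\<close> makes the amplitude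
  \<open>\<alpha>\<close> on the left of order \<open>\<epsilon>\<close>, and the normalization fixes the limit of the amplitude \<open>\<beta>\<close> on the
  right. Since the shooting solutions depend on \<open>\<Lambda>\<close> in a Lipschitz manner, the eigenfunctions
  converge (\<open>H1_convergence\<close>).

  For the expansions, the recursion for the coefficients says that the truncated series satisfy the
  equations with \<open>\<Lambda>\<close> replaced by \<open>M = \<mu> j + \<epsilon> \<nu> 1 + \<dots> + \<epsilon>^n \<nu> n\<close>, and the interface
  conditions, up to \<open>O(\<epsilon>^(n+1))\<close>. They are therefore multiples of the shooting solutions for \<open>M\<close>
  up to such errors, which gives \<open>matching \<epsilon> M = O(\<epsilon>^(n+1))\<close>. The zero is simple, uniformly
  in \<open>\<epsilon>\<close> (\<open>simple_zero_stability\<close>), so \<open>\<Lambda> - M = O(\<epsilon>^(n+1))\<close>, and comparing shooting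
  solutions for \<open>\<Lambda>\<close> and \<open>M\<close> gives the estimate for the eigenfunctions (\<open>asymptotic_expansion\<close>).
\<close>

section \<open>Sturm-Liouville equations as first-order systems\<close>

text \<open>
  A solution \<open>u\<close> of \<open>(p u')' + q u = g\<close> together with its flux \<open>v = p u'\<close>. Keeping the flux as a
  separate unknown avoids differentiating \<open>p\<close>, and the interface conditions are conditions on it.
\<close>
definition sl_system ::
    "real \<Rightarrow> real \<Rightarrow> (real \<Rightarrow> real) \<Rightarrow> (real \<Rightarrow> real) \<Rightarrow> (real \<Rightarrow> real) \<Rightarrow>
     (real \<Rightarrow> real) \<Rightarrow> (real \<Rightarrow> real) \<Rightarrow> bool" where
  "sl_system c d p q g u v \<longleftrightarrow>
     (\<forall>x\<in>{c..d}. (u has_real_derivative v x / p x) (at x within {c..d}) \<and>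
                 (v has_real_derivative g x - q x * u x) (at x within {c..d}))"

lemma sl_systemD:
  assumes "sl_system c d p q g u v" "x \<in> {c..d}"
  shows "(u has_real_derivative v x / p x) (at x within {c..d})"
    "(v has_real_derivative g x - q x * u x) (at x within {c..d})"
  using assms by (auto simp: sl_system_def)

lemma sl_system_continuous:
  assumes "sl_system c d p q g u v"
  shows "continuous_on {c..d} u" "continuous_on {c..d} v"
  using assms by (auto simp: sl_system_def intro!: DERIV_continuous_on)

lemma has_real_derivative_transform:
  assumes "x \<in> S" "\<And>x. x \<in> S \<Longrightarrow> g x = f x" "(f has_real_derivative D) (at x within S)"
  shows "(g has_real_derivative D) (at x within S)"
  using assms unfolding has_field_derivative_def by (rule has_derivative_transform)

lemma sl_system_cong:
  assumes "sl_system c d p q g u v"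
    and "\<And>x. x \<in> {c..d} \<Longrightarrow> p' x = p x" "\<And>x. x \<in> {c..d} \<Longrightarrow> u' x = u x"
      "\<And>x. x \<in> {c..d} \<Longrightarrow> v' x = v x" "\<And>x. x \<in> {c..d} \<Longrightarrow> g' x - q' x * u x = g x - q x * u x"
  shows "sl_system c d p' q' g' u' v'"
  unfolding sl_system_def
proof (intro ballI conjI)
  fix x assume x: "x \<in> {c..d}"
  show "(u' has_real_derivative v' x / p' x) (at x within {c..d})"
    using has_real_derivative_transform[OF x assms(3) sl_systemD(1)[OF assms(1) x]] assms(2,4) x
    by simp
  show "(v' has_real_derivative g' x - q' x * u' x) (at x within {c..d})"
    using has_real_derivative_transform[OF x assms(4) sl_systemD(2)[OF assms(1) x]] assms(3,5) x
    by simp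
qed

lemma sl_system_add:
  assumes "sl_system c d p q g u v" "sl_system c d p q g' u' v'"
  shows "sl_system c d p q (\<lambda>x. g x + g' x) (\<lambda>x. u x + u' x) (\<lambda>x. v x + v' x)"
  unfolding sl_system_def
proof (intro ballI conjI)
  fix x assume x: "x \<in> {c..d}"
  show "((\<lambda>x. u x + u' x) has_real_derivative (v x + v' x) / p x) (at x within {c..d})"
    using DERIV_add[OF sl_systemD(1)[OF assms(1) x] sl_systemD(1)[OF assms(2) x]]
    by (simp add: add_divide_distrib)
  show "((\<lambda>x. v x + v' x) has_real_derivative g x + g' x - q x * (u x + u' x)) (at x within {c..d})"
    using DERIV_add[OF sl_systemD(2)[OF assms(1) x] sl_systemD(2)[OF assms(2) x]]
    by (simp add: algebra_simps)
qed

lemma sl_system_scale: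
  assumes "sl_system c d p q g u v"
  shows "sl_system c d p q (\<lambda>x. s * g x) (\<lambda>x. s * u x) (\<lambda>x. s * v x)"
  unfolding sl_system_def
proof (intro ballI conjI)
  fix x assume x: "x \<in> {c..d}"
  show "((\<lambda>x. s * u x) has_real_derivative s * v x / p x) (at x within {c..d})"
    using DERIV_cmult[OF sl_systemD(1)[OF assms(1) x], of s] by simp
  show "((\<lambda>x. s * v x) has_real_derivative s * g x - q x * (s * u x)) (at x within {c..d})"
    using DERIV_cmult[OF sl_systemD(2)[OF assms(1) x], of s] by (simp add: algebra_simps)
qed

lemma sl_system_diff:
  assumes "sl_system c d p q g u v" "sl_system c d p q g' u' v'"
  shows "sl_system c d p q (\<lambda>x. g x - g' x) (\<lambda>x. u x - u' x) (\<lambda>x. v x - v' x)"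
  using sl_system_add[OF assms(1) sl_system_scale[OF assms(2), of "-1"]] by simp

lemma sl_system_sum:
  assumes "finite I" "\<And>i. i \<in> I \<Longrightarrow> sl_system c d p q (g i) (u i) (v i)"
  shows "sl_system c d p q (\<lambda>x. \<Sum>i\<in>I. g i x) (\<lambda>x. \<Sum>i\<in>I. u i x) (\<lambda>x. \<Sum>i\<in>I. v i x)"
  using assms
proof (induction I rule: finite_induct)
  case empty
  then show ?case by (simp add: sl_system_def)
next
  case (insert i I)
  then show ?case using sl_system_add by simp
qed

text \<open>
  Reflection turns data at the right end into data at the left end, so that shooting has to be
  treated in one direction only. The flux changes its sign.
\<close>
lemma sl_system_reflect:
  assumes "sl_system c d p q g u v"
  shows "sl_system (-d) (-c) (\<lambda>x. p (-x)) (\<lambda>x. q (-x)) (\<lambda>x. g (-x)) (\<lambda>x. u (-x)) (\<lambda>x. - v (-x))"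
  unfolding sl_system_def
proof (intro ballI conjI)
  fix x assume x: "x \<in> {-d..-c}"
  have im: "uminus ` {-d..-c} = {c..d}" by auto
  have m: "-x \<in> {c..d}" using x by auto
  have neg: "(uminus has_real_derivative -1) (at x within {-d..-c})"
    by (auto intro!: derivative_eq_intros)
  show "((\<lambda>x. u (- x)) has_real_derivative - v (- x) / p (- x)) (at x within {-d..-c})"
    using DERIV_image_chain[where g = uminus and s = "{-d..-c}" and f = u and x = x, unfolded im,
      OF sl_systemD(1)[OF assms m] neg] by (simp add: o_def)
  have "((\<lambda>x. v (- x)) has_real_derivative - (g (-x) - q (- x) * u (- x))) (at x within {-d..-c})"
    using DERIV_image_chain[where g = uminus and s = "{-d..-c}" and f = v and x = x, unfolded im,
      OF sl_systemD(2)[OF assms m] neg] by (simp add: o_def)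
  then show "((\<lambda>x. - v (- x)) has_real_derivative g (-x) - q (- x) * u (- x)) (at x within {-d..-c})"
    using DERIV_minus by fastforce
qed

lemma solves_SL_iff_sl_system:
  assumes "c < d" and p: "\<And>x. x \<in> {c..d} \<Longrightarrow> p x > 0"
  shows "solves_SL c d p q g u \<longleftrightarrow> sl_system c d p q g u (\<lambda>x. p x * Dv c d u x)"
proof -
  have "u differentiable (at x within {c..d}) \<longleftrightarrow>
      (u has_real_derivative p x * Dv c d u x / p x) (at x within {c..d})" if x: "x \<in> {c..d}" for x
    using p[OF x] vector_derivative_works[of u "at x within {c..d}"]
    by (auto simp: Dv_def has_real_derivative_iff_has_vector_derivative differentiable_def
        has_vector_derivative_def)
  then show ?thesis
    unfolding solves_SL_def sl_system_def by blast
qed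

lemma Dv_eqI:
  fixes u :: "real \<Rightarrow> 'a::euclidean_space"
  assumes "c < d" "x \<in> {c..d}" "(u has_vector_derivative D) (at x within {c..d})"
  shows "Dv c d u x = D"
  unfolding Dv_def using assms by (intro vector_derivative_within_closed_interval) auto

lemma sl_system_quasi_derivative:
  assumes "c < d" and p: "\<And>x. x \<in> {c..d} \<Longrightarrow> p x > 0" and "sl_system c d p q g u v"
    and x: "x \<in> {c..d}"
  shows "p x * Dv c d u x = v x"
proof -
  have "Dv c d u x = v x / p x"
    using Dv_eqI[OF assms(1) x] sl_systemD(1)[OF assms(3) x]
    by (simp add: has_real_derivative_iff_has_vector_derivative)
  then show ?thesis using p[OF x] by simp
qed

lemma sl_system_imp_solves_SL:
  assumes "c < d" and p: "\<And>x. x \<in> {c..d} \<Longrightarrow> p x > 0" and "sl_system c d p q g u v"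
  shows "solves_SL c d p q g u"
proof -
  have "sl_system c d p q g u (\<lambda>x. p x * Dv c d u x)"
    by (rule sl_system_cong[OF assms(3)]) (use sl_system_quasi_derivative[OF assms] in auto)
  then show ?thesis
    using solves_SL_iff_sl_system[of c d p] assms by blast
qed

text \<open>
  Gronwall's inequality for \<open>u\<^sup>2 + v\<^sup>2\<close>. Uniqueness, stability and the dependence on the spectral
  parameter all come from this one estimate.
\<close>
lemma sl_system_energy_estimate:
  assumes sys: "sl_system c d p q g u v"
    and P: "\<And>x. x \<in> {c..d} \<Longrightarrow> \<bar>1 / p x\<bar> \<le> P"
    and Q: "\<And>x. x \<in> {c..d} \<Longrightarrow> \<bar>q x\<bar> \<le> Q"
    and N: "\<And>x. x \<in> {c..d} \<Longrightarrow> \<bar>g x\<bar> \<le> N"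
    and x: "x \<in> {c..d}"
  shows "(u x)\<^sup>2 + (v x)\<^sup>2 \<le> ((u c)\<^sup>2 + (v c)\<^sup>2 + N\<^sup>2) * exp ((P + Q + 1) * (x - c))"
proof -
  define K where "K = P + Q + 1"
  define E where "E = (\<lambda>x. ((u x)\<^sup>2 + (v x)\<^sup>2 + N\<^sup>2) * exp (- K * (x - c)))"
  have PQ: "0 \<le> P" "0 \<le> Q"
    using P[OF x] Q[OF x] by linarith+
  have "E x \<le> E c"
  proof (rule DERIV_nonpos_imp_decreasing_open[where f = E and a = c and b = x])
    show "c \<le> x" using x by simp
    show "continuous_on {c..x} E"
      unfolding E_def
      by (intro continuous_intros continuous_on_subset[OF sl_system_continuous(1)[OF sys]]
          continuous_on_subset[OF sl_system_continuous(2)[OF sys]]) (use x in auto)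
    fix t assume t: "c < t" "t < x"
    then have tI: "t \<in> {c..d}" and at: "at t within {c..d} = at t"
      using x by (auto simp: at_within_Icc_at)
    note d = sl_systemD[OF sys tI, unfolded at]
    define E' where "E' = 2 * u t * (v t / p t) + 2 * v t * (g t - q t * u t)
        - K * ((u t)\<^sup>2 + (v t)\<^sup>2 + N\<^sup>2)"
    have D: "(E has_real_derivative E' * exp (- K * (t - c))) (at t)"
      unfolding E_def E'_def
      by (rule derivative_eq_intros d refl | simp)+ (simp add: algebra_simps power2_eq_square)
    \<comment> \<open>Every mixed term of \<open>E'\<close> is dominated by \<open>u\<^sup>2 + v\<^sup>2\<close> or by \<open>N\<^sup>2\<close>; \<open>K\<close> is the sum of the factors.\<close>
    have prod: "2 * \<bar>u t\<bar> * \<bar>v t\<bar> \<le> (u t)\<^sup>2 + (v t)\<^sup>2"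
      using sum_squares_bound[of "\<bar>u t\<bar>" "\<bar>v t\<bar>"] by simp
    have 1: "2 * u t * (v t / p t) \<le> P * ((u t)\<^sup>2 + (v t)\<^sup>2)"
    proof -
      have "2 * u t * (v t / p t) \<le> \<bar>1 / p t\<bar> * (2 * \<bar>u t\<bar> * \<bar>v t\<bar>)"
        using abs_ge_self[of "2 * u t * (v t / p t)"] by (simp add: abs_mult)
      also have "\<dots> \<le> P * ((u t)\<^sup>2 + (v t)\<^sup>2)"
        by (intro mult_mono P tI prod) (use PQ in auto)
      finally show ?thesis .
    qed
    have 2: "- (2 * v t * (q t * u t)) \<le> Q * ((u t)\<^sup>2 + (v t)\<^sup>2)"
    proof -
      have "- (2 * v t * (q t * u t)) \<le> \<bar>q t\<bar> * (2 * \<bar>u t\<bar> * \<bar>v t\<bar>)"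
        using abs_ge_minus_self[of "2 * v t * (q t * u t)"] by (simp add: abs_mult mult_ac)
      also have "\<dots> \<le> Q * ((u t)\<^sup>2 + (v t)\<^sup>2)"
        by (intro mult_mono Q tI prod) (use PQ in auto)
      finally show ?thesis .
    qed
    have "(g t)\<^sup>2 \<le> N\<^sup>2"
      using N[OF tI] by (metis abs_ge_zero power2_abs power_mono)
    then have 3: "2 * v t * g t \<le> (v t)\<^sup>2 + N\<^sup>2"
      using sum_squares_bound[of "v t" "g t"] by linarith
    have "0 \<le> (P + Q) * N\<^sup>2" "0 \<le> (u t)\<^sup>2" using PQ by auto
    moreover have "E' = 2 * u t * (v t / p t) + 2 * v t * g t + - (2 * v t * (q t * u t))
        - P * ((u t)\<^sup>2 + (v t)\<^sup>2) - Q * ((u t)\<^sup>2 + (v t)\<^sup>2) - (P + Q) * N\<^sup>2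
        - (u t)\<^sup>2 - (v t)\<^sup>2 - N\<^sup>2"
      unfolding E'_def K_def by (simp add: algebra_simps)
    ultimately have "E' \<le> 0"
      using 1 2 3 by linarith
    then show "\<exists>y. (E has_real_derivative y) (at t) \<and> y \<le> 0"
      using D by (metis exp_ge_zero mult_nonpos_nonneg)
  qed
  then have "((u x)\<^sup>2 + (v x)\<^sup>2 + N\<^sup>2) \<le> ((u c)\<^sup>2 + (v c)\<^sup>2 + N\<^sup>2) * exp (K * (x - c))"
    unfolding E_def by (simp add: exp_minus divide_inverse[symmetric] pos_divide_le_eq)
  then show ?thesis
    unfolding K_def by (smt (verit) zero_le_power2)
qed

lemma continuous_on_Icc_bounded:
  fixes f :: "real \<Rightarrow> real"
  assumes "continuous_on {c..d} f"
  obtains B where "0 < B" "\<And>x. x \<in> {c..d} \<Longrightarrow> \<bar>f x\<bar> \<le> B"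
proof -
  have "bounded (f ` {c..d})"
    using assms by (intro compact_imp_bounded compact_continuous_image) auto
  then show ?thesis
    using that unfolding bounded_pos by auto
qed

lemma sl_system_unique:
  assumes "sl_system c d p q g u v" "sl_system c d p q g u' v'"
    and p: "continuous_on {c..d} p" "\<And>x. x \<in> {c..d} \<Longrightarrow> p x > 0" and q: "continuous_on {c..d} q"
    and "u c = u' c" "v c = v' c" and x: "x \<in> {c..d}"
  shows "u x = u' x" "v x = v' x"
proof -
  have "continuous_on {c..d} (\<lambda>x. 1 / p x)"
    using p by (intro continuous_intros) fastforce+
  then obtain P where P: "\<And>x. x \<in> {c..d} \<Longrightarrow> \<bar>1 / p x\<bar> \<le> P"
    using continuous_on_Icc_bounded by blast
  obtain Q where Q: "\<And>x. x \<in> {c..d} \<Longrightarrow> \<bar>q x\<bar> \<le> Q"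
    using continuous_on_Icc_bounded[OF q] by blast
  have "(u x - u' x)\<^sup>2 + (v x - v' x)\<^sup>2 \<le> 0"
    using sl_system_energy_estimate[OF sl_system_diff[OF assms(1,2)] P Q, of 0 x] assms(6-8) by simp
  then show "u x = u' x" "v x = v' x"
    by (smt (verit) zero_le_power2 zero_eq_power2)+
qed

text \<open>
  The integrand is the derivative of the Wronskian \<open>v1 u2 - u1 v2\<close>: the products of the fluxes
  cancel because both systems have the same \<open>p\<close>.
\<close>
lemma sl_system_lagrange:
  assumes "c \<le> d" "sl_system c d p q1 g1 u1 v1" "sl_system c d p q2 g2 u2 v2"
  shows "((\<lambda>x. (g1 x - q1 x * u1 x) * u2 x - (g2 x - q2 x * u2 x) * u1 x) has_integral
    (v1 d * u2 d - u1 d * v2 d) - (v1 c * u2 c - u1 c * v2 c)) {c..d}"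
proof (rule fundamental_theorem_of_calculus[OF assms(1)])
  fix x assume x: "x \<in> {c..d}"
  have "((\<lambda>x. v1 x * u2 x - u1 x * v2 x) has_real_derivative
      (g1 x - q1 x * u1 x) * u2 x - (g2 x - q2 x * u2 x) * u1 x) (at x within {c..d})"
    by (rule derivative_eq_intros sl_systemD[OF assms(2) x] sl_systemD[OF assms(3) x] refl)+
      (simp add: algebra_simps)
  then show "((\<lambda>x. v1 x * u2 x - u1 x * v2 x) has_vector_derivative
      (g1 x - q1 x * u1 x) * u2 x - (g2 x - q2 x * u2 x) * u1 x) (at x within {c..d})"
    by (simp add: has_real_derivative_iff_has_vector_derivative)
qed

lemma integral_bound_by_power:
  fixes f :: "real \<Rightarrow> real"
  assumes "c \<le> x" "f integrable_on {c..x}" "\<And>s. s \<in> {c..x} \<Longrightarrow> \<bar>f s\<bar> \<le> B * (s - c) ^ n / fact n"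
  shows "\<bar>integral {c..x} f\<bar> \<le> B * (x - c) ^ Suc n / fact (Suc n)"
proof -
  have "((\<lambda>s. B * (s - c) ^ n / fact n) has_integral
      B * (x - c) ^ Suc n / fact (Suc n) - B * (c - c) ^ Suc n / fact (Suc n)) {c..x}"
  proof (rule fundamental_theorem_of_calculus[OF assms(1)])
    fix s
    have "((\<lambda>s. B * (s - c) ^ Suc n / fact (Suc n)) has_real_derivative B * (s - c) ^ n / fact n)
        (at s within {c..x})"
      by (auto intro!: derivative_eq_intros simp del: power_Suc fact_Suc) (simp add: divide_simps)
    then show "((\<lambda>s. B * (s - c) ^ Suc n / fact (Suc n)) has_vector_derivative B * (s - c) ^ n / fact n)
        (at s within {c..x})"
      by (simp add: has_real_derivative_iff_has_vector_derivative)
  qed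
  then have I: "((\<lambda>s. B * (s - c) ^ n / fact n) has_integral B * (x - c) ^ Suc n / fact (Suc n)) {c..x}"
    by simp
  have "norm (integral {c..x} f) \<le> integral {c..x} (\<lambda>s. B * (s - c) ^ n / fact n)"
    by (rule integral_norm_bound_integral) (use assms I in \<open>auto simp: has_integral_iff\<close>)
  then show ?thesis using I by (simp add: has_integral_iff)
qed

text \<open>
  Picard iteration. Integrating the system twice gives \<open>u = h0 - T u\<close>, where \<open>h0\<close> contains the data
  and \<open>T h = \<integral> 1/p \<integral> q h\<close>. The \<open>n\<close>-th iterate of \<open>T\<close> is bounded by \<open>K^n (x - c)^n / n!\<close>, so the
  series of the \<open>(-T)^n h0\<close> converges uniformly.
\<close>
lemma sl_system_exists:
  assumes "c < d" and p: "continuous_on {c..d} p" "\<And>x. x \<in> {c..d} \<Longrightarrow> p x > 0"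
    and q: "continuous_on {c..d} q" and g: "continuous_on {c..d} g"
  shows "\<exists>u v. sl_system c d p q g u v \<and> u c = A \<and> v c = B"
proof -
  have cp: "continuous_on {c..d} (\<lambda>x. 1 / p x)"
    using p by (intro continuous_intros) fastforce+
  obtain P where P: "0 < P" "\<And>x. x \<in> {c..d} \<Longrightarrow> \<bar>1 / p x\<bar> \<le> P"
    using continuous_on_Icc_bounded[OF cp] by blast
  obtain Q where Q: "0 < Q" "\<And>x. x \<in> {c..d} \<Longrightarrow> \<bar>q x\<bar> \<le> Q"
    using continuous_on_Icc_bounded[OF q] by blast
  define K where "K = P * (Q * (d - c))"
  have K: "0 < K" using P Q assms(1) by (simp add: K_def)
  define V where "V = (\<lambda>h x. integral {c..x} (\<lambda>s. q s * h s))"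
  define T where "T = (\<lambda>h x. integral {c..x} (\<lambda>s. 1 / p s * V h s))"
  have ci: "continuous_on {c..d} (\<lambda>x. integral {c..x} f)" if "continuous_on {c..d} f" for f :: "real \<Rightarrow> real"
    using that by (intro indefinite_integral_continuous_1 integrable_continuous_real)
  have int: "f integrable_on {c..x}" if "continuous_on {c..d} f" "x \<in> {c..d}" for f :: "real \<Rightarrow> real" and x
    using that by (intro integrable_continuous_real continuous_on_subset[OF that(1)]) auto
  have cV: "continuous_on {c..d} (V h)" if "continuous_on {c..d} h" for h
    unfolding V_def by (intro ci continuous_on_mult q that)
  have cT: "continuous_on {c..d} (T h)" if "continuous_on {c..d} h" for h
    unfolding T_def by (intro ci continuous_on_mult cp cV that)
  have T_bound: "\<bar>T h x\<bar> \<le> K * M * (x - c) ^ Suc n / fact (Suc n)"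
    if h: "continuous_on {c..d} h" and hM: "\<And>s. s \<in> {c..d} \<Longrightarrow> \<bar>h s\<bar> \<le> M * (s - c) ^ n / fact n"
      and x: "x \<in> {c..d}" for h M n x
    unfolding T_def
  proof (rule integral_bound_by_power)
    show "c \<le> x" using x by simp
    show "(\<lambda>s. 1 / p s * V h s) integrable_on {c..x}"
      by (intro int continuous_on_mult cp cV h x)
    fix s assume "s \<in> {c..x}"
    then have s: "s \<in> {c..d}" using x by auto
    have M: "0 \<le> M"
    proof -
      have "0 \<le> M * ((d - c) ^ n / fact n)" "0 < (d - c) ^ n / (fact n :: real)"
        using order_trans[OF abs_ge_zero hM[of d]] assms(1) by auto
      then show ?thesis by (metis zero_le_mult_iff not_less)
    qed
    have "norm (V h s) \<le> (Q * (M * (s - c) ^ n / fact n)) * (s - c)"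
      unfolding V_def
    proof (rule integral_bound)
      fix t assume "t \<in> {c..s}"
      then have t: "t \<in> {c..d}" "(t - c) ^ n \<le> (s - c) ^ n"
        using s by (auto intro: power_mono)
      have "\<bar>h t\<bar> \<le> M * (s - c) ^ n / fact n"
        using hM[OF t(1)] t(2) M by (smt (verit) divide_right_mono fact_ge_zero mult_left_mono)
      then show "norm (q t * h t) \<le> Q * (M * (s - c) ^ n / fact n)"
        unfolding real_norm_def abs_mult using Q t(1) by (intro mult_mono) auto
    next
      show "continuous_on {c..s} (\<lambda>t. q t * h t)"
        by (rule continuous_on_subset[of "{c..d}"], intro continuous_on_mult q h) (use s in auto)
    qed (use s in auto)
    also have "\<dots> \<le> (Q * (M * (s - c) ^ n / fact n)) * (d - c)"
      using s M Q(1) by (intro mult_left_mono) auto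
    finally have "\<bar>1 / p s\<bar> * \<bar>V h s\<bar> \<le> P * ((Q * (M * (s - c) ^ n / fact n)) * (d - c))"
      using P s by (intro mult_mono) auto
    then show "\<bar>1 / p s * V h s\<bar> \<le> K * M * (s - c) ^ n / fact n"
      unfolding K_def by (simp add: abs_mult mult_ac)
  qed
  define W0 where "W0 = (\<lambda>x. B + integral {c..x} g)"
  define h0 where "h0 = (\<lambda>x. A + integral {c..x} (\<lambda>s. 1 / p s * W0 s))"
  have cW0: "continuous_on {c..d} W0"
    unfolding W0_def by (intro continuous_intros ci g)
  have ch0: "continuous_on {c..d} h0"
    unfolding h0_def by (intro continuous_intros ci continuous_on_mult cp cW0)
  obtain M where M: "0 < M" "\<And>x. x \<in> {c..d} \<Longrightarrow> \<bar>h0 x\<bar> \<le> M"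
    using continuous_on_Icc_bounded[OF ch0] by blast
  define h where "h = rec_nat h0 (\<lambda>n f x. - T f x)"
  have h_0: "h 0 = h0" and h_Suc: "\<And>n. h (Suc n) = (\<lambda>x. - T (h n) x)"
    unfolding h_def by auto
  have ch: "continuous_on {c..d} (h n)" for n
    by (induction n) (auto simp: h_0 h_Suc ch0 cT intro: continuous_on_minus)
  have hb: "\<bar>h n x\<bar> \<le> K ^ n * M * (x - c) ^ n / fact n" if "x \<in> {c..d}" for n x
    using that
  proof (induction n arbitrary: x)
    case 0
    then show ?case using M by (simp add: h_0)
  next
    case (Suc n)
    show ?case
      using T_bound[OF ch Suc.IH Suc.prems] by (simp add: h_Suc mult_ac)
  qed
  \<comment> \<open>The partial sums satisfy \<open>S (Suc n) = h0 - T (S n)\<close>; the limit inherits the fixed point equation.\<close>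
  define S where "S = (\<lambda>n x. \<Sum>i<n. h i x)"
  define u where "u = (\<lambda>x. \<Sum>i. h i x)"
  have lim: "uniform_limit {c..d} S u sequentially"
    unfolding S_def u_def
  proof (rule Weierstrass_m_test)
    fix n x assume x: "x \<in> {c..d}"
    have "K ^ n * M * (x - c) ^ n / fact n \<le> K ^ n * M * (d - c) ^ n / fact n"
      using x K M by (intro divide_right_mono mult_left_mono power_mono) auto
    then show "norm (h n x) \<le> M * ((K * (d - c)) ^ n /\<^sub>R fact n)"
      using hb[OF x, of n] by (simp add: power_mult_distrib mult_ac divide_simps)
  next
    show "summable (\<lambda>n. M * ((K * (d - c)) ^ n /\<^sub>R fact n))"
      by (intro summable_mult summable_exp_generic)
  qed
  have cS: "continuous_on {c..d} (S n)" for n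
    unfolding S_def by (intro continuous_intros ch)
  have cu: "continuous_on {c..d} u"
    by (rule uniform_limit_theorem[OF _ lim]) (auto simp: cS)
  have T_diff: "T f x - T f' x = T (\<lambda>s. f s - f' s) x"
    if f: "continuous_on {c..d} f" "continuous_on {c..d} f'" and x: "x \<in> {c..d}" for f f' x
  proof -
    have V: "V f s - V f' s = V (\<lambda>s. f s - f' s) s" if s: "s \<in> {c..d}" for s
      unfolding V_def using s f q
      by (subst integral_diff[symmetric]) (auto intro!: int continuous_intros simp: algebra_simps)
    have "T f x - T f' x = integral {c..x} (\<lambda>s. 1 / p s * V f s - 1 / p s * V f' s)"
      unfolding T_def using x f by (intro integral_diff[symmetric] int continuous_on_mult cp cV)
    also have "\<dots> = integral {c..x} (\<lambda>s. 1 / p s * V (\<lambda>s. f s - f' s) s)"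
      using x V by (intro integral_cong) (auto simp: algebra_simps diff_divide_distrib[symmetric])
    finally show ?thesis unfolding T_def .
  qed
  have step: "S (Suc n) x = h0 x - T (S n) x" if x: "x \<in> {c..d}" for n x
  proof (induction n)
    case 0
    have "T (S 0) x = 0" unfolding T_def V_def S_def by simp
    then show ?case by (simp add: S_def h_0)
  next
    case (Suc n)
    have "T (S (Suc n)) x - T (S n) x = T (h n) x"
      using T_diff[OF cS cS x, of "Suc n" n] by (simp add: S_def)
    then show ?case using Suc by (simp add: S_def h_Suc)
  qed
  have fixp: "u x = h0 x - T u x" if x: "x \<in> {c..d}" for x
  proof -
    have "(\<lambda>n. T (S n) x) \<longlonglongrightarrow> T u x"
    proof (rule LIMSEQ_I)
      fix e :: real assume e: "0 < e"
      define e' where "e' = e / (K * (d - c) + 1)"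
      have e': "0 < e'" "K * (d - c) + 1 > 0"
        using e K assms(1) unfolding e'_def by (simp_all add: add_pos_pos)
      obtain n0 where n0: "\<And>n s. n \<ge> n0 \<Longrightarrow> s \<in> {c..d} \<Longrightarrow> dist (S n s) (u s) < e'"
        using uniform_limitD[OF lim e'(1)] unfolding eventually_sequentially by blast
      have "norm (T (S n) x - T u x) < e" if "n \<ge> n0" for n
      proof -
        have "\<bar>T (\<lambda>s. S n s - u s) x\<bar> \<le> K * e' * (x - c) ^ Suc 0 / fact (Suc 0)"
          by (rule T_bound) (use n0[OF that] cS cu x in
              \<open>auto simp: dist_real_def less_imp_le intro: continuous_intros\<close>)
        also have "\<dots> \<le> e' * (K * (d - c))"
          using x K e' by (simp add: mult_left_mono)
        also have "\<dots> < e' * (K * (d - c) + 1)"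
          using e' by simp
        also have "\<dots> = e" using e' by (simp add: e'_def)
        finally show ?thesis using T_diff[OF cS cu x] by simp
      qed
      then show "\<exists>no. \<forall>n\<ge>no. norm (T (S n) x - T u x) < e" by blast
    qed
    then have "(\<lambda>n. S (Suc n) x) \<longlonglongrightarrow> h0 x - T u x"
      by (simp add: step[OF x] tendsto_diff)
    moreover have "(\<lambda>n. S (Suc n) x) \<longlonglongrightarrow> u x"
      using tendsto_uniform_limitI[OF lim x] LIMSEQ_Suc by blast
    ultimately show ?thesis using LIMSEQ_unique by blast
  qed
  define v where "v = (\<lambda>x. W0 x - V u x)"
  have cv: "continuous_on {c..d} v"
    unfolding v_def by (intro continuous_intros cW0 cV cu)
  have u_eq: "u x = A + integral {c..x} (\<lambda>s. 1 / p s * v s)" if x: "x \<in> {c..d}" for x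
  proof -
    have "integral {c..x} (\<lambda>s. 1 / p s * v s) =
        integral {c..x} (\<lambda>s. 1 / p s * W0 s) - integral {c..x} (\<lambda>s. 1 / p s * V u s)"
      unfolding v_def using x
      by (subst integral_diff[symmetric])
        (auto intro!: int continuous_on_mult cp cW0 cV cu simp del: times_divide_eq_left
          simp: right_diff_distrib)
    then show ?thesis using fixp[OF x] by (simp add: h0_def T_def)
  qed
  have v_eq: "v x = B + integral {c..x} (\<lambda>s. g s - q s * u s)" if x: "x \<in> {c..d}" for x
    unfolding v_def W0_def V_def using x
    by (subst integral_diff) (auto intro!: int continuous_on_mult q cu g)
  have ftc: "((\<lambda>x. C + integral {c..x} f) has_real_derivative f x) (at x within {c..d})"
    if "continuous_on {c..d} f" "x \<in> {c..d}" for f x and C :: real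
    using integral_has_real_derivative[OF that] DERIV_const[of C] DERIV_add by fastforce
  have "sl_system c d p q g u v"
    unfolding sl_system_def
  proof (intro ballI conjI)
    fix x assume x: "x \<in> {c..d}"
    have "((\<lambda>x. A + integral {c..x} (\<lambda>s. 1 / p s * v s)) has_real_derivative 1 / p x * v x) (at x within {c..d})"
      by (rule ftc[OF _ x]) (intro continuous_on_mult cp cv)
    then show "(u has_real_derivative v x / p x) (at x within {c..d})"
      using has_real_derivative_transform[OF x u_eq] by simp
    have "((\<lambda>x. B + integral {c..x} (\<lambda>s. g s - q s * u s)) has_real_derivative g x - q x * u x) (at x within {c..d})"
      by (rule ftc[OF _ x]) (intro continuous_intros q cu g)
    then show "(v has_real_derivative g x - q x * u x) (at x within {c..d})"
      using has_real_derivative_transform[OF x v_eq] by simp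
  qed
  moreover have "u c = A" "v c = B"
    using u_eq[of c] v_eq[of c] assms(1) by auto
  ultimately show ?thesis by blast
qed

section \<open>Shooting solutions and the spectral parameter\<close>

lemma integral_pos_of_continuous_nonneg:
  fixes f :: "real \<Rightarrow> real"
  assumes "c < d" "continuous_on {c..d} f" "\<And>x. x \<in> {c..d} \<Longrightarrow> f x \<ge> 0" "x0 \<in> {c..d}" "f x0 > 0"
  shows "integral {c..d} f > 0"
proof -
  have "integral {c..d} f \<noteq> 0"
    using integral_eq_0_iff[OF assms(2,1,3)] assms(4,5) by auto
  moreover have "integral {c..d} f \<ge> 0"
    by (intro integral_nonneg integrable_continuous_real assms)
  ultimately show ?thesis by linarith
qed

text \<open>
  The interval ends at the interface 0. Its outer end is \<open>c\<close>, where the Dirichlet condition is imposed.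
\<close>
locale sl_interval =
  fixes c :: real and p w :: "real \<Rightarrow> real"
  assumes c_neg: "c < 0"
    and p_cont: "continuous_on {c..0} p" and p_pos: "\<And>x. x \<in> {c..0} \<Longrightarrow> p x > 0"
    and w_cont: "continuous_on {c..0} w" and w_pos: "\<And>x. x \<in> {c..0} \<Longrightarrow> w x > 0"
begin

abbreviation sys :: "real \<Rightarrow> (real \<Rightarrow> real) \<Rightarrow> (real \<Rightarrow> real) \<Rightarrow> (real \<Rightarrow> real) \<Rightarrow> bool" where
  "sys t g u v \<equiv> sl_system c 0 p (\<lambda>x. t * w x) g u v"

text \<open>
  The shooting solution and its flux, started at the outer end with value 0 and flux 1. Every solution
  of the homogeneous equation vanishing there is a multiple of it.
\<close>
definition sol_flux :: "real \<Rightarrow> (real \<Rightarrow> real) \<times> (real \<Rightarrow> real)" where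
  "sol_flux t = (SOME uv. sys t (\<lambda>x. 0) (fst uv) (snd uv) \<and> fst uv c = 0 \<and> snd uv c = 1)"

definition sol :: "real \<Rightarrow> real \<Rightarrow> real" where "sol t = fst (sol_flux t)"
definition flux :: "real \<Rightarrow> real \<Rightarrow> real" where "flux t = snd (sol_flux t)"

lemma qw_cont: "continuous_on {c..0} (\<lambda>x. t * w x)"
  by (intro continuous_intros w_cont)

lemma sol_sys: "sys t (\<lambda>x. 0) (sol t) (flux t)"
  and sol_left [simp]: "sol t c = 0" and flux_left [simp]: "flux t c = 1"
proof -
  obtain u v where uv: "sys t (\<lambda>x. 0) u v" "u c = 0" "v c = 1"
    using sl_system_exists[OF c_neg p_cont p_pos qw_cont continuous_on_const, where A = 0 and B = 1]
    by metis
  have "sys t (\<lambda>x. 0) (fst (sol_flux t)) (snd (sol_flux t)) \<and>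
      fst (sol_flux t) c = 0 \<and> snd (sol_flux t) c = 1"
    unfolding sol_flux_def by (rule someI_ex) (use uv in \<open>force intro: exI[of _ "(u, v)"]\<close>)
  then show "sys t (\<lambda>x. 0) (sol t) (flux t)" "sol t c = 0" "flux t c = 1"
    unfolding sol_def flux_def by blast+
qed

lemmas sol_cont = sl_system_continuous(1)[OF sol_sys]
  and flux_cont = sl_system_continuous(2)[OF sol_sys]

lemma sys_unique:
  assumes "sys t g u v" "sys t g u' v'" "u c = u' c" "v c = v' c" "x \<in> {c..0}"
  shows "u x = u' x" "v x = v' x"
  by (rule sl_system_unique[OF assms(1,2) p_cont p_pos qw_cont assms(3,4,5)], assumption)+

lemma homogeneous_eq_sol:
  assumes "sys t (\<lambda>x. 0) u v" "u c = 0" "x \<in> {c..0}"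
  shows "u x = v c * sol t x" "v x = v c * flux t x"
proof -
  have "sys t (\<lambda>x. 0) (\<lambda>x. v c * sol t x) (\<lambda>x. v c * flux t x)"
    using sl_system_scale[OF sol_sys, of t "v c"] by simp
  note unique = sys_unique[OF assms(1) this _ _ assms(3)]
  show "u x = v c * sol t x" "v x = v c * flux t x"
    by (rule unique; simp add: assms(2))+
qed

text \<open>
  Solutions for different parameters become comparable by moving the difference of the parameters
  to the right-hand side.
\<close>
lemma sys_change_parameter:
  assumes "sys t g u v"
  shows "sys s (\<lambda>x. g x + (s - t) * w x * u x) u v"
  by (rule sl_system_cong[OF assms]) (auto simp: algebra_simps)

text \<open>
  One constant for all parameters in \<open>[-T, T]\<close>: this uniformity makes error terms of solutions with
  \<open>\<epsilon>\<close>-dependent parameter uniform in \<open>\<epsilon>\<close>.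
\<close>
definition stability_constant :: "real \<Rightarrow> real \<Rightarrow> bool" where
  "stability_constant T C \<longleftrightarrow> 0 < C \<and>
     (\<forall>t g u v N x. \<bar>t\<bar> \<le> T \<and> sys t g u v \<and> u c = 0 \<and> (\<forall>x\<in>{c..0}. \<bar>g x\<bar> \<le> N) \<and> x \<in> {c..0} \<longrightarrow>
        \<bar>u x\<bar> \<le> C * (\<bar>v c\<bar> + N) \<and> \<bar>v x\<bar> \<le> C * (\<bar>v c\<bar> + N))"

lemma stability_constantD:
  assumes "stability_constant T C" "\<bar>t\<bar> \<le> T" "sys t g u v" "u c = 0"
    "\<And>x. x \<in> {c..0} \<Longrightarrow> \<bar>g x\<bar> \<le> N" "x \<in> {c..0}"
  shows "\<bar>u x\<bar> \<le> C * (\<bar>v c\<bar> + N)" "\<bar>v x\<bar> \<le> C * (\<bar>v c\<bar> + N)"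
  using assms unfolding stability_constant_def by blast+

lemma stability: "\<exists>C. stability_constant T C"
proof -
  have "continuous_on {c..0} (\<lambda>x. 1 / p x)"
    by (intro continuous_intros p_cont) (use p_pos in fastforce)
  then obtain P where P: "0 < P" "\<And>x. x \<in> {c..0} \<Longrightarrow> \<bar>1 / p x\<bar> \<le> P"
    using continuous_on_Icc_bounded by blast
  obtain W where W: "0 < W" "\<And>x. x \<in> {c..0} \<Longrightarrow> \<bar>w x\<bar> \<le> W"
    using continuous_on_Icc_bounded[OF w_cont] by blast
  define K where "K = P + \<bar>T\<bar> * W + 1"
  define C where "C = exp (K * (- c) / 2)"
  have "K > 0" using P(1) W(1) unfolding K_def by (simp add: add_nonneg_pos)
  have C2: "C\<^sup>2 = exp (K * (- c))"
    unfolding C_def power2_eq_square exp_add[symmetric] by simp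
  have "\<bar>u x\<bar> \<le> C * (\<bar>v c\<bar> + N) \<and> \<bar>v x\<bar> \<le> C * (\<bar>v c\<bar> + N)"
    if t: "\<bar>t\<bar> \<le> T" and s: "sys t g u v" and u: "u c = 0"
      and N: "\<And>x. x \<in> {c..0} \<Longrightarrow> \<bar>g x\<bar> \<le> N" and x: "x \<in> {c..0}" for t g u v N x
  proof -
    have N0: "0 \<le> N" using N[OF x] by linarith
    have Q: "\<bar>t * w y\<bar> \<le> \<bar>T\<bar> * W" if "y \<in> {c..0}" for y
      unfolding abs_mult using t W(2)[OF that] by (intro mult_mono) auto
    have "(u x)\<^sup>2 + (v x)\<^sup>2 \<le> ((v c)\<^sup>2 + N\<^sup>2) * exp (K * (x - c))"
      using sl_system_energy_estimate[OF s P(2) Q N x] u by (simp add: K_def)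
    also have "\<dots> \<le> (\<bar>v c\<bar> + N)\<^sup>2 * C\<^sup>2"
    proof (intro mult_mono)
      show "exp (K * (x - c)) \<le> C\<^sup>2"
        unfolding C2 exp_le_cancel_iff using x \<open>K > 0\<close> by (intro mult_left_mono) auto
    qed (use N0 in \<open>auto simp: power2_sum\<close>)
    finally have *: "(u x)\<^sup>2 + (v x)\<^sup>2 \<le> (C * (\<bar>v c\<bar> + N))\<^sup>2"
      by (simp add: power_mult_distrib mult.commute)
    have "0 \<le> C * (\<bar>v c\<bar> + N)" using N0 by (simp add: C_def)
    moreover have "\<bar>u x\<bar>\<^sup>2 \<le> (C * (\<bar>v c\<bar> + N))\<^sup>2" "\<bar>v x\<bar>\<^sup>2 \<le> (C * (\<bar>v c\<bar> + N))\<^sup>2"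
      unfolding power2_abs using * zero_le_power2[of "u x"] zero_le_power2[of "v x"] by linarith+
    ultimately show ?thesis
      using power2_le_imp_le by blast
  qed
  moreover have "0 < C" by (simp add: C_def)
  ultimately show ?thesis
    unfolding stability_constant_def by blast
qed

lemma sol_bounded:
  "\<exists>B>0. \<forall>t x. \<bar>t\<bar> \<le> T \<longrightarrow> x \<in> {c..0} \<longrightarrow> \<bar>sol t x\<bar> \<le> B \<and> \<bar>flux t x\<bar> \<le> B"
proof -
  obtain C where C: "stability_constant T C"
    using stability by blast
  have "\<bar>sol t x\<bar> \<le> C" "\<bar>flux t x\<bar> \<le> C" if "\<bar>t\<bar> \<le> T" "x \<in> {c..0}" for t x
    using stability_constantD[OF C that(1) sol_sys sol_left _ that(2), of 0] by simp_all
  moreover have "0 < C" using C by (simp add: stability_constant_def)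
  ultimately show ?thesis by blast
qed

lemma sol_Lipschitz:
  "\<exists>L>0. \<forall>s t x. \<bar>s\<bar> \<le> T \<longrightarrow> \<bar>t\<bar> \<le> T \<longrightarrow> x \<in> {c..0} \<longrightarrow>
      \<bar>sol s x - sol t x\<bar> \<le> L * \<bar>s - t\<bar> \<and> \<bar>flux s x - flux t x\<bar> \<le> L * \<bar>s - t\<bar>"
proof -
  obtain C where C: "stability_constant T C"
    using stability by blast
  obtain B where B: "0 < B"
    "\<And>t x. \<bar>t\<bar> \<le> T \<Longrightarrow> x \<in> {c..0} \<Longrightarrow> \<bar>sol t x\<bar> \<le> B \<and> \<bar>flux t x\<bar> \<le> B"
    using sol_bounded by blast
  obtain W where W: "0 < W" "\<And>x. x \<in> {c..0} \<Longrightarrow> \<bar>w x\<bar> \<le> W"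
    using continuous_on_Icc_bounded[OF w_cont] by blast
  have "\<bar>sol s x - sol t x\<bar> \<le> C * (W * B) * \<bar>s - t\<bar> \<and> \<bar>flux s x - flux t x\<bar> \<le> C * (W * B) * \<bar>s - t\<bar>"
    if *: "\<bar>s\<bar> \<le> T" "\<bar>t\<bar> \<le> T" "x \<in> {c..0}" for s t x
  proof -
    have d: "sys s (\<lambda>x. 0 - (0 + (s - t) * w x * sol t x)) (\<lambda>x. sol s x - sol t x) (\<lambda>x. flux s x - flux t x)"
      by (intro sl_system_diff sol_sys sys_change_parameter)
    have N: "\<bar>0 - (0 + (s - t) * w y * sol t y)\<bar> \<le> \<bar>s - t\<bar> * (W * B)" if y: "y \<in> {c..0}" for y
    proof -
      have "\<bar>w y\<bar> * \<bar>sol t y\<bar> \<le> W * B"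
        using W(2)[OF y] B(2)[OF *(2) y] W(1) by (intro mult_mono) auto
      then have "\<bar>s - t\<bar> * (\<bar>w y\<bar> * \<bar>sol t y\<bar>) \<le> \<bar>s - t\<bar> * (W * B)"
        by (intro mult_left_mono) auto
      then show ?thesis by (simp add: abs_mult mult.assoc)
    qed
    show ?thesis
      using stability_constantD[OF C *(1) d _ N *(3)] by (simp add: mult_ac)
  qed
  moreover have "0 < C * (W * B)"
    using B W C by (simp add: stability_constant_def)
  ultimately show ?thesis by blast
qed

lemma endpoint_isCont: "isCont (\<lambda>t. sol t 0) t" "isCont (\<lambda>t. flux t 0) t"
proof -
  obtain L where L: "0 < L" "\<And>s s' x. \<bar>s\<bar> \<le> \<bar>t\<bar> + 1 \<Longrightarrow> \<bar>s'\<bar> \<le> \<bar>t\<bar> + 1 \<Longrightarrow> x \<in> {c..0} \<Longrightarrow>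
      \<bar>sol s x - sol s' x\<bar> \<le> L * \<bar>s - s'\<bar> \<and> \<bar>flux s x - flux s' x\<bar> \<le> L * \<bar>s - s'\<bar>"
    using sol_Lipschitz[of "\<bar>t\<bar> + 1"] by blast
  have z: "(0::real) \<in> {c..0}" using c_neg by simp
  have near: "\<forall>\<^sub>F s in at t. dist s t < 1"
    by (auto simp: eventually_at intro: exI[of _ 1])
  have "\<forall>\<^sub>F s in at t. norm (sol s 0 - sol t 0) \<le> L * \<bar>s - t\<bar>"
    "\<forall>\<^sub>F s in at t. norm (flux s 0 - flux t 0) \<le> L * \<bar>s - t\<bar>"
    using near by (eventually_elim, use L(2)[of _ t 0] z in \<open>auto simp: dist_real_def\<close>)+
  note bounds = this
  have "((\<lambda>s. L * \<bar>s - t\<bar>) \<longlongrightarrow> 0) (at t)"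
    by (auto intro!: tendsto_eq_intros)
  note null = Lim_null_comparison[OF _ this]
  have lim: "((\<lambda>s. sol s 0 - sol t 0) \<longlongrightarrow> 0) (at t)"
    "((\<lambda>s. flux s 0 - flux t 0) \<longlongrightarrow> 0) (at t)"
    using null[OF bounds(1)] null[OF bounds(2)] by blast+
  show "isCont (\<lambda>t. sol t 0) t" "isCont (\<lambda>t. flux t 0) t"
    unfolding isCont_def by (rule LIM_zero_cancel, rule lim)+
qed

text \<open>
  A solution vanishing identically would have flux 0 at \<open>c\<close>.
\<close>
lemma sol_nonzero: "\<exists>x\<in>{c..0}. sol t x \<noteq> 0"
proof (rule ccontr)
  assume "\<not> ?thesis"
  then have z: "\<And>x. x \<in> {c..0} \<Longrightarrow> sol t x = 0" by blast
  have cI: "c \<in> {c..0}" using c_neg by simp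
  have "(sol t has_real_derivative 0) (at c within {c..0})"
    by (rule has_real_derivative_transform[OF cI z]) auto
  then have "Dv c 0 (sol t) c = 0"
    by (intro Dv_eqI[OF c_neg cI]) (simp add: has_real_derivative_iff_has_vector_derivative)
  then show False
    using sl_system_quasi_derivative[OF c_neg p_pos sol_sys cI, of t] by simp
qed

definition sol_norm2 :: "real \<Rightarrow> real" where
  "sol_norm2 t = integral {c..0} (\<lambda>x. w x * (sol t x)\<^sup>2)"

lemma sol_norm2_pos: "sol_norm2 t > 0"
proof -
  obtain x0 where x0: "x0 \<in> {c..0}" "sol t x0 \<noteq> 0" using sol_nonzero by blast
  show ?thesis
    unfolding sol_norm2_def
  proof (rule integral_pos_of_continuous_nonneg[OF c_neg _ _ x0(1)])
    show "continuous_on {c..0} (\<lambda>x. w x * (sol t x)\<^sup>2)"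
      by (intro continuous_intros w_cont sol_cont)
    show "0 \<le> w x * (sol t x)\<^sup>2" if "x \<in> {c..0}" for x
      using w_pos[OF that] by simp
    show "0 < w x0 * (sol t x0)\<^sup>2"
      using w_pos[OF x0(1)] x0(2) by simp
  qed
qed

lemma product_integral_Lipschitz:
  "\<exists>K>0. \<forall>s1 s2 s1' s2'. \<bar>s1\<bar> \<le> T \<longrightarrow> \<bar>s2\<bar> \<le> T \<longrightarrow> \<bar>s1'\<bar> \<le> T \<longrightarrow> \<bar>s2'\<bar> \<le> T \<longrightarrow>
     \<bar>integral {c..0} (\<lambda>x. w x * sol s1 x * sol s2 x) - integral {c..0} (\<lambda>x. w x * sol s1' x * sol s2' x)\<bar>
       \<le> K * (\<bar>s1 - s1'\<bar> + \<bar>s2 - s2'\<bar>)"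
proof -
  obtain B where B: "0 < B"
    "\<And>t x. \<bar>t\<bar> \<le> T \<Longrightarrow> x \<in> {c..0} \<Longrightarrow> \<bar>sol t x\<bar> \<le> B \<and> \<bar>flux t x\<bar> \<le> B"
    using sol_bounded by blast
  obtain L where L: "0 < L" "\<And>s t x. \<bar>s\<bar> \<le> T \<Longrightarrow> \<bar>t\<bar> \<le> T \<Longrightarrow> x \<in> {c..0} \<Longrightarrow>
      \<bar>sol s x - sol t x\<bar> \<le> L * \<bar>s - t\<bar> \<and> \<bar>flux s x - flux t x\<bar> \<le> L * \<bar>s - t\<bar>"
    using sol_Lipschitz by blast
  obtain W where W: "0 < W" "\<And>x. x \<in> {c..0} \<Longrightarrow> \<bar>w x\<bar> \<le> W"
    using continuous_on_Icc_bounded[OF w_cont] by blast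
  define K where "K = W * (B * L) * (0 - c)"
  have "\<bar>integral {c..0} (\<lambda>x. w x * sol s1 x * sol s2 x) - integral {c..0} (\<lambda>x. w x * sol s1' x * sol s2' x)\<bar>
       \<le> K * (\<bar>s1 - s1'\<bar> + \<bar>s2 - s2'\<bar>)"
    if T: "\<bar>s1\<bar> \<le> T" "\<bar>s2\<bar> \<le> T" "\<bar>s1'\<bar> \<le> T" "\<bar>s2'\<bar> \<le> T" for s1 s2 s1' s2'
  proof -
    define e where "e = \<bar>s1 - s1'\<bar> + \<bar>s2 - s2'\<bar>"
    have int: "(\<lambda>x. w x * sol s x * sol s' x) integrable_on {c..0}" for s s'
      by (intro integrable_continuous_real continuous_intros w_cont sol_cont)
    have "norm (integral {c..0} (\<lambda>x. w x * sol s1 x * sol s2 x - w x * sol s1' x * sol s2' x))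
        \<le> (W * (B * L * e)) * (0 - c)"
    proof (rule integral_bound)
      show "continuous_on {c..0} (\<lambda>x. w x * sol s1 x * sol s2 x - w x * sol s1' x * sol s2' x)"
        by (intro continuous_intros w_cont sol_cont)
      fix x assume x: "x \<in> {c..0}"
      have "\<bar>sol s1 x * sol s2 x - sol s1' x * sol s2' x\<bar> =
          \<bar>(sol s1 x - sol s1' x) * sol s2 x + sol s1' x * (sol s2 x - sol s2' x)\<bar>"
        by (simp add: algebra_simps)
      also have "\<dots> \<le> \<bar>sol s1 x - sol s1' x\<bar> * \<bar>sol s2 x\<bar> + \<bar>sol s1' x\<bar> * \<bar>sol s2 x - sol s2' x\<bar>"
        by (metis abs_mult abs_triangle_ineq)
      also have "\<dots> \<le> (L * \<bar>s1 - s1'\<bar>) * B + B * (L * \<bar>s2 - s2'\<bar>)"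
      proof (intro add_mono mult_mono)
        show "\<bar>sol s1 x - sol s1' x\<bar> \<le> L * \<bar>s1 - s1'\<bar>" "\<bar>sol s2 x - sol s2' x\<bar> \<le> L * \<bar>s2 - s2'\<bar>"
          using L(2)[OF T(1,3) x] L(2)[OF T(2,4) x] by auto
        show "\<bar>sol s2 x\<bar> \<le> B" "\<bar>sol s1' x\<bar> \<le> B"
          using B(2)[OF T(2) x] B(2)[OF T(3) x] by auto
      qed (use B(1) L(1) in auto)
      also have "\<dots> = B * L * e" by (simp add: e_def algebra_simps)
      finally have "\<bar>w x\<bar> * \<bar>sol s1 x * sol s2 x - sol s1' x * sol s2' x\<bar> \<le> W * (B * L * e)"
        by (intro mult_mono W x) (use W(1) in auto)
      moreover have "w x * sol s1 x * sol s2 x - w x * sol s1' x * sol s2' x =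
          w x * (sol s1 x * sol s2 x - sol s1' x * sol s2' x)"
        by (simp add: algebra_simps)
      ultimately show "norm (w x * sol s1 x * sol s2 x - w x * sol s1' x * sol s2' x) \<le> W * (B * L * e)"
        by (simp add: abs_mult)
    qed (use c_neg in simp)
    also have "\<dots> = K * e" by (simp add: K_def)
    finally show ?thesis
      using integral_diff[OF int int, of s1 s2 s1' s2'] by (simp add: e_def)
  qed
  moreover have "K > 0" using W(1) B(1) L(1) c_neg unfolding K_def by (intro mult_pos_pos) auto
  ultimately show ?thesis by blast
qed

lemma sol_norm2_isCont: "isCont sol_norm2 t"
proof -
  define T where "T = \<bar>t\<bar> + 1"
  obtain K where K: "0 < K" "\<And>s1 s2 s1' s2'. \<bar>s1\<bar> \<le> T \<Longrightarrow> \<bar>s2\<bar> \<le> T \<Longrightarrow> \<bar>s1'\<bar> \<le> T \<Longrightarrow> \<bar>s2'\<bar> \<le> T \<Longrightarrow>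
      \<bar>integral {c..0} (\<lambda>x. w x * sol s1 x * sol s2 x) - integral {c..0} (\<lambda>x. w x * sol s1' x * sol s2' x)\<bar>
        \<le> K * (\<bar>s1 - s1'\<bar> + \<bar>s2 - s2'\<bar>)"
    using product_integral_Lipschitz[of T] by blast
  have "\<forall>\<^sub>F s in at t. dist s t < 1"
    by (auto simp: eventually_at intro: exI[of _ 1])
  then have "\<forall>\<^sub>F s in at t. norm (sol_norm2 s - sol_norm2 t) \<le> K * (2 * \<bar>s - t\<bar>)"
  proof eventually_elim
    case (elim s)
    then have "\<bar>s\<bar> \<le> T" "\<bar>t\<bar> \<le> T" unfolding T_def by (auto simp: dist_real_def)
    from K(2)[OF this(1,1) this(2,2)] show ?case
      by (simp add: sol_norm2_def power2_eq_square mult.assoc)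
  qed
  moreover have "((\<lambda>s. K * (2 * \<bar>s - t\<bar>)) \<longlongrightarrow> 0) (at t)"
    by (auto intro!: tendsto_eq_intros)
  ultimately have "((\<lambda>s. sol_norm2 s - sol_norm2 t) \<longlongrightarrow> 0) (at t)"
    by (rule Lim_null_comparison)
  then show ?thesis unfolding isCont_def by (rule LIM_zero_cancel)
qed

lemma wronskian_at_0:
  "flux s 0 * sol t 0 - sol s 0 * flux t 0 = (t - s) * integral {c..0} (\<lambda>x. w x * sol s x * sol t x)"
proof -
  have "((\<lambda>x. (t - s) * (w x * sol s x * sol t x)) has_integral
      flux s 0 * sol t 0 - sol s 0 * flux t 0) {c..0}"
    using sl_system_lagrange[OF less_imp_le[OF c_neg] sol_sys[of s] sol_sys[of t]]
    by (simp add: algebra_simps)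
  then show ?thesis
    by (simp add: has_integral_iff)
qed

text \<open>
  At \<open>s1 = s2 = t\<close> the integral is the positive number \<open>sol_norm2 t\<close>, and it is continuous. In
  combination with \<open>wronskian_at_0\<close> this bounds the speed of rotation of \<open>(sol, flux)\<close> from below.
\<close>
lemma product_integral_bounded_below:
  "\<exists>\<delta>>0. \<exists>m>0. \<forall>s1 s2. \<bar>s1 - t\<bar> < \<delta> \<longrightarrow> \<bar>s2 - t\<bar> < \<delta> \<longrightarrow>
     m \<le> integral {c..0} (\<lambda>x. w x * sol s1 x * sol s2 x)"
proof -
  define T where "T = \<bar>t\<bar> + 1"
  obtain K where K: "0 < K" "\<And>s1 s2 s1' s2'. \<bar>s1\<bar> \<le> T \<Longrightarrow> \<bar>s2\<bar> \<le> T \<Longrightarrow> \<bar>s1'\<bar> \<le> T \<Longrightarrow> \<bar>s2'\<bar> \<le> T \<Longrightarrow>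
      \<bar>integral {c..0} (\<lambda>x. w x * sol s1 x * sol s2 x) - integral {c..0} (\<lambda>x. w x * sol s1' x * sol s2' x)\<bar>
        \<le> K * (\<bar>s1 - s1'\<bar> + \<bar>s2 - s2'\<bar>)"
    using product_integral_Lipschitz[of T] by blast
  define \<delta> where "\<delta> = min 1 (sol_norm2 t / (4 * K))"
  have "sol_norm2 t / 2 \<le> integral {c..0} (\<lambda>x. w x * sol s1 x * sol s2 x)"
    if s: "\<bar>s1 - t\<bar> < \<delta>" "\<bar>s2 - t\<bar> < \<delta>" for s1 s2
  proof -
    have "\<bar>s1\<bar> \<le> T" "\<bar>s2\<bar> \<le> T" "\<bar>t\<bar> \<le> T" using s unfolding T_def \<delta>_def by auto
    from K(2)[OF this(1,2) this(3,3)]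
    have "\<bar>integral {c..0} (\<lambda>x. w x * sol s1 x * sol s2 x) - sol_norm2 t\<bar>
        \<le> K * (\<bar>s1 - t\<bar> + \<bar>s2 - t\<bar>)"
      by (simp add: sol_norm2_def power2_eq_square mult.assoc)
    also have "\<dots> \<le> K * (2 * (sol_norm2 t / (4 * K)))"
      using s K(1) unfolding \<delta>_def by (intro mult_left_mono) auto
    also have "\<dots> = sol_norm2 t / 2" using K(1) by simp
    finally show ?thesis by linarith
  qed
  moreover have "\<delta> > 0" using sol_norm2_pos[of t] K(1) by (simp add: \<delta>_def)
  ultimately show ?thesis using sol_norm2_pos[of t] by (meson half_gt_zero)
qed

lemma rotation:
  "\<exists>\<delta>>0. \<forall>s1 s2. \<bar>s1 - t\<bar> < \<delta> \<longrightarrow> \<bar>s2 - t\<bar> < \<delta> \<longrightarrow> s1 < s2 \<longrightarrow>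
     sol s1 0 * flux s2 0 < flux s1 0 * sol s2 0"
proof -
  obtain \<delta> m where \<delta>: "\<delta> > 0" "m > 0" "\<And>s1 s2. \<bar>s1 - t\<bar> < \<delta> \<Longrightarrow> \<bar>s2 - t\<bar> < \<delta> \<Longrightarrow>
     m \<le> integral {c..0} (\<lambda>x. w x * sol s1 x * sol s2 x)"
    using product_integral_bounded_below[of t] by blast
  have "sol s1 0 * flux s2 0 < flux s1 0 * sol s2 0"
    if s: "\<bar>s1 - t\<bar> < \<delta>" "\<bar>s2 - t\<bar> < \<delta>" "s1 < s2" for s1 s2
  proof -
    have "0 < (s2 - s1) * integral {c..0} (\<lambda>x. w x * sol s1 x * sol s2 x)"
      using \<delta>(2) \<delta>(3)[OF s(1,2)] s(3) by simp
    then show ?thesis using wronskian_at_0[of s1 s2] by linarith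
  qed
  then show ?thesis using \<delta>(1) by blast
qed

text \<open>
  Nonpositive parameters make the right-hand side of
  \<open>(sol \<cdot> flux)' = flux\<^sup>2 / p - t w sol\<^sup>2\<close> nonnegative, and positive at the outer end.
\<close>
lemma sol_flux_pos:
  assumes "t \<le> 0"
  shows "sol t 0 * flux t 0 > 0"
proof -
  define f where "f = (\<lambda>x. (flux t x)\<^sup>2 / p x - t * w x * (sol t x)\<^sup>2)"
  have "(f has_integral sol t 0 * flux t 0 - sol t c * flux t c) {c..0}"
  proof (rule fundamental_theorem_of_calculus)
    fix x assume x: "x \<in> {c..0}"
    show "((\<lambda>x. sol t x * flux t x) has_vector_derivative f x) (at x within {c..0})"
      unfolding has_real_derivative_iff_has_vector_derivative[symmetric] f_def
      using DERIV_mult[OF sl_systemD[OF sol_sys x]]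
      by (simp add: algebra_simps power2_eq_square)
  qed (use c_neg in simp)
  then have "integral {c..0} f = sol t 0 * flux t 0" by (simp add: integral_unique)
  moreover have "integral {c..0} f > 0"
  proof (rule integral_pos_of_continuous_nonneg[where ?x0.0 = c])
    show "continuous_on {c..0} f"
      unfolding f_def
      by (intro continuous_intros w_cont sol_cont flux_cont p_cont) (use p_pos in fastforce)
    show "f x \<ge> 0" if x: "x \<in> {c..0}" for x
    proof -
      have "t * w x * (sol t x)\<^sup>2 \<le> 0"
        using assms w_pos[OF x] by (intro mult_nonpos_nonneg) (auto simp: mult_le_0_iff)
      moreover have "(flux t x)\<^sup>2 / p x \<ge> 0" using p_pos[OF x] by simp
      ultimately show ?thesis unfolding f_def by linarith
    qed
    show "f c > 0" using p_pos[of c] c_neg by (simp add: f_def)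
  qed (use c_neg in auto)
  ultimately show ?thesis by simp
qed

end

section \<open>Zeros of the matching function\<close>

text \<open>
  The curve \<open>t \<mapsto> (F t, f t)\<close> turns strictly clockwise around the origin. Comparing
  nearby parameters by their cross product replaces a continuous choice of an angle. Both quotients
  are locally monotone where they are defined: \<open>f / F\<close> decreases and \<open>F / f\<close> increases.
\<close>
definition rotating :: "(real \<Rightarrow> real) \<Rightarrow> (real \<Rightarrow> real) \<Rightarrow> bool" where
  "rotating F f \<longleftrightarrow> (\<forall>t. isCont F t) \<and> (\<forall>t. isCont f t) \<and>
     (\<forall>t. \<exists>\<delta>>0. \<forall>s1 s2. \<bar>s1 - t\<bar> < \<delta> \<longrightarrow> \<bar>s2 - t\<bar> < \<delta> \<longrightarrow> s1 < s2 \<longrightarrow> F s1 * f s2 < f s1 * F s2)"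

lemma rotating_isCont: "rotating F f \<Longrightarrow> isCont F t" "rotating F f \<Longrightarrow> isCont f t"
  by (auto simp: rotating_def)

lemma rotatingE:
  assumes "rotating F f"
  obtains \<delta> where "0 < \<delta>" "\<And>s1 s2. \<bar>s1 - t\<bar> < \<delta> \<Longrightarrow> \<bar>s2 - t\<bar> < \<delta> \<Longrightarrow> s1 < s2 \<Longrightarrow> F s1 * f s2 < f s1 * F s2"
  using assms unfolding rotating_def by meson

lemma rotating_quarter_turn:
  assumes "rotating F f"
  shows "rotating (\<lambda>t. - f t) F" "rotating f (\<lambda>t. - F t)"
  using assms unfolding rotating_def by (auto simp: mult.commute)

lemma rotating_nonzero:
  assumes "rotating F f" "f t = 0"
  shows "F t \<noteq> 0"
proof
  assume "F t = 0"
  moreover obtain \<delta> where d: "0 < \<delta>"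
    "\<And>s1 s2. \<bar>s1 - t\<bar> < \<delta> \<Longrightarrow> \<bar>s2 - t\<bar> < \<delta> \<Longrightarrow> s1 < s2 \<Longrightarrow> F s1 * f s2 < f s1 * F s2"
    using rotatingE[OF assms(1)] by metis
  moreover have "F (t - \<delta> / 2) * f t < f (t - \<delta> / 2) * F t"
    by (rule d(2)) (use d(1) in auto)
  ultimately show False using assms by simp
qed

lemma same_sign_near:
  fixes F :: "real \<Rightarrow> real"
  assumes "isCont F t" "F t \<noteq> 0"
  obtains \<delta> where "0 < \<delta>" "\<And>s. \<bar>s - t\<bar> < \<delta> \<Longrightarrow> F s * F t > 0"
proof -
  have "((\<lambda>s. F s * F t) \<longlongrightarrow> F t * F t) (at t)"
    using assms(1) unfolding isCont_def by (intro tendsto_intros)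
  moreover have "0 < F t * F t" using assms(2) by (auto simp: zero_less_mult_iff linorder_neq_iff)
  ultimately have "\<forall>\<^sub>F s in at t. 0 < F s * F t"
    by (rule order_tendstoD(1))
  then obtain \<delta> where "0 < \<delta>" "\<And>s. s \<noteq> t \<Longrightarrow> dist s t < \<delta> \<Longrightarrow> 0 < F s * F t"
    unfolding eventually_at by auto
  with that[of \<delta>] \<open>0 < F t * F t\<close> show ?thesis
    by (metis dist_real_def)
qed

lemma sign_change_zero:
  fixes h :: "real \<Rightarrow> real"
  assumes "x < y" "\<And>t. isCont h t" "h x * h y < 0"
  obtains z where "x < z" "z < y" "h z = 0"
proof -
  have cont: "continuous_on {x..y} h"
    using assms(2) continuous_at_imp_continuous_on by blast
  consider "h x < 0" "0 < h y" | "0 < h x" "h y < 0"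
    using assms(3) by (auto simp: mult_less_0_iff)
  then obtain z where "x \<le> z" "z \<le> y" "h z = 0"
  proof cases
    case 1
    then show ?thesis using IVT'[of h x 0 y] cont assms(1) that by auto
  next
    case 2
    then show ?thesis using IVT2'[of h y 0 x] cont assms(1) that by auto
  qed
  moreover have "z \<noteq> x" "z \<noteq> y" using assms(3) \<open>h z = 0\<close> by auto
  ultimately show ?thesis using that[of z] by linarith
qed

text \<open>
  \<open>(F, f)\<close> and \<open>(G, g)\<close> stand for value and flux at the interface of the two shooting solutions.
\<close>
locale rotating_pair =
  fixes F f G g :: "real \<Rightarrow> real"
  assumes rot_F: "rotating F f" and rot_G: "rotating G g"
begin

definition matching :: "real \<Rightarrow> real \<Rightarrow> real" where
  "matching \<epsilon> t = \<epsilon> * (F t * g t) + f t * G t"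

text \<open>
  The order of the zero of \<open>matching 0 = f G\<close>.
\<close>
definition limit_mult :: "real \<Rightarrow> nat" where
  "limit_mult t = of_bool (f t = 0) + of_bool (G t = 0)"

text \<open>
  Finiteness is included because infinite sets have cardinality 0.
\<close>
definition zeros_count :: "real \<Rightarrow> real set \<Rightarrow> nat \<Rightarrow> bool" where
  "zeros_count \<epsilon> A n \<longleftrightarrow> finite {t\<in>A. matching \<epsilon> t = 0} \<and> card {t\<in>A. matching \<epsilon> t = 0} = n"

lemma matching_isCont: "isCont (matching \<epsilon>) t"
  unfolding matching_def
  by (intro continuous_intros rotating_isCont[OF rot_F] rotating_isCont[OF rot_G])

lemma matching_tendsto: "((\<lambda>\<epsilon>. matching \<epsilon> t) \<longlongrightarrow> f t * G t) (at_right 0)"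
  unfolding matching_def by (auto intro!: tendsto_eq_intros)

lemma eventually_no_zeros:
  assumes "compact K" "\<And>t. t \<in> K \<Longrightarrow> f t * G t \<noteq> 0"
  shows "\<forall>\<^sub>F \<epsilon> in at_right 0. \<forall>t\<in>K. matching \<epsilon> t \<noteq> 0"
proof (cases "K = {}")
  case False
  have cont: "continuous_on K F" "continuous_on K f" "continuous_on K G" "continuous_on K g"
    using rotating_isCont[OF rot_F] rotating_isCont[OF rot_G]
    by (auto intro: continuous_at_imp_continuous_on)
  have "continuous_on K (\<lambda>t. \<bar>f t * G t\<bar>)" "continuous_on K (\<lambda>t. \<bar>F t * g t\<bar>)"
    by (intro continuous_intros cont)+
  note cont2 = this
  obtain t0 where t0: "t0 \<in> K" "\<And>t. t \<in> K \<Longrightarrow> \<bar>f t0 * G t0\<bar> \<le> \<bar>f t * G t\<bar>"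
    using continuous_attains_inf[OF assms(1) False cont2(1)] by blast
  obtain t1 where t1: "t1 \<in> K" "\<And>t. t \<in> K \<Longrightarrow> \<bar>F t * g t\<bar> \<le> \<bar>F t1 * g t1\<bar>"
    using continuous_attains_sup[OF assms(1) False cont2(2)] by blast
  have "((\<lambda>\<epsilon>. \<epsilon> * \<bar>F t1 * g t1\<bar>) \<longlongrightarrow> 0) (at_right 0)"
    by (auto intro!: tendsto_eq_intros)
  then have "\<forall>\<^sub>F \<epsilon> in at_right 0. \<epsilon> * \<bar>F t1 * g t1\<bar> < \<bar>f t0 * G t0\<bar>"
    by (rule order_tendstoD(2)) (use assms(2)[OF t0(1)] in simp)
  then show ?thesis
    using eventually_at_right_less[of 0]
  proof eventually_elim
    case (elim \<epsilon>)
    show ?case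
    proof (intro ballI notI)
      fix t assume t: "t \<in> K" and "matching \<epsilon> t = 0"
      then have "f t * G t = - (\<epsilon> * (F t * g t))"
        unfolding matching_def by linarith
      then have "\<bar>f t * G t\<bar> = \<epsilon> * \<bar>F t * g t\<bar>"
        using elim(2) by (simp add: abs_mult)
      also have "\<dots> \<le> \<epsilon> * \<bar>F t1 * g t1\<bar>"
        using t1(2)[OF t] elim(2) by (intro mult_left_mono) auto
      finally show False using elim t0(2)[OF t] by linarith
    qed
  qed
qed simp

text \<open>
  Near \<open>p\<close> neither \<open>F\<close> nor \<open>G\<close> vanishes, and \<open>matching \<epsilon> / (F G) = f / F + \<epsilon> g / G\<close> is strictly
  decreasing, so there is at most one zero. There is one because \<open>f G\<close> changes its sign at \<open>p\<close>, and this
  persists for small \<open>\<epsilon>\<close>.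
\<close>
lemma count_near_zero_of_f:
  assumes "f p = 0" "G p \<noteq> 0"
  shows "\<forall>\<^sub>F \<delta> in at_right 0. \<forall>\<^sub>F \<epsilon> in at_right 0. zeros_count \<epsilon> {t. \<bar>t - p\<bar> < \<delta>} 1"
proof -
  obtain d1 where d1: "0 < d1" "\<And>s. \<bar>s - p\<bar> < d1 \<Longrightarrow> F s * F p > 0"
    using same_sign_near[OF rotating_isCont(1)[OF rot_F] rotating_nonzero[OF rot_F assms(1)]] by metis
  obtain d2 where d2: "0 < d2" "\<And>s. \<bar>s - p\<bar> < d2 \<Longrightarrow> G s * G p > 0"
    using same_sign_near[OF rotating_isCont(1)[OF rot_G] assms(2)] by metis
  obtain d3 where d3: "0 < d3"
    "\<And>s1 s2. \<bar>s1 - p\<bar> < d3 \<Longrightarrow> \<bar>s2 - p\<bar> < d3 \<Longrightarrow> s1 < s2 \<Longrightarrow> F s1 * f s2 < f s1 * F s2"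
    using rotatingE[OF rot_F] by metis
  obtain d4 where d4: "0 < d4"
    "\<And>s1 s2. \<bar>s1 - p\<bar> < d4 \<Longrightarrow> \<bar>s2 - p\<bar> < d4 \<Longrightarrow> s1 < s2 \<Longrightarrow> G s1 * g s2 < g s1 * G s2"
    using rotatingE[OF rot_G] by metis
  have "\<forall>\<^sub>F \<delta> in at_right 0. \<delta> < d1 \<and> \<delta> < d2 \<and> \<delta> < d3 \<and> \<delta> < d4"
    using d1(1) d2(1) d3(1) d4(1)
    by (intro eventually_conj order_tendstoD(2)[OF tendsto_ident_at])
  then show ?thesis
    using eventually_at_right_less[of 0]
  proof eventually_elim
    case \<delta>: (elim \<delta>)
    define x y where "x = p - \<delta> / 2" and "y = p + \<delta> / 2"
    have xy: "\<bar>x - p\<bar> < \<delta>" "\<bar>y - p\<bar> < \<delta>" "x < p" "p < y"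
      using \<delta> by (auto simp: x_def y_def)
    have "f x * F p > 0" "F p * f y < 0"
      using d3(2)[of x p] d3(2)[of p y] xy \<delta> assms(1) by auto
    moreover have "G x * G p > 0" "G y * G p > 0"
      using d2(2) xy \<delta> by auto
    ultimately have neg: "(f x * G x) * (f y * G y) < 0"
      by (auto simp: mult_less_0_iff zero_less_mult_iff)
    have "((\<lambda>\<epsilon>. matching \<epsilon> x * matching \<epsilon> y) \<longlongrightarrow> (f x * G x) * (f y * G y)) (at_right 0)"
      by (intro tendsto_intros matching_tendsto)
    from order_tendstoD(2)[OF this neg]
    show ?case
      using eventually_at_right_less[of 0]
    proof eventually_elim
      case \<epsilon>: (elim \<epsilon>)
      have unique: False
        if s: "\<bar>s1 - p\<bar> < \<delta>" "\<bar>s2 - p\<bar> < \<delta>" "s1 < s2" "matching \<epsilon> s1 = 0" "matching \<epsilon> s2 = 0"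
        for s1 s2
      proof -
        have same: "F s1 * F s2 > 0" "G s1 * G s2 > 0"
          using d1(2)[of s1] d1(2)[of s2] d2(2)[of s1] d2(2)[of s2] s \<delta>
          by (auto simp: zero_less_mult_iff)
        have turn: "f s1 * F s2 - F s1 * f s2 > 0" "g s1 * G s2 - G s1 * g s2 > 0"
          using d3(2)[of s1 s2] d4(2)[of s1 s2] s \<delta> by auto
        have "\<epsilon> * ((F s1 * F s2) * (g s1 * G s2 - G s1 * g s2))
            + (G s1 * G s2) * (f s1 * F s2 - F s1 * f s2) > 0"
          by (intro add_pos_pos mult_pos_pos[OF \<epsilon>(2)] mult_pos_pos[OF same(1) turn(2)]
              mult_pos_pos[OF same(2) turn(1)])
        also have "\<epsilon> * ((F s1 * F s2) * (g s1 * G s2 - G s1 * g s2))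
            + (G s1 * G s2) * (f s1 * F s2 - F s1 * f s2)
            = matching \<epsilon> s1 * (F s2 * G s2) - matching \<epsilon> s2 * (F s1 * G s1)"
          unfolding matching_def by algebra
        finally show False using s by simp
      qed
      obtain z where z: "x < z" "z < y" "matching \<epsilon> z = 0"
        using sign_change_zero[OF _ matching_isCont \<epsilon>(1)] xy by auto
      have "{t \<in> {t. \<bar>t - p\<bar> < \<delta>}. matching \<epsilon> t = 0} = {z}"
      proof -
        have "\<bar>z - p\<bar> < \<delta>" using z xy by linarith
        then show ?thesis using unique[of z] unique[of _ z] z(3) by (auto intro: linorder_cases)
      qed
      then show ?case by (simp add: zeros_count_def)
    qed
  qed
qed

text \<open>
  Near \<open>p\<close> neither \<open>F\<close> nor \<open>g\<close> vanishes, and \<open>matching \<epsilon> / (F g) = \<epsilon> + (f / F) (G / g)\<close>. As \<open>f / F\<close>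
  decreases and \<open>G / g\<close> increases through 0, the product vanishes at \<open>p\<close>, is negative elsewhere and
  strictly monotone on each side. Adding \<open>\<epsilon>\<close> produces exactly one zero on each side.
\<close>
lemma count_near_double_zero:
  assumes "f p = 0" "G p = 0"
  shows "\<forall>\<^sub>F \<delta> in at_right 0. \<forall>\<^sub>F \<epsilon> in at_right 0. zeros_count \<epsilon> {t. \<bar>t - p\<bar> < \<delta>} 2"
proof -
  have g0: "g p \<noteq> 0"
    using rotating_nonzero[OF rotating_quarter_turn(1)[OF rot_G], of p] assms(2) by simp
  obtain d1 where d1: "0 < d1" "\<And>s. \<bar>s - p\<bar> < d1 \<Longrightarrow> F s * F p > 0"
    using same_sign_near[OF rotating_isCont(1)[OF rot_F] rotating_nonzero[OF rot_F assms(1)]] by metis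
  obtain d2 where d2: "0 < d2" "\<And>s. \<bar>s - p\<bar> < d2 \<Longrightarrow> g s * g p > 0"
    using same_sign_near[OF rotating_isCont(2)[OF rot_G] g0] by metis
  obtain d3 where d3: "0 < d3"
    "\<And>s1 s2. \<bar>s1 - p\<bar> < d3 \<Longrightarrow> \<bar>s2 - p\<bar> < d3 \<Longrightarrow> s1 < s2 \<Longrightarrow> F s1 * f s2 < f s1 * F s2"
    using rotatingE[OF rot_F] by metis
  obtain d4 where d4: "0 < d4"
    "\<And>s1 s2. \<bar>s1 - p\<bar> < d4 \<Longrightarrow> \<bar>s2 - p\<bar> < d4 \<Longrightarrow> s1 < s2 \<Longrightarrow> G s1 * g s2 < g s1 * G s2"
    using rotatingE[OF rot_G] by metis
  have "\<forall>\<^sub>F \<delta> in at_right 0. \<delta> < d1 \<and> \<delta> < d2 \<and> \<delta> < d3 \<and> \<delta> < d4"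
    using d1(1) d2(1) d3(1) d4(1)
    by (intro eventually_conj order_tendstoD(2)[OF tendsto_ident_at])
  then show ?thesis
    using eventually_at_right_less[of 0]
  proof eventually_elim
    case \<delta>: (elim \<delta>)
    have nz: "F s \<noteq> 0" "g s \<noteq> 0" if "\<bar>s - p\<bar> < \<delta>" for s
      using d1(2)[of s] d2(2)[of s] that \<delta> by auto
    have quot: "f s2 / F s2 < f s1 / F s1" "G s1 / g s1 < G s2 / g s2"
      if s: "\<bar>s1 - p\<bar> < \<delta>" "\<bar>s2 - p\<bar> < \<delta>" "s1 < s2" for s1 s2
    proof -
      have same: "F s1 * F s2 > 0" "g s1 * g s2 > 0"
        using d1(2)[of s1] d1(2)[of s2] d2(2)[of s1] d2(2)[of s2] s \<delta>
        by (auto simp: zero_less_mult_iff)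
      have turn: "f s1 * F s2 - F s1 * f s2 > 0" "g s1 * G s2 - G s1 * g s2 > 0"
        using d3(2)[of s1 s2] d4(2)[of s1 s2] s \<delta> by auto
      have "(f s1 * F s2 - F s1 * f s2) / (F s1 * F s2) > 0"
        "(g s1 * G s2 - G s1 * g s2) / (g s1 * g s2) > 0"
        using divide_pos_pos[OF turn(1) same(1)] divide_pos_pos[OF turn(2) same(2)] by blast+
      moreover have "(f s1 * F s2 - F s1 * f s2) / (F s1 * F s2) = f s1 / F s1 - f s2 / F s2"
        "(g s1 * G s2 - G s1 * g s2) / (g s1 * g s2) = G s2 / g s2 - G s1 / g s1"
        using nz[OF s(1)] nz[OF s(2)] by (auto simp: field_simps)
      ultimately show "f s2 / F s2 < f s1 / F s1" "G s1 / g s1 < G s2 / g s2" by simp_all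
    qed
    have zero_iff: "matching \<epsilon> s = 0 \<longleftrightarrow> (f s / F s) * (G s / g s) = - \<epsilon>" if "\<bar>s - p\<bar> < \<delta>" for s \<epsilon>
      unfolding matching_def using nz[OF that] by (auto simp: field_simps eq_neg_iff_add_eq_0)
    have pI: "\<bar>p - p\<bar> < \<delta>" using \<delta> by simp
    have qp: "f p / F p = 0" "G p / g p = 0" using assms by auto
    define x y where "x = p - \<delta> / 2" and "y = p + \<delta> / 2"
    have xy: "\<bar>x - p\<bar> < \<delta>" "\<bar>y - p\<bar> < \<delta>" "x < p" "p < y"
      using \<delta> by (auto simp: x_def y_def)
    have neg: "(f s * G s) * (F p * g p) < 0" if s: "\<bar>s - p\<bar> < \<delta>" "s \<noteq> p" for s
    proof -
      have "(f s / F s) * (G s / g s) < 0"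
        using quot[OF s(1) pI] quot[OF pI s(1)] s(2) unfolding qp
        by (metis linorder_neqE_linordered_idom mult_neg_pos mult_pos_neg)
      then have "(f s * G s) / (F s * g s) < 0" by simp
      then have "(f s * G s) * (F s * g s) < 0"
        by (auto simp: divide_less_0_iff mult_less_0_iff)
      moreover have "F s * F p > 0" "g s * g p > 0"
        using d1(2) d2(2) s \<delta> by auto
      ultimately show ?thesis by (auto simp: mult_less_0_iff zero_less_mult_iff)
    qed
    have ev: "\<forall>\<^sub>F \<epsilon> in at_right 0. matching \<epsilon> s * (F p * g p) < 0"
      if s: "\<bar>s - p\<bar> < \<delta>" "s \<noteq> p" for s
    proof -
      have "((\<lambda>\<epsilon>. matching \<epsilon> s * (F p * g p)) \<longlongrightarrow> (f s * G s) * (F p * g p)) (at_right 0)"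
        by (intro tendsto_intros matching_tendsto)
      from order_tendstoD(2)[OF this neg[OF s]] show ?thesis .
    qed
    have "x \<noteq> p" "y \<noteq> p" using xy by auto
    from ev[OF xy(1) this(1)] ev[OF xy(2) this(2)] eventually_at_right_less[of 0]
    show ?case
    proof eventually_elim
      case \<epsilon>: (elim \<epsilon>)
      have mp: "matching \<epsilon> p * (F p * g p) > 0"
      proof -
        have "matching \<epsilon> p * (F p * g p) = \<epsilon> * (F p * g p)\<^sup>2"
          unfolding matching_def assms by (simp add: power2_eq_square)
        then show ?thesis using \<epsilon>(3) nz[OF pI] by simp
      qed
      have "matching \<epsilon> x * matching \<epsilon> p < 0" "matching \<epsilon> p * matching \<epsilon> y < 0"
        using \<epsilon>(1,2) mp by (auto simp: mult_less_0_iff zero_less_mult_iff)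
      then obtain z1 z2 where z1: "x < z1" "z1 < p" "matching \<epsilon> z1 = 0"
        and z2: "p < z2" "z2 < y" "matching \<epsilon> z2 = 0"
        using sign_change_zero[OF xy(3) matching_isCont] sign_change_zero[OF xy(4) matching_isCont]
        by metis
      have zd: "\<bar>z1 - p\<bar> < \<delta>" "\<bar>z2 - p\<bar> < \<delta>" using z1 z2 xy by linarith+
      have right: False
        if s: "\<bar>s1 - p\<bar> < \<delta>" "\<bar>s2 - p\<bar> < \<delta>" "s1 < s2" "matching \<epsilon> s1 = 0" "matching \<epsilon> s2 = 0" "p < s1"
        for s1 s2
      proof -
        have "f s2 / F s2 < f s1 / F s1" "f s1 / F s1 < 0" "0 < G s1 / g s1" "G s1 / g s1 < G s2 / g s2"
          using quot[OF s(1,2,3)] quot[OF pI s(1) s(6)] unfolding qp by auto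
        then have "(- (f s1 / F s1)) * (G s1 / g s1) < (- (f s2 / F s2)) * (G s2 / g s2)"
          by (intro mult_strict_mono) auto
        then show False using s zero_iff[OF s(1)] zero_iff[OF s(2)] by simp
      qed
      have left: False
        if s: "\<bar>s1 - p\<bar> < \<delta>" "\<bar>s2 - p\<bar> < \<delta>" "s1 < s2" "matching \<epsilon> s1 = 0" "matching \<epsilon> s2 = 0" "s2 < p"
        for s1 s2
      proof -
        have "f s2 / F s2 < f s1 / F s1" "0 < f s2 / F s2" "G s2 / g s2 < 0" "G s1 / g s1 < G s2 / g s2"
          using quot[OF s(1,2,3)] quot[OF s(2) pI s(6)] unfolding qp by auto
        then have "(f s2 / F s2) * (- (G s2 / g s2)) < (f s1 / F s1) * (- (G s1 / g s1))"
          by (intro mult_strict_mono) auto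
        then show False using s zero_iff[OF s(1)] zero_iff[OF s(2)] by simp
      qed
      have "{t \<in> {t. \<bar>t - p\<bar> < \<delta>}. matching \<epsilon> t = 0} = {z1, z2}"
      proof (intro equalityI subsetI)
        fix t assume "t \<in> {t \<in> {t. \<bar>t - p\<bar> < \<delta>}. matching \<epsilon> t = 0}"
        then have t: "\<bar>t - p\<bar> < \<delta>" "matching \<epsilon> t = 0" by auto
        have "t \<noteq> p" using mp t(2) by auto
        then show "t \<in> {z1, z2}"
          using right[OF t(1) zd(2) _ t(2) z2(3)] right[OF zd(2) t(1) _ z2(3) t(2) z2(1)]
            left[OF t(1) zd(1) _ t(2) z1(3) z1(2)] left[OF zd(1) t(1) _ z1(3) t(2)]
          by (metis insertCI linorder_neqE_linordered_idom)
      qed (use z1 z2 zd in auto)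
      moreover have "z1 \<noteq> z2" using z1 z2 by auto
      ultimately show ?case by (simp add: zeros_count_def)
    qed
  qed
qed

end

text \<open>
  The case of a zero of \<open>G\<close> only reduces to that of a zero of \<open>f\<close>: quarter turns of both curves
  exchange the roles of \<open>f\<close> and \<open>G\<close> and preserve \<open>matching\<close>.
\<close>
lemma (in rotating_pair) count_near:
  "\<forall>\<^sub>F \<delta> in at_right 0. \<forall>\<^sub>F \<epsilon> in at_right 0. zeros_count \<epsilon> {t. \<bar>t - p\<bar> < \<delta>} (limit_mult p)"
proof -
  consider "f p = 0" "G p \<noteq> 0" | "f p \<noteq> 0" "G p = 0" | "f p = 0" "G p = 0" | "f p \<noteq> 0" "G p \<noteq> 0"
    by blast
  then show ?thesis
  proof cases
    case 1
    then show ?thesis using count_near_zero_of_f by (simp add: limit_mult_def)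
  next
    case 2
    interpret swap: rotating_pair "\<lambda>t. - g t" G f "\<lambda>t. - F t"
      by unfold_locales (use rotating_quarter_turn rot_F rot_G in auto)
    have "swap.matching = matching"
      by (auto simp: fun_eq_iff swap.matching_def matching_def mult_ac)
    then have "swap.zeros_count = zeros_count"
      by (auto simp: fun_eq_iff swap.zeros_count_def zeros_count_def)
    then show ?thesis using swap.count_near_zero_of_f[of p] 2 by (simp add: limit_mult_def)
  next
    case 3
    then show ?thesis using count_near_double_zero by (simp add: limit_mult_def numeral_2_eq_2)
  next
    case 4
    have "isCont (\<lambda>t. f t * G t) p"
      by (intro continuous_intros rotating_isCont[OF rot_F] rotating_isCont[OF rot_G])
    then obtain d where d: "0 < d" "\<And>s. \<bar>s - p\<bar> < d \<Longrightarrow> f s * G s * (f p * G p) > 0"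
      using same_sign_near[where F = "\<lambda>t. f t * G t" and t = p] 4 by auto
    have "\<forall>\<^sub>F \<delta> in at_right 0. \<delta> < d"
      using d(1) by (intro order_tendstoD(2)[OF tendsto_ident_at])
    then show ?thesis
    proof eventually_elim
      case \<delta>: (elim \<delta>)
      have "f t * G t \<noteq> 0" if "t \<in> cball p \<delta>" for t
      proof -
        have "\<bar>t - p\<bar> < d" using that \<delta> by (simp add: dist_real_def abs_minus_commute)
        then show ?thesis using d(2)[of t] by auto
      qed
      then have "\<forall>\<^sub>F \<epsilon> in at_right 0. \<forall>t\<in>cball p \<delta>. matching \<epsilon> t \<noteq> 0"
        by (intro eventually_no_zeros compact_cball)
      then show ?case
      proof eventually_elim
        case (elim \<epsilon>)
        then have "{t \<in> {t. \<bar>t - p\<bar> < \<delta>}. matching \<epsilon> t = 0} = {}"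
          by (auto simp: dist_real_def abs_minus_commute)
        then show ?case
          unfolding zeros_count_def by (simp only: card.empty finite.emptyI) (simp add: 4 limit_mult_def)
      qed
    qed
  qed
qed

lemma rotating_zero_isolated:
  assumes "rotating F f"
  shows "\<not> p islimpt {t. f t = 0}"
proof
  assume lim: "p islimpt {t. f t = 0}"
  have "isCont f p" using rotating_isCont[OF assms] by blast
  have fp: "f p = 0"
  proof (rule ccontr)
    assume "f p \<noteq> 0"
    then obtain d where "0 < d" "\<And>s. \<bar>s - p\<bar> < d \<Longrightarrow> f s * f p > 0"
      using same_sign_near[OF \<open>isCont f p\<close>] by blast
    then show False
      using lim unfolding islimpt_approachable dist_real_def by fastforce
  qed
  obtain d where d: "0 < d"
    "\<And>s1 s2. \<bar>s1 - p\<bar> < d \<Longrightarrow> \<bar>s2 - p\<bar> < d \<Longrightarrow> s1 < s2 \<Longrightarrow> F s1 * f s2 < f s1 * F s2"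
    using rotatingE[OF assms] by metis
  obtain s where s: "f s = 0" "s \<noteq> p" "\<bar>s - p\<bar> < d"
    using lim d(1) unfolding islimpt_approachable dist_real_def by blast
  show False
    using d(2)[of s p] d(2)[of p s] s fp d(1) by (cases "s < p") auto
qed

context rotating_pair
begin

lemma finite_limit_zeros: "finite ({x..y} \<inter> {p. f p = 0 \<or> G p = 0})"
proof (rule finite_not_islimpt_in_compact)
  fix z
  show "\<not> z islimpt {p. f p = 0 \<or> G p = 0}"
    using rotating_zero_isolated[OF rot_F, of z]
      rotating_zero_isolated[OF rotating_quarter_turn(1)[OF rot_G], of z]
    by (simp add: Collect_disj_eq islimpt_Un)
qed simp

text \<open>
  The positivity assumptions exclude nonpositive zeros, of the limit as well as for \<open>\<epsilon> > 0\<close>. On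
  \<open>[0, X]\<close> the limit zeros are finite in number; small disjoint neighbourhoods of them contain the
  right numbers of zeros, and the compact rest contains none.
\<close>
lemma count_below:
  assumes pos: "\<And>t. t \<le> 0 \<Longrightarrow> F t * f t > 0" "\<And>t. t \<le> 0 \<Longrightarrow> G t * g t > 0"
    and X: "f X \<noteq> 0" "G X \<noteq> 0"
  defines "S \<equiv> {p. p < X \<and> (f p = 0 \<or> G p = 0)}"
  shows "finite S" "\<forall>\<^sub>F \<epsilon> in at_right 0. zeros_count \<epsilon> {..<X} (\<Sum>p\<in>S. limit_mult p)"
proof -
  have S_pos: "0 < p" if "p \<in> S" for p
    using that pos[of p] unfolding S_def by (cases "p \<le> 0") auto
  have "S \<subseteq> {0..X} \<inter> {p. f p = 0 \<or> G p = 0}"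
    using S_pos by (auto simp: S_def less_imp_le)
  then show fin: "finite S"
    using finite_limit_zeros finite_subset by blast
  have "\<forall>\<^sub>F \<delta> in at_right 0.
      (\<forall>p\<in>S. (\<forall>\<^sub>F \<epsilon> in at_right 0. zeros_count \<epsilon> {t. \<bar>t - p\<bar> < \<delta>} (limit_mult p)) \<and> \<delta> < X - p \<and>
        (\<forall>q\<in>S. p \<noteq> q \<longrightarrow> \<delta> < \<bar>p - q\<bar> / 2)) \<and> 0 < \<delta>"
  proof (intro eventually_conj eventually_ball_finite[OF fin] ballI count_near eventually_at_right_less)
    fix p assume p: "p \<in> S"
    show "\<forall>\<^sub>F \<delta> in at_right 0. \<delta> < X - p"
      by (rule order_tendstoD(2)[OF tendsto_ident_at]) (use p in \<open>simp add: S_def\<close>)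
    fix q assume q: "q \<in> S"
    show "\<forall>\<^sub>F \<delta> in at_right 0. p \<noteq> q \<longrightarrow> \<delta> < \<bar>p - q\<bar> / 2"
    proof (cases "p = q")
      case False
      then have "\<forall>\<^sub>F \<delta> in at_right 0. \<delta> < \<bar>p - q\<bar> / 2"
        by (intro order_tendstoD(2)[OF tendsto_ident_at]) simp
      then show ?thesis by eventually_elim simp
    qed simp
  qed
  then obtain \<delta> where \<delta>: "0 < \<delta>" "\<And>p. p \<in> S \<Longrightarrow> \<delta> < X - p"
      "\<And>p q. p \<in> S \<Longrightarrow> q \<in> S \<Longrightarrow> p \<noteq> q \<Longrightarrow> \<delta> < \<bar>p - q\<bar> / 2"
      "\<And>p. p \<in> S \<Longrightarrow> \<forall>\<^sub>F \<epsilon> in at_right 0. zeros_count \<epsilon> {t. \<bar>t - p\<bar> < \<delta>} (limit_mult p)"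
    using eventually_happens'[OF trivial_limit_at_right_real] by blast
  define K where "K = {0..X} - (\<Union>p\<in>S. ball p \<delta>)"
  have "compact K"
    unfolding K_def by (intro compact_diff open_UN) auto
  moreover have "f t * G t \<noteq> 0" if "t \<in> K" for t
    using that X \<delta>(1) unfolding K_def S_def by force
  ultimately have "\<forall>\<^sub>F \<epsilon> in at_right 0. \<forall>t\<in>K. matching \<epsilon> t \<noteq> 0"
    by (rule eventually_no_zeros)
  moreover have "\<forall>\<^sub>F \<epsilon> in at_right 0. \<forall>p\<in>S. zeros_count \<epsilon> {t. \<bar>t - p\<bar> < \<delta>} (limit_mult p)"
    by (intro eventually_ball_finite[OF fin] ballI \<delta>(4))
  ultimately show "\<forall>\<^sub>F \<epsilon> in at_right 0. zeros_count \<epsilon> {..<X} (\<Sum>p\<in>S. limit_mult p)"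
    using eventually_at_right_less[of 0]
  proof eventually_elim
    case (elim \<epsilon>)
    \<comment> \<open>Multiplying by \<open>F G\<close> turns both terms into products of positive numbers.\<close>
    have nonpos: "matching \<epsilon> t \<noteq> 0" if "t \<le> 0" for t
    proof -
      have "F t \<noteq> 0" "G t \<noteq> 0" using pos[OF that] by auto
      then have "\<epsilon> * ((F t)\<^sup>2 * (G t * g t)) + (F t * f t) * (G t)\<^sup>2 > 0"
        using pos[OF that] elim(3) by (intro add_pos_pos mult_pos_pos[of \<epsilon>]) auto
      moreover have "\<epsilon> * ((F t)\<^sup>2 * (G t * g t)) + (F t * f t) * (G t)\<^sup>2 = matching \<epsilon> t * (F t * G t)"
        unfolding matching_def by algebra
      ultimately show ?thesis by auto
    qed
    have "{t \<in> {..<X}. matching \<epsilon> t = 0} = (\<Union>p\<in>S. {t \<in> {t. \<bar>t - p\<bar> < \<delta>}. matching \<epsilon> t = 0})"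
    proof (intro equalityI subsetI)
      fix t assume t: "t \<in> {t \<in> {..<X}. matching \<epsilon> t = 0}"
      then have "t > 0" using nonpos[of t] by (cases "t \<le> 0") auto
      then have "t \<notin> K" "t \<in> {0..X}" using t elim(1) by auto
      then obtain p where "p \<in> S" "t \<in> ball p \<delta>" unfolding K_def by blast
      then show "t \<in> (\<Union>p\<in>S. {t \<in> {t. \<bar>t - p\<bar> < \<delta>}. matching \<epsilon> t = 0})"
        using t by (auto simp: dist_real_def abs_minus_commute)
    next
      fix t assume "t \<in> (\<Union>p\<in>S. {t \<in> {t. \<bar>t - p\<bar> < \<delta>}. matching \<epsilon> t = 0})"
      then obtain p where "p \<in> S" "\<bar>t - p\<bar> < \<delta>" "matching \<epsilon> t = 0" by auto
      then show "t \<in> {t \<in> {..<X}. matching \<epsilon> t = 0}" using \<delta>(2)[of p] by auto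
    qed
    moreover have "card (\<Union>p\<in>S. {t \<in> {t. \<bar>t - p\<bar> < \<delta>}. matching \<epsilon> t = 0})
        = (\<Sum>p\<in>S. card {t \<in> {t. \<bar>t - p\<bar> < \<delta>}. matching \<epsilon> t = 0})"
    proof (rule card_UN_disjoint[OF fin])
      show "\<forall>p\<in>S. finite {t \<in> {t. \<bar>t - p\<bar> < \<delta>}. matching \<epsilon> t = 0}"
        using elim(2) by (auto simp: zeros_count_def)
      show "\<forall>p\<in>S. \<forall>q\<in>S. p \<noteq> q \<longrightarrow> {t \<in> {t. \<bar>t - p\<bar> < \<delta>}. matching \<epsilon> t = 0} \<inter>
          {t \<in> {t. \<bar>t - q\<bar> < \<delta>}. matching \<epsilon> t = 0} = {}"
        using \<delta>(3) by fastforce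
    qed
    ultimately show ?case
      using elim(2) fin by (simp add: zeros_count_def)
  qed
qed

end

section \<open>Weak derivatives and classical solutions\<close>

lemma AE_lebesgue_on_negligible:
  assumes "AE x in lebesgue_on {c..d :: real}. P x"
  obtains N where "negligible N" "\<And>x. x \<in> {c..d} - N \<Longrightarrow> P x"
proof -
  have "AE x in lebesgue. x \<in> {c..d} \<longrightarrow> P x"
    using assms by (subst (asm) AE_restrict_space_iff) auto
  then obtain N where "N \<in> null_sets lebesgue" "{x \<in> space lebesgue. \<not> (x \<in> {c..d} \<longrightarrow> P x)} \<subseteq> N"
    unfolding eventually_ae_filter by blast
  then show ?thesis
    by (intro that[of N]) (auto simp: negligible_iff_null_sets)
qed

lemma continuous_on_imp_L2:
  fixes g :: "real \<Rightarrow> 'a::euclidean_space"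
  assumes "continuous_on {c..d} g"
  shows "g \<in> L2 c d"
  unfolding L2_def mem_Collect_eq
proof
  show "g \<in> borel_measurable (lebesgue_on {c..d})"
    by (rule continuous_imp_measurable_on_sets_lebesgue[OF assms]) simp
  show "integrable (lebesgue_on {c..d}) (\<lambda>x. (norm (g x))\<^sup>2)"
    by (intro continuous_imp_integrable_real continuous_intros assms)
qed

lemma L2_imp_integrable_on:
  fixes g :: "real \<Rightarrow> 'a::euclidean_space"
  assumes "g \<in> L2 c d"
  shows "g integrable_on {c..d}"
proof -
  interpret finite_measure "lebesgue_on {c..d}"
    by (intro finite_measure_lebesgue_on) auto
  have "integrable (lebesgue_on {c..d}) g"
  proof (rule Bochner_Integration.integrable_bound)
    show "integrable (lebesgue_on {c..d}) (\<lambda>x. 1 + (norm (g x))\<^sup>2)"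
      using assms unfolding L2_def by (intro Bochner_Integration.integrable_add integrable_const) auto
    show "g \<in> borel_measurable (lebesgue_on {c..d})"
      using assms by (simp add: L2_def)
    have "norm (g x) \<le> norm (1 + (norm (g x))\<^sup>2)" for x
    proof -
      have "2 * norm (g x) \<le> 1 + (norm (g x))\<^sup>2"
        using sum_squares_bound[of 1 "norm (g x)"] by simp
      then show ?thesis using norm_ge_zero[of "g x"] by (simp del: norm_ge_zero)
    qed
    then show "AE x in lebesgue_on {c..d}. norm (g x) \<le> norm (1 + (norm (g x))\<^sup>2)" by simp
  qed
  then show ?thesis by (intro integrable_on_lebesgue_on) auto
qed

lemma has_weak_deriv_continuous:
  fixes u g :: "real \<Rightarrow> 'a::euclidean_space"
  assumes "has_weak_deriv c d u g"
  shows "continuous_on {c..d} u"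
proof -
  have "continuous_on {c..d} (\<lambda>x. u c + integral {c..x} g)"
    using assms unfolding has_weak_deriv_def
    by (intro continuous_intros indefinite_integral_continuous_1 L2_imp_integrable_on) auto
  then show ?thesis
    by (rule continuous_on_eq) (use assms in \<open>unfold has_weak_deriv_def, metis\<close>)
qed

text \<open>
  A weak derivative that agrees almost everywhere with a continuous \<open>h\<close> is a classical one.
\<close>
lemma has_weak_deriv_imp_vector_derivative:
  fixes u g :: "real \<Rightarrow> 'a::euclidean_space"
  assumes "has_weak_deriv c d u g" "continuous_on {c..d} h" "negligible N"
    and "\<And>x. x \<in> {c..d} - N \<Longrightarrow> g x = h x" and x: "x \<in> {c..d}"
  shows "(u has_vector_derivative h x) (at x within {c..d})"
proof -
  have eq: "u y = u c + integral {c..y} h" if y: "y \<in> {c..d}" for y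
  proof -
    have "integral {c..y} h = integral {c..y} g"
      by (rule integral_spike[OF assms(3)]) (use assms(4) y in auto)
    moreover have "u y = u c + integral {c..y} g"
      using assms(1) y unfolding has_weak_deriv_def by blast
    ultimately show ?thesis by (simp only:)
  qed
  have "((\<lambda>y. u c + integral {c..y} h) has_vector_derivative h x) (at x within {c..d})"
    using has_vector_derivative_add[OF has_vector_derivative_const
        integral_has_vector_derivative[OF assms(2) x], of "u c"] by simp
  then show ?thesis
    by (rule has_vector_derivative_transform[OF x, rotated]) (rule eq)
qed

lemma C1_imp_has_weak_deriv:
  fixes u g :: "real \<Rightarrow> 'a::euclidean_space"
  assumes "continuous_on {c..d} g"
    and "\<And>x. x \<in> {c..d} \<Longrightarrow> (u has_vector_derivative g x) (at x within {c..d})"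
  shows "has_weak_deriv c d u g"
  unfolding has_weak_deriv_def
proof (intro conjI ballI continuous_on_imp_L2 assms(1))
  fix x assume x: "x \<in> {c..d}"
  have "(g has_integral u x - u c) {c..x}"
  proof (rule fundamental_theorem_of_calculus)
    fix y assume "y \<in> {c..x}"
    then have "y \<in> {c..d}" "{c..x} \<subseteq> {c..d}" using x by auto
    then show "(u has_vector_derivative g y) (at y within {c..x})"
      using has_vector_derivative_within_subset[OF assms(2)] by blast
  qed (use x in simp)
  then show "u x = u c + integral {c..x} g" by (simp add: integral_unique)
qed

lemma smooth_on_Icc_C1:
  assumes "smooth_on_Icc c d f"
  shows "\<exists>f'. continuous_on {c..d} f' \<and>
    (\<forall>x\<in>{c..d}. (f has_real_derivative f' x) (at x within {c..d}))"
proof -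
  obtain D where D0: "\<And>x. x \<in> {c..d} \<Longrightarrow> D 0 x = f x"
    and D: "\<And>n x. x \<in> {c..d} \<Longrightarrow> (D n has_real_derivative D (Suc n) x) (at x within {c..d})"
    using assms unfolding smooth_on_Icc_def by blast
  have "continuous_on {c..d} (D (Suc 0))"
    by (rule DERIV_continuous_on[where D = "D (Suc (Suc 0))"], rule D)
  moreover have "(f has_real_derivative D (Suc 0) x) (at x within {c..d})" if x: "x \<in> {c..d}" for x
    by (rule has_real_derivative_transform[OF x _ D[OF x]]) (simp add: D0)
  ultimately show ?thesis by blast
qed

lemma smooth_on_Icc_continuous:
  assumes "smooth_on_Icc c d f"
  shows "continuous_on {c..d} f"
proof -
  obtain f' where "\<forall>x\<in>{c..d}. (f has_real_derivative f' x) (at x within {c..d})"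
    using smooth_on_Icc_C1[OF assms] by blast
  then show ?thesis by (intro DERIV_continuous_on[where D = f']) blast
qed

text \<open>
  The coefficients are real, so a complex solution is a pair of real ones, and the real theory applies
  to both parts.
\<close>
definition csl_system ::
    "real \<Rightarrow> real \<Rightarrow> (real \<Rightarrow> real) \<Rightarrow> (real \<Rightarrow> real) \<Rightarrow> (real \<Rightarrow> complex) \<Rightarrow>
     (real \<Rightarrow> complex) \<Rightarrow> (real \<Rightarrow> complex) \<Rightarrow> bool" where
  "csl_system c d p q g u v \<longleftrightarrow>
     sl_system c d p q (\<lambda>x. Re (g x)) (\<lambda>x. Re (u x)) (\<lambda>x. Re (v x)) \<and>
     sl_system c d p q (\<lambda>x. Im (g x)) (\<lambda>x. Im (u x)) (\<lambda>x. Im (v x))"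

lemma has_vector_derivative_complex_iff:
  fixes u :: "real \<Rightarrow> complex"
  shows "(u has_vector_derivative D) F \<longleftrightarrow>
    ((\<lambda>x. Re (u x)) has_vector_derivative Re D) F \<and> ((\<lambda>x. Im (u x)) has_vector_derivative Im D) F"
proof
  assume *: "(u has_vector_derivative D) F"
  show "((\<lambda>x. Re (u x)) has_vector_derivative Re D) F \<and> ((\<lambda>x. Im (u x)) has_vector_derivative Im D) F"
    using bounded_linear.has_vector_derivative[OF bounded_linear_Re *]
      bounded_linear.has_vector_derivative[OF bounded_linear_Im *] by blast
next
  assume *: "((\<lambda>x. Re (u x)) has_vector_derivative Re D) F \<and> ((\<lambda>x. Im (u x)) has_vector_derivative Im D) F"
  have "((\<lambda>x. complex_of_real (Re (u x)) + \<i> * complex_of_real (Im (u x))) has_vector_derivative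
      complex_of_real (Re D) + \<i> * complex_of_real (Im D)) F"
    using * by (intro has_vector_derivative_add has_vector_derivative_mult_right
        bounded_linear.has_vector_derivative[OF bounded_linear_of_real]) auto
  then show "(u has_vector_derivative D) F" by (simp add: complex_eq[symmetric])
qed

lemma csl_system_iff:
  "csl_system c d p q g u v \<longleftrightarrow>
     (\<forall>x\<in>{c..d}. (u has_vector_derivative (v x /\<^sub>R p x)) (at x within {c..d}) \<and>
                 (v has_vector_derivative (g x - q x *\<^sub>R u x)) (at x within {c..d}))"
proof -
  have D1: "(u has_vector_derivative (v x /\<^sub>R p x)) F \<longleftrightarrow>
      ((\<lambda>x. Re (u x)) has_real_derivative Re (v x) / p x) F \<and>
      ((\<lambda>x. Im (u x)) has_real_derivative Im (v x) / p x) F" for x F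
    unfolding has_vector_derivative_complex_iff[of u]
    by (simp add: has_real_derivative_iff_has_vector_derivative divide_inverse mult.commute)
  have D2: "(v has_vector_derivative (g x - q x *\<^sub>R u x)) F \<longleftrightarrow>
      ((\<lambda>x. Re (v x)) has_real_derivative Re (g x) - q x * Re (u x)) F \<and>
      ((\<lambda>x. Im (v x)) has_real_derivative Im (g x) - q x * Im (u x)) F" for x F
    unfolding has_vector_derivative_complex_iff[of v]
    by (simp add: has_real_derivative_iff_has_vector_derivative)
  show ?thesis
    unfolding csl_system_def sl_system_def D1 D2 by blast
qed

lemma csl_system_reflect:
  assumes "csl_system c d p q g u v"
  shows "csl_system (-d) (-c) (\<lambda>x. p (-x)) (\<lambda>x. q (-x)) (\<lambda>x. g (-x)) (\<lambda>x. u (-x)) (\<lambda>x. - v (-x))"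
  using assms sl_system_reflect[of c d p q "\<lambda>x. Re (g x)" "\<lambda>x. Re (u x)" "\<lambda>x. Re (v x)"]
    sl_system_reflect[of c d p q "\<lambda>x. Im (g x)" "\<lambda>x. Im (u x)" "\<lambda>x. Im (v x)"]
  by (simp add: csl_system_def)

lemma csl_system_continuous:
  assumes "csl_system c d p q g u v"
  shows "continuous_on {c..d} u" "continuous_on {c..d} v"
  using assms unfolding csl_system_iff
  by (auto intro!: continuous_on_vector_derivative[of "{c..d}"])

lemma csl_system_cong:
  assumes "csl_system c d p q g u v"
    and "\<And>x. x \<in> {c..d} \<Longrightarrow> p' x = p x" "\<And>x. x \<in> {c..d} \<Longrightarrow> q' x = q x"
      "\<And>x. x \<in> {c..d} \<Longrightarrow> g' x = g x" "\<And>x. x \<in> {c..d} \<Longrightarrow> u' x = u x" "\<And>x. x \<in> {c..d} \<Longrightarrow> v' x = v x"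
  shows "csl_system c d p' q' g' u' v'"
proof -
  have "sl_system c d p q (\<lambda>x. Re (g x)) (\<lambda>x. Re (u x)) (\<lambda>x. Re (v x))"
    "sl_system c d p q (\<lambda>x. Im (g x)) (\<lambda>x. Im (u x)) (\<lambda>x. Im (v x))"
    using assms(1) by (auto simp: csl_system_def)
  then show ?thesis
    unfolding csl_system_def
    by (intro conjI) (erule sl_system_cong; simp add: assms)+
qed

lemma csl_system_diff:
  assumes "csl_system c d p q g u v" "csl_system c d p q g' u' v'"
  shows "csl_system c d p q (\<lambda>x. g x - g' x) (\<lambda>x. u x - u' x) (\<lambda>x. v x - v' x)"
  using assms unfolding csl_system_def by (auto intro: sl_system_diff)

lemma csl_system_complex_multiple:
  assumes "sl_system c d p q g u v"
  shows "csl_system c d p q (\<lambda>x. C * complex_of_real (g x)) (\<lambda>x. C * complex_of_real (u x))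
    (\<lambda>x. C * complex_of_real (v x))"
  unfolding csl_system_def
  using sl_system_scale[OF assms, of "Re C"] sl_system_scale[OF assms, of "Im C"] by simp

text \<open>
  Elements of the domain are continuous. So if \<open>v\<close> is continuous, then so is the image \<open>v + t u\<close>, and
  the weak equation is a classical one. The converse needs a differentiable \<open>p\<close>, to make
  \<open>u' = flux / p\<close> weakly differentiable.
\<close>
lemma SL_graph_iff:
  fixes p w :: "real \<Rightarrow> real" and u v :: "real \<Rightarrow> complex"
  assumes "c < d" and p: "smooth_on_Icc c d p" "\<And>x. x \<in> {c..d} \<Longrightarrow> p x > 0"
    and w: "continuous_on {c..d} w" "\<And>x. x \<in> {c..d} \<Longrightarrow> w x > 0"
    and v: "continuous_on {c..d} v"
  shows "(u, \<lambda>x. v x + complex_of_real t * u x) \<in> SL_graph c d p w \<longleftrightarrow>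
    (\<forall>x. x \<notin> {c..d} \<longrightarrow> u x = 0) \<and>
    csl_system c d p (\<lambda>x. t * w x) (\<lambda>x. - w x *\<^sub>R v x) u (\<lambda>x. p x *\<^sub>R Dv c d u x)" (is "?L \<longleftrightarrow> ?R")
proof
  assume L: ?L
  define V where "V = (\<lambda>x. p x *\<^sub>R Dv c d u x)"
  define f where "f = (\<lambda>x. v x + complex_of_real t * u x)"
  obtain v0 g0 g where uv: "has_weak_deriv c d u v0" "has_weak_deriv c d v0 g0"
    and z: "\<forall>x. x \<notin> {c..d} \<longrightarrow> u x = 0"
    and g: "has_weak_deriv c d V g" "AE x in lebesgue_on {c..d}. f x = - (1 / w x) *\<^sub>R g x"
    using L unfolding SL_graph_def H2_def V_def f_def by blast
  have cu: "continuous_on {c..d} u" and cv0: "continuous_on {c..d} v0"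
    using uv has_weak_deriv_continuous by blast+
  have du: "(u has_vector_derivative v0 x) (at x within {c..d})" if "x \<in> {c..d}" for x
    by (rule has_weak_deriv_imp_vector_derivative[OF uv(1) cv0 negligible_empty _ that]) simp
  have V_eq: "V x = p x *\<^sub>R v0 x" if "x \<in> {c..d}" for x
    unfolding V_def using Dv_eqI[OF assms(1) that du[OF that]] by simp
  have cf: "continuous_on {c..d} (\<lambda>x. - w x *\<^sub>R f x)"
    unfolding f_def by (intro continuous_intros w v cu)
  obtain N where N: "negligible N" "\<And>x. x \<in> {c..d} - N \<Longrightarrow> f x = - (1 / w x) *\<^sub>R g x"
    using AE_lebesgue_on_negligible[OF g(2)] by blast
  have dV: "(V has_vector_derivative - w x *\<^sub>R f x) (at x within {c..d})" if "x \<in> {c..d}" for x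
  proof (rule has_weak_deriv_imp_vector_derivative[OF g(1) cf N(1) _ that])
    fix y assume y: "y \<in> {c..d} - N"
    then have "w y \<noteq> 0" using w(2)[of y] by auto
    then show "g y = - w y *\<^sub>R f y" using N(2)[OF y] by simp
  qed
  have "csl_system c d p (\<lambda>x. t * w x) (\<lambda>x. - w x *\<^sub>R v x) u V"
    unfolding csl_system_iff
  proof (intro ballI conjI)
    fix x assume x: "x \<in> {c..d}"
    have "V x /\<^sub>R p x = v0 x" using V_eq[OF x] p(2)[OF x] by simp
    then show "(u has_vector_derivative V x /\<^sub>R p x) (at x within {c..d})"
      using du[OF x] by simp
    have "- w x *\<^sub>R v x - (t * w x) *\<^sub>R u x = - w x *\<^sub>R f x"
      by (simp add: f_def scaleR_conv_of_real algebra_simps)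
    then show "(V has_vector_derivative - w x *\<^sub>R v x - (t * w x) *\<^sub>R u x) (at x within {c..d})"
      using dV[OF x] by simp
  qed
  with z show ?R unfolding V_def by blast
next
  assume R: ?R
  define V where "V = (\<lambda>x. p x *\<^sub>R Dv c d u x)"
  define f where "f = (\<lambda>x. v x + complex_of_real t * u x)"
  have sys: "csl_system c d p (\<lambda>x. t * w x) (\<lambda>x. - w x *\<^sub>R v x) u V"
    using R V_def by blast
  note cont = csl_system_continuous[OF sys]
  have du: "(u has_vector_derivative V x /\<^sub>R p x) (at x within {c..d})"
    and dV: "(V has_vector_derivative - w x *\<^sub>R f x) (at x within {c..d})" if "x \<in> {c..d}" for x
  proof -
    have eq: "- w x *\<^sub>R v x - (t * w x) *\<^sub>R u x = - w x *\<^sub>R f x"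
      by (simp add: f_def scaleR_conv_of_real algebra_simps)
    show "(u has_vector_derivative V x /\<^sub>R p x) (at x within {c..d})"
      using sys that unfolding csl_system_iff by blast
    show "(V has_vector_derivative - w x *\<^sub>R f x) (at x within {c..d})"
      unfolding eq[symmetric] using sys that unfolding csl_system_iff by blast
  qed
  obtain p' where p': "continuous_on {c..d} p'"
    "\<And>x. x \<in> {c..d} \<Longrightarrow> (p has_real_derivative p' x) (at x within {c..d})"
    using smooth_on_Icc_C1[OF p(1)] by auto
  have pnz: "p x \<noteq> 0" if "x \<in> {c..d}" for x using p(2)[OF that] by simp
  have cp: "continuous_on {c..d} p" using smooth_on_Icc_continuous[OF p(1)] .
  have cf: "continuous_on {c..d} (\<lambda>x. - w x *\<^sub>R f x)"
    unfolding f_def by (intro continuous_intros w v cont)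
  define q where "q = (\<lambda>x. - p' x / (p x)\<^sup>2)"
  have dv: "((\<lambda>x. V x /\<^sub>R p x) has_vector_derivative
      (q x *\<^sub>R V x + inverse (p x) *\<^sub>R (- w x *\<^sub>R f x))) (at x within {c..d})" if x: "x \<in> {c..d}" for x
  proof -
    have "((\<lambda>x. inverse (p x)) has_real_derivative q x) (at x within {c..d})"
      using DERIV_inverse'[OF p'(2)[OF x] pnz[OF x]] unfolding q_def
      by (simp add: power2_eq_square field_simps)
    then show ?thesis
      using has_vector_derivative_scaleR[OF _ dV[OF x], of "\<lambda>x. inverse (p x)" "q x"]
      by (simp add: add.commute)
  qed
  have "has_weak_deriv c d u (\<lambda>x. V x /\<^sub>R p x)"
    by (rule C1_imp_has_weak_deriv[OF _ du])
      (auto intro!: continuous_intros cont cp dest: pnz)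
  moreover have "has_weak_deriv c d (\<lambda>x. V x /\<^sub>R p x)
      (\<lambda>x. q x *\<^sub>R V x + inverse (p x) *\<^sub>R (- w x *\<^sub>R f x))"
    unfolding q_def
    by (rule C1_imp_has_weak_deriv[OF _ dv[unfolded q_def]])
      (auto intro!: continuous_intros cont cp v w p' cf[unfolded f_def] simp: f_def dest: pnz)
  ultimately have "u \<in> H2 c d" unfolding H2_def by blast
  moreover have "f \<in> L2 c d"
    unfolding f_def by (intro continuous_on_imp_L2 continuous_intros v cont)
  moreover have "has_weak_deriv c d V (\<lambda>x. - w x *\<^sub>R f x)"
    by (rule C1_imp_has_weak_deriv[OF cf dV])
  moreover have "AE x in lebesgue_on {c..d}. f x = - (1 / w x) *\<^sub>R (- w x *\<^sub>R f x)"
  proof (rule AE_I2)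
    fix x assume "x \<in> space (lebesgue_on {c..d})"
    then have "w x \<noteq> 0" using w(2)[of x] by auto
    then show "f x = - (1 / w x) *\<^sub>R (- w x *\<^sub>R f x)" by simp
  qed
  ultimately show ?L
    using R unfolding SL_graph_def V_def f_def by blast
qed

section \<open>Root vectors of the limit operator\<close>

context sl_interval
begin

abbreviation csys :: "real \<Rightarrow> (real \<Rightarrow> complex) \<Rightarrow> (real \<Rightarrow> complex) \<Rightarrow> (real \<Rightarrow> complex) \<Rightarrow> bool" where
  "csys t g u v \<equiv> csl_system c 0 p (\<lambda>x. t * w x) g u v"

lemma csys_sol:
  "csys t (\<lambda>x. 0) (\<lambda>x. C * complex_of_real (sol t x)) (\<lambda>x. C * complex_of_real (flux t x))"
  using csl_system_complex_multiple[OF sol_sys, of t C] by simp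

lemma csys_homogeneous:
  assumes "csys t (\<lambda>x. 0) u v" "u c = 0" "x \<in> {c..0}"
  shows "u x = v c * complex_of_real (sol t x)" "v x = v c * complex_of_real (flux t x)"
proof -
  have re: "sys t (\<lambda>x. 0) (\<lambda>x. Re (u x)) (\<lambda>x. Re (v x))" "Re (u c) = 0"
    and im: "sys t (\<lambda>x. 0) (\<lambda>x. Im (u x)) (\<lambda>x. Im (v x))" "Im (u c) = 0"
    using assms(1,2) by (simp_all add: csl_system_def)
  show "u x = v c * complex_of_real (sol t x)" "v x = v c * complex_of_real (flux t x)"
    using homogeneous_eq_sol[OF re assms(3)] homogeneous_eq_sol[OF im assms(3)]
    by (simp_all add: complex_eq_iff)
qed

lemma sys_resonance:
  assumes "sys t (\<lambda>x. - w x * (C * sol t x)) u v" "u c = 0"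
  shows "v 0 * sol t 0 - u 0 * flux t 0 = - C * sol_norm2 t"
proof -
  have "((\<lambda>x. - C * (w x * (sol t x)\<^sup>2)) has_integral v 0 * sol t 0 - u 0 * flux t 0) {c..0}"
    using sl_system_lagrange[OF less_imp_le[OF c_neg] assms(1) sol_sys[of t]] assms(2)
    by (simp add: algebra_simps power2_eq_square)
  then show ?thesis by (simp add: has_integral_iff sol_norm2_def)
qed

text \<open>
  The Lagrange identity against the shooting solution. A right-hand side that is a multiple of \<open>w sol\<close>
  occurs in Jordan chains; the identity shows which boundary values at 0 it enforces.
\<close>
lemma csys_resonance:
  assumes "csys t (\<lambda>x. - w x *\<^sub>R (C * complex_of_real (sol t x))) u v" "u c = 0"
  shows "v 0 * complex_of_real (sol t 0) - u 0 * complex_of_real (flux t 0) = - C * complex_of_real (sol_norm2 t)"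
proof -
  have re: "sys t (\<lambda>x. - w x * (Re C * sol t x)) (\<lambda>x. Re (u x)) (\<lambda>x. Re (v x))" "Re (u c) = 0"
    and im: "sys t (\<lambda>x. - w x * (Im C * sol t x)) (\<lambda>x. Im (u x)) (\<lambda>x. Im (v x))" "Im (u c) = 0"
    using assms by (simp_all add: csl_system_def)
  show ?thesis
    using sys_resonance[OF re] sys_resonance[OF im] by (simp add: complex_eq_iff)
qed

end

lemma csl_system_quasi_derivative:
  assumes "c < d" and p: "\<And>x. x \<in> {c..d} \<Longrightarrow> p x > 0" and "csl_system c d p q g u v"
    and x: "x \<in> {c..d}"
  shows "p x *\<^sub>R Dv c d u x = v x"
proof -
  have "Dv c d u x = v x /\<^sub>R p x"
    using Dv_eqI[OF assms(1) x] assms(3) x unfolding csl_system_iff by blast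
  then show ?thesis using p[OF x] by simp
qed

text \<open>
  The interpretation \<open>L\<close> is the left half; \<open>R\<close> is the right half reflected to \<open>[-b, 0]\<close>.
\<close>
locale two_phase =
  fixes a b :: real and k r \<kappa> \<rho> :: "real \<Rightarrow> real"
  assumes a_neg: "a < 0" and b_pos: "0 < b"
    and k_smooth: "smooth_on_Icc a 0 k" and r_smooth: "smooth_on_Icc a 0 r"
    and \<kappa>_smooth: "smooth_on_Icc 0 b \<kappa>" and \<rho>_smooth: "smooth_on_Icc 0 b \<rho>"
    and kr_pos: "\<And>x. x \<in> {a..0} \<Longrightarrow> k x > 0 \<and> r x > 0"
    and \<kappa>\<rho>_pos: "\<And>x. x \<in> {0..b} \<Longrightarrow> \<kappa> x > 0 \<and> \<rho> x > 0"
begin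

lemma coeff_cont: "continuous_on {a..0} k" "continuous_on {a..0} r"
    "continuous_on {0..b} \<kappa>" "continuous_on {0..b} \<rho>"
  using k_smooth r_smooth \<kappa>_smooth \<rho>_smooth smooth_on_Icc_continuous by blast+

lemma continuous_on_reflect:
  fixes f :: "real \<Rightarrow> 'x::topological_space"
  shows "continuous_on {0..b} f \<longleftrightarrow> continuous_on {-b..0} (\<lambda>x. f (-x))"
proof
  assume "continuous_on {0..b} f"
  then show "continuous_on {-b..0} (\<lambda>x. f (-x))"
    by (rule continuous_on_compose2) (auto intro: continuous_intros)
next
  assume "continuous_on {-b..0} (\<lambda>x. f (-x))"
  then have "continuous_on {0..b} (\<lambda>x. f (- (-x)))"
    by (rule continuous_on_compose2) (auto intro: continuous_intros)
  then show "continuous_on {0..b} f" by simp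
qed

sublocale L: sl_interval a k r
  by unfold_locales (use a_neg coeff_cont kr_pos in auto)

sublocale R: sl_interval "-b" "\<lambda>x. \<kappa> (-x)" "\<lambda>x. \<rho> (-x)"
  by unfold_locales (use b_pos coeff_cont \<kappa>\<rho>_pos in \<open>auto simp: continuous_on_reflect[symmetric]\<close>)

lemma L_rotating: "rotating (\<lambda>t. L.sol t 0) (\<lambda>t. L.flux t 0)"
  unfolding rotating_def using L.endpoint_isCont L.rotation by blast

lemma R_rotating: "rotating (\<lambda>t. R.sol t 0) (\<lambda>t. R.flux t 0)"
  unfolding rotating_def using R.endpoint_isCont R.rotation by blast

sublocale rotating_pair "\<lambda>t. L.sol t 0" "\<lambda>t. L.flux t 0" "\<lambda>t. R.sol t 0" "\<lambda>t. R.flux t 0"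
  by unfold_locales (rule L_rotating R_rotating)+

abbreviation \<A> :: "(cpair \<times> cpair) set" where
  "\<A> \<equiv> A_op a b k r \<kappa> \<rho>"

text \<open>
  The equation \<open>(A - t) u = v\<close> for classical solutions, with the right component reflected.
\<close>
definition root_equation :: "real \<Rightarrow> cpair \<Rightarrow> cpair \<Rightarrow> bool" where
  "root_equation t v u \<longleftrightarrow>
     (\<forall>x. x \<notin> {a..0} \<longrightarrow> fst u x = 0) \<and> (\<forall>x. x \<notin> {0..b} \<longrightarrow> snd u x = 0) \<and>
     fst u a = 0 \<and> snd u b = 0 \<and> fst u 0 = snd u 0 \<and>
     (\<exists>V W. L.csys t (\<lambda>x. - r x *\<^sub>R fst v x) (fst u) V \<and> V 0 = 0 \<and>
            R.csys t (\<lambda>x. - \<rho> (-x) *\<^sub>R snd v (-x)) (\<lambda>x. snd u (-x)) W)"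

lemma A_op_iff_root_equation:
  assumes v: "continuous_on {a..0} v1" "continuous_on {0..b} v2"
  shows "((u1, u2), (\<lambda>x. v1 x + complex_of_real t * u1 x, \<lambda>x. v2 x + complex_of_real t * u2 x)) \<in> \<A>
    \<longleftrightarrow> root_equation t (v1, v2) (u1, u2)"
proof -
  define P where "P = (\<lambda>x. k x *\<^sub>R Dv a 0 u1 x)"
  define Q where "Q = (\<lambda>x. \<kappa> x *\<^sub>R Dv 0 b u2 x)"
  have z: "0 \<in> {a..0}" using a_neg by simp
  have k0: "k 0 \<noteq> 0" using kr_pos[OF z] by simp
  have graph1: "(u1, \<lambda>x. v1 x + complex_of_real t * u1 x) \<in> SL_graph a 0 k r \<longleftrightarrow>
      (\<forall>x. x \<notin> {a..0} \<longrightarrow> u1 x = 0) \<and> L.csys t (\<lambda>x. - r x *\<^sub>R v1 x) u1 P"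
    unfolding P_def
    by (rule SL_graph_iff) (use a_neg k_smooth kr_pos coeff_cont v in auto)
  have graph2: "(u2, \<lambda>x. v2 x + complex_of_real t * u2 x) \<in> SL_graph 0 b \<kappa> \<rho> \<longleftrightarrow>
      (\<forall>x. x \<notin> {0..b} \<longrightarrow> u2 x = 0) \<and> csl_system 0 b \<kappa> (\<lambda>x. t * \<rho> x) (\<lambda>x. - \<rho> x *\<^sub>R v2 x) u2 Q"
    unfolding Q_def
    by (rule SL_graph_iff) (use b_pos \<kappa>_smooth \<kappa>\<rho>_pos coeff_cont v in auto)
  show ?thesis
  proof
    assume A: "((u1, u2), (\<lambda>x. v1 x + complex_of_real t * u1 x, \<lambda>x. v2 x + complex_of_real t * u2 x)) \<in> \<A>"
    then have "csl_system 0 b \<kappa> (\<lambda>x. t * \<rho> x) (\<lambda>x. - \<rho> x *\<^sub>R v2 x) u2 Q"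
      using graph2 by (simp add: A_op_def)
    from csl_system_reflect[OF this]
    have "R.csys t (\<lambda>x. - \<rho> (-x) *\<^sub>R v2 (-x)) (\<lambda>x. u2 (-x)) (\<lambda>x. - Q (-x))" by simp
    moreover have "L.csys t (\<lambda>x. - r x *\<^sub>R v1 x) u1 P" "P 0 = 0"
      using A graph1 by (auto simp: A_op_def P_def)
    ultimately show "root_equation t (v1, v2) (u1, u2)"
      using A graph1 graph2 unfolding root_equation_def A_op_def by auto
  next
    assume "root_equation t (v1, v2) (u1, u2)"
    then obtain V W where eq: "\<forall>x. x \<notin> {a..0} \<longrightarrow> u1 x = 0" "\<forall>x. x \<notin> {0..b} \<longrightarrow> u2 x = 0"
      "u1 a = 0" "u2 b = 0" "u1 0 = u2 0" "V 0 = 0"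
      and V: "L.csys t (\<lambda>x. - r x *\<^sub>R v1 x) u1 V"
      and W: "R.csys t (\<lambda>x. - \<rho> (-x) *\<^sub>R v2 (-x)) (\<lambda>x. u2 (-x)) W"
      unfolding root_equation_def by auto
    have PV: "P x = V x" if "x \<in> {a..0}" for x
      unfolding P_def using csl_system_quasi_derivative[OF a_neg L.p_pos V that] .
    have sys1: "L.csys t (\<lambda>x. - r x *\<^sub>R v1 x) u1 P"
      by (rule csl_system_cong[OF V]) (use PV in auto)
    have W': "csl_system 0 b \<kappa> (\<lambda>x. t * \<rho> x) (\<lambda>x. - \<rho> x *\<^sub>R v2 x) u2 (\<lambda>x. - W (-x))"
      using csl_system_reflect[OF W] by simp
    have QW: "Q x = - W (-x)" if "x \<in> {0..b}" for x
      unfolding Q_def using csl_system_quasi_derivative[OF b_pos _ W' that] \<kappa>\<rho>_pos by blast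
    have sys2: "csl_system 0 b \<kappa> (\<lambda>x. t * \<rho> x) (\<lambda>x. - \<rho> x *\<^sub>R v2 x) u2 Q"
      by (rule csl_system_cong[OF W']) (use QW in auto)
    have "Dv a 0 u1 0 = 0"
      using PV[OF z] eq(6) k0 by (simp add: P_def)
    then show "((u1, u2), (\<lambda>x. v1 x + complex_of_real t * u1 x, \<lambda>x. v2 x + complex_of_real t * u2 x)) \<in> \<A>"
      using graph1 graph2 sys1 sys2 eq unfolding A_op_def by auto
  qed
qed

lemma root_vectors_continuous:
  assumes "u \<in> root_vectors \<A> l m"
  shows "continuous_on {a..0} (fst u)" "continuous_on {0..b} (snd u)"
proof -
  have "continuous_on {a..0} (fst u) \<and> continuous_on {0..b} (snd u)"
  proof (cases m)
    case 0
    then show ?thesis using assms by simp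
  next
    case (Suc n)
    then have "fst u \<in> H2 a 0" "snd u \<in> H2 0 b"
      using assms by (auto simp: A_op_def SL_graph_def)
    then show ?thesis
      unfolding H2_def using has_weak_deriv_continuous by blast
  qed
  then show "continuous_on {a..0} (fst u)" "continuous_on {0..b} (snd u)" by auto
qed

lemma root_vectors_Suc_iff:
  "u \<in> root_vectors \<A> (complex_of_real t) (Suc m) \<longleftrightarrow>
    (\<exists>v \<in> root_vectors \<A> (complex_of_real t) m. root_equation t v u)"
proof -
  obtain u1 u2 where u: "u = (u1, u2)" by fastforce
  have "((u1, u2), (\<lambda>x. v1 x + complex_of_real t * u1 x, \<lambda>x. v2 x + complex_of_real t * u2 x)) \<in> \<A>
      \<longleftrightarrow> root_equation t (v1, v2) (u1, u2)"
    if "(v1, v2) \<in> root_vectors \<A> (complex_of_real t) m" for v1 v2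
    using A_op_iff_root_equation root_vectors_continuous[OF that] by simp
  then show ?thesis unfolding u by (auto simp: Bex_def)
qed

end

context two_phase
begin

lemma root_equation_conditions:
  assumes "root_equation t v u"
  shows "\<And>x. x \<notin> {a..0} \<Longrightarrow> fst u x = 0" "\<And>x. x \<notin> {0..b} \<Longrightarrow> snd u x = 0"
    "fst u a = 0" "snd u b = 0" "fst u 0 = snd u 0"
  using assms unfolding root_equation_def by auto

text \<open>
  The left components of a chain form a chain of \<open>A1\<close>, which is symmetric and has no Jordan blocks: if
  \<open>t\<close> is an eigenvalue of \<open>A1\<close> and \<open>v\<close> has a nonzero left component, then the equation for \<open>u\<close> is not
  solvable.
\<close>
lemma root_equation_left:
  assumes "root_equation t v u" and v: "\<And>x. x \<in> {a..0} \<Longrightarrow> fst v x = C * complex_of_real (L.sol t x)"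
  shows "C = 0 \<Longrightarrow> \<exists>M. (\<forall>x\<in>{a..0}. fst u x = M * complex_of_real (L.sol t x)) \<and>
      M * complex_of_real (L.flux t 0) = 0"
    and "L.flux t 0 = 0 \<Longrightarrow> C = 0"
proof -
  obtain V where V: "L.csys t (\<lambda>x. - r x *\<^sub>R fst v x) (fst u) V" "V 0 = 0" "fst u a = 0"
    using assms(1) unfolding root_equation_def by blast
  have sys: "L.csys t (\<lambda>x. - r x *\<^sub>R (C * complex_of_real (L.sol t x))) (fst u) V"
    by (rule csl_system_cong[OF V(1)]) (use v in auto)
  have z: "0 \<in> {a..0}" using a_neg by simp
  {
    assume "C = 0"
    then have hom: "L.csys t (\<lambda>x. 0) (fst u) V" using sys by simp
    have "V a * complex_of_real (L.flux t 0) = 0"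
      using L.csys_homogeneous(2)[OF hom V(3) z] V(2) by simp
    then show "\<exists>M. (\<forall>x\<in>{a..0}. fst u x = M * complex_of_real (L.sol t x)) \<and>
        M * complex_of_real (L.flux t 0) = 0"
      using L.csys_homogeneous(1)[OF hom V(3)] by blast
  }
  assume "L.flux t 0 = 0"
  then have "C * complex_of_real (L.sol_norm2 t) = 0"
    using L.csys_resonance[OF sys V(3)] V(2) by simp
  then show "C = 0"
    using L.sol_norm2_pos[of t] by simp
qed

lemma root_equation_right_homogeneous:
  assumes "root_equation t v u" and v: "\<And>x. x \<in> {0..b} \<Longrightarrow> snd v x = 0"
  shows "\<exists>M. \<forall>x\<in>{0..b}. snd u x = M * complex_of_real (R.sol t (-x))"
proof -
  obtain W where W: "R.csys t (\<lambda>x. - \<rho> (-x) *\<^sub>R snd v (-x)) (\<lambda>x. snd u (-x)) W" "snd u b = 0"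
    using assms(1) unfolding root_equation_def by blast
  have hom: "R.csys t (\<lambda>x. 0) (\<lambda>x. snd u (-x)) W"
    by (rule csl_system_cong[OF W(1)]) (use v in auto)
  have "snd u x = W (-b) * complex_of_real (R.sol t (-x))" if "x \<in> {0..b}" for x
    using R.csys_homogeneous(1)[OF hom, of "-x"] W(2) that by simp
  then show ?thesis by blast
qed

text \<open>
  On the right a nontrivial chain is possible, because the coupling condition permits a nonzero value
  at 0; this value is determined by the previous member of the chain.
\<close>
lemma root_equation_right_resonance:
  assumes "root_equation t v u" "R.sol t 0 = 0"
    and v: "\<And>x. x \<in> {0..b} \<Longrightarrow> snd v x = C * complex_of_real (R.sol t (-x))"
  shows "snd u 0 * complex_of_real (R.flux t 0) = C * complex_of_real (R.sol_norm2 t)"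
proof -
  obtain W where W: "R.csys t (\<lambda>x. - \<rho> (-x) *\<^sub>R snd v (-x)) (\<lambda>x. snd u (-x)) W" "snd u b = 0"
    using assms(1) unfolding root_equation_def by blast
  have sys: "R.csys t (\<lambda>x. - \<rho> (-x) *\<^sub>R (C * complex_of_real (R.sol t x))) (\<lambda>x. snd u (-x)) W"
    by (rule csl_system_cong[OF W(1)]) (use v in auto)
  show ?thesis
    using R.csys_resonance[OF sys] W(2) assms(2) by simp
qed

lemma root_equationI:
  assumes "\<And>x. x \<notin> {a..0} \<Longrightarrow> fst u x = 0" "\<And>x. x \<notin> {0..b} \<Longrightarrow> snd u x = 0"
    and left: "\<And>x. x \<in> {a..0} \<Longrightarrow> fst u x = C * complex_of_real (L.sol t x)" "C * complex_of_real (L.flux t 0) = 0"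
      "\<And>x. x \<in> {a..0} \<Longrightarrow> fst v x = 0"
    and right: "R.csys t (\<lambda>x. - \<rho> (-x) *\<^sub>R snd v (-x)) (\<lambda>x. snd u (-x)) W"
    and "snd u b = 0" "fst u 0 = snd u 0"
  shows "root_equation t v u"
proof -
  have "L.csys t (\<lambda>x. - r x *\<^sub>R fst v x) (fst u) (\<lambda>x. C * complex_of_real (L.flux t x))"
    by (rule csl_system_cong[OF L.csys_sol[of t C]]) (use left in auto)
  moreover have "fst u a = 0" using left(1)[of a] a_neg by simp
  ultimately show ?thesis
    unfolding root_equation_def using assms by blast
qed

definition left_part :: "real \<Rightarrow> complex \<Rightarrow> real \<Rightarrow> complex" where
  "left_part t C x = C * zero_ext a 0 (L.sol t) x"

definition right_part :: "real \<Rightarrow> complex \<Rightarrow> real \<Rightarrow> complex" where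
  "right_part t C x = C * zero_ext 0 b (\<lambda>x. R.sol t (-x)) x"

lemma part_simps [simp]:
  "x \<in> {a..0} \<Longrightarrow> left_part t C x = C * complex_of_real (L.sol t x)"
  "x \<notin> {a..0} \<Longrightarrow> left_part t C x = 0"
  "x \<in> {0..b} \<Longrightarrow> right_part t C x = C * complex_of_real (R.sol t (-x))"
  "x \<notin> {0..b} \<Longrightarrow> right_part t C x = 0"
  by (auto simp: left_part_def right_part_def zero_ext_def)

lemma zero_mem: "0 \<in> {a..0}" "0 \<in> {0..b}" "a \<in> {a..0}" "b \<in> {0..b}"
  using a_neg b_pos by auto

text \<open>
  If \<open>t\<close> is not an eigenvalue of \<open>A1\<close>, the left component vanishes and the right component is subject
  to Dirichlet conditions at both ends, hence an ordinary eigenfunction of \<open>A2_hat\<close>.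
\<close>
lemma root_vectors_regular:
  assumes f: "L.flux t 0 \<noteq> 0" and u: "u \<in> root_vectors \<A> (complex_of_real t) m"
  shows "\<exists>D. u = (\<lambda>x. 0, right_part t D) \<and> (R.sol t 0 \<noteq> 0 \<longrightarrow> D = 0)"
  using u
proof (induction m arbitrary: u)
  case 0
  then show ?case by (auto simp: right_part_def intro: exI[of _ 0])
next
  case (Suc m)
  then obtain v where v: "v \<in> root_vectors \<A> (complex_of_real t) m" and eq: "root_equation t v u"
    using root_vectors_Suc_iff by blast
  obtain D where D: "v = (\<lambda>x. 0, right_part t D)" "R.sol t 0 \<noteq> 0 \<longrightarrow> D = 0"
    using Suc.IH[OF v] by blast
  note cond = root_equation_conditions[OF eq]
  obtain M where M: "\<forall>x\<in>{a..0}. fst u x = M * complex_of_real (L.sol t x)" "M * complex_of_real (L.flux t 0) = 0"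
    using root_equation_left(1)[OF eq, of 0] D(1) by auto
  then have "M = 0" using f by simp
  have fst0: "fst u x = 0" for x
    using M(1) cond(1)[of x] \<open>M = 0\<close> by (cases "x \<in> {a..0}") auto
  have "D = 0"
  proof (cases "R.sol t 0 = 0")
    case True
    have "snd u 0 * complex_of_real (R.flux t 0) = D * complex_of_real (R.sol_norm2 t)"
      by (rule root_equation_right_resonance[OF eq True]) (simp add: D(1))
    then show ?thesis
      using R.sol_norm2_pos[of t] cond(5) fst0 by simp
  qed (use D(2) in simp)
  then have "\<And>x. x \<in> {0..b} \<Longrightarrow> snd v x = 0" using D(1) by simp
  then obtain M' where M': "\<And>x. x \<in> {0..b} \<Longrightarrow> snd u x = M' * complex_of_real (R.sol t (-x))"
    using root_equation_right_homogeneous[OF eq] by blast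
  have "snd u = right_part t M'"
  proof
    fix x show "snd u x = right_part t M' x"
      using M'[of x] cond(2)[of x] by (cases "x \<in> {0..b}") auto
  qed
  moreover have "M' * complex_of_real (R.sol t 0) = 0"
    using M'[OF zero_mem(2)] cond(5) fst0 by simp
  moreover have "fst u = (\<lambda>x. 0)" using fst0 by auto
  ultimately show ?case by (intro exI[of _ M']) (auto simp: prod_eq_iff)
qed

text \<open>
  For an eigenvalue of \<open>A1\<close> only, the left component is an eigenfunction, its chain stops by
  \<open>root_equation_left\<close>, and the right component is determined by its value at 0.
\<close>
lemma root_vectors_simple_left:
  assumes f: "L.flux t 0 = 0" and G: "R.sol t 0 \<noteq> 0"
    and u: "u \<in> root_vectors \<A> (complex_of_real t) m"
  shows "\<exists>C. u = (left_part t C, right_part t (C * complex_of_real (L.sol t 0 / R.sol t 0)))"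
  using u
proof (induction m arbitrary: u)
  case 0
  then show ?case by (auto simp: left_part_def right_part_def intro: exI[of _ 0])
next
  case (Suc m)
  then obtain v where v: "v \<in> root_vectors \<A> (complex_of_real t) m" and eq: "root_equation t v u"
    using root_vectors_Suc_iff by blast
  obtain C where C: "v = (left_part t C, right_part t (C * complex_of_real (L.sol t 0 / R.sol t 0)))"
    using Suc.IH[OF v] by blast
  note cond = root_equation_conditions[OF eq]
  have left: "\<And>x. x \<in> {a..0} \<Longrightarrow> fst v x = C * complex_of_real (L.sol t x)" using C by simp
  have "C = 0" using root_equation_left(2)[OF eq left f] .
  obtain M where M: "\<And>x. x \<in> {a..0} \<Longrightarrow> fst u x = M * complex_of_real (L.sol t x)"
    using root_equation_left(1)[OF eq left \<open>C = 0\<close>] by blast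
  have "\<And>x. x \<in> {0..b} \<Longrightarrow> snd v x = 0" using C \<open>C = 0\<close> by simp
  then obtain M' where M': "\<And>x. x \<in> {0..b} \<Longrightarrow> snd u x = M' * complex_of_real (R.sol t (-x))"
    using root_equation_right_homogeneous[OF eq] by blast
  have "M' * complex_of_real (R.sol t 0) = M * complex_of_real (L.sol t 0)"
    using M[OF zero_mem(1)] M'[OF zero_mem(2)] cond(5) by simp
  then have "M' = M * complex_of_real (L.sol t 0 / R.sol t 0)"
    using G by (simp add: field_simps)
  moreover have "snd u = right_part t M'"
  proof
    fix x show "snd u x = right_part t M' x"
      using M'[of x] cond(2)[of x] by (cases "x \<in> {0..b}") auto
  qed
  moreover have "fst u = left_part t M"
  proof
    fix x show "fst u x = left_part t M x"
      using M[of x] cond(1)[of x] by (cases "x \<in> {a..0}") auto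
  qed
  ultimately show ?case by (intro exI[of _ M]) (simp add: prod_eq_iff)
qed

text \<open>
  The candidate for the right component of the second vector of a Jordan chain.
\<close>
lemma generalized_right_solution:
  obtains w W where "R.sys t (\<lambda>x. - \<rho> (-x) * R.sol t x) w W" "w (-b) = 0" "W (-b) = 0"
proof -
  have "continuous_on {-b..0} (\<lambda>x. - \<rho> (-x) * R.sol t x)"
    by (intro continuous_intros R.w_cont R.sol_cont)
  then show ?thesis
    using sl_system_exists[OF R.c_neg R.p_cont R.p_pos R.qw_cont, where A = 0 and B = 0] that by metis
qed

lemma generalized_right_solution_nonzero:
  assumes "R.sys t (\<lambda>x. - \<rho> (-x) * R.sol t x) w W" "w (-b) = 0" "R.sol t 0 = 0"
  shows "w 0 \<noteq> 0"
proof
  assume "w 0 = 0"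
  have "R.sys t (\<lambda>x. - \<rho> (-x) * (1 * R.sol t x)) w W" using assms(1) by simp
  from R.sys_resonance[of t 1 w W, OF this assms(2)] have "R.sol_norm2 t = 0"
    using \<open>w 0 = 0\<close> assms(3) by simp
  then show False using R.sol_norm2_pos[of t] by simp
qed

text \<open>
  For a common eigenvalue the chain has length two: the eigenvector has zero left component, and the
  nonzero value \<open>w 0\<close> of the second vector is matched by an eigenfunction of \<open>A1\<close>. This left
  component prevents a third vector.
\<close>
lemma root_vectors_double:
  assumes f: "L.flux t 0 = 0" and G: "R.sol t 0 = 0"
    and w: "R.sys t (\<lambda>x. - \<rho> (-x) * R.sol t x) w W" "w (-b) = 0"
    and u: "u \<in> root_vectors \<A> (complex_of_real t) m"
  shows "\<exists>C D. u = (left_part t (D * complex_of_real (w 0 / L.sol t 0)),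
      \<lambda>x. right_part t C x + D * zero_ext 0 b (\<lambda>x. w (-x)) x)"
  using u
proof (induction m arbitrary: u)
  case 0
  then show ?case by (auto simp: left_part_def right_part_def intro!: exI[of _ 0])
next
  case (Suc m)
  have w0: "w 0 \<noteq> 0" by (rule generalized_right_solution_nonzero[OF w(1,2) G])
  have F: "L.sol t 0 \<noteq> 0" by (rule rotating_nonzero[OF L_rotating f])
  obtain v where v: "v \<in> root_vectors \<A> (complex_of_real t) m" and eq: "root_equation t v u"
    using Suc.prems root_vectors_Suc_iff by blast
  obtain C D where CD: "v = (left_part t (D * complex_of_real (w 0 / L.sol t 0)),
      \<lambda>x. right_part t C x + D * zero_ext 0 b (\<lambda>x. w (-x)) x)"
    using Suc.IH[OF v] by blast
  note cond = root_equation_conditions[OF eq]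
  have left: "\<And>x. x \<in> {a..0} \<Longrightarrow> fst v x = (D * complex_of_real (w 0 / L.sol t 0)) * complex_of_real (L.sol t x)"
    using CD by simp
  have D0: "D * complex_of_real (w 0 / L.sol t 0) = 0"
    by (rule root_equation_left(2)[OF eq left f])
  then have "D = 0" using w0 F by simp
  obtain M where M: "\<And>x. x \<in> {a..0} \<Longrightarrow> fst u x = M * complex_of_real (L.sol t x)"
    using root_equation_left(1)[OF eq left D0] by blast
  obtain U where U: "R.csys t (\<lambda>x. - \<rho> (-x) *\<^sub>R snd v (-x)) (\<lambda>x. snd u (-x)) U"
    using eq unfolding root_equation_def by blast
  \<comment> \<open>Subtracting the particular solution leaves a solution of the homogeneous equation.\<close>
  have "R.csys t (\<lambda>x. - \<rho> (-x) *\<^sub>R snd v (-x) - C * complex_of_real (- \<rho> (-x) * R.sol t x))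
      (\<lambda>x. snd u (-x) - C * complex_of_real (w x)) (\<lambda>x. U x - C * complex_of_real (W x))"
    by (rule csl_system_diff[OF U csl_system_complex_multiple[OF w(1)]])
  then have hom: "R.csys t (\<lambda>x. 0)
      (\<lambda>x. snd u (-x) - C * complex_of_real (w x)) (\<lambda>x. U x - C * complex_of_real (W x))"
    by (rule csl_system_cong) (auto simp: CD \<open>D = 0\<close> scaleR_conv_of_real)
  obtain M' where M': "\<And>x. x \<in> {-b..0} \<Longrightarrow>
      snd u (-x) - C * complex_of_real (w x) = M' * complex_of_real (R.sol t x)"
    using R.csys_homogeneous(1)[OF hom] cond(4) w(2) by fastforce
  have "C * complex_of_real (w 0) = M * complex_of_real (L.sol t 0)"
    using M'[of 0] M[OF zero_mem(1)] cond(5) G b_pos by simp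
  then have M_eq: "M = C * complex_of_real (w 0 / L.sol t 0)"
    using F by (simp add: field_simps)
  have "snd u = (\<lambda>x. right_part t M' x + C * zero_ext 0 b (\<lambda>x. w (-x)) x)"
  proof
    fix x show "snd u x = right_part t M' x + C * zero_ext 0 b (\<lambda>x. w (-x)) x"
      using M'[of "-x"] cond(2)[of x] by (cases "x \<in> {0..b}") (auto simp: zero_ext_def algebra_simps)
  qed
  moreover have "fst u = left_part t M"
  proof
    fix x show "fst u x = left_part t M x"
      using M[of x] cond(1)[of x] by (cases "x \<in> {a..0}") auto
  qed
  ultimately show ?case
    unfolding M_eq by (intro exI[of _ M'] exI[of _ C]) (simp add: prod_eq_iff)
qed

lemma alg_mult_eq_limit_mult: "alg_mult \<A> (complex_of_real t) = limit_mult t"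
proof -
  interpret vs: vector_space cpair_scale by (rule vector_space_cpair_scale)
  define U where "U = (\<Union>m. root_vectors \<A> (complex_of_real t) m)"
  define E0 :: cpair where "E0 = (\<lambda>x. 0, right_part t 1)"
  have dim_unique: "vs.dim U = card B" if "B \<subseteq> U" "U \<subseteq> vs.span B" "vs.independent B" for B
    using vs.dim_unique[OF that refl] .
  have dim_single: "vs.dim U = 1" if "E \<in> U" "E \<noteq> 0" "\<And>u. u \<in> U \<Longrightarrow> \<exists>C. u = cpair_scale C E" for E
  proof -
    have "vs.independent {E}" using that(2) by simp
    moreover have "U \<subseteq> vs.span {E}" unfolding vs.span_singleton using that(3) by blast
    ultimately show ?thesis using dim_unique[of "{E}"] that(1) by simp
  qed
  have zero_in: "(\<lambda>x. 0, \<lambda>x. 0) \<in> root_vectors \<A> (complex_of_real t) 0" by simp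
  have E0_root: "E0 \<in> root_vectors \<A> (complex_of_real t) (Suc 0)" if G: "R.sol t 0 = 0"
  proof -
    have "root_equation t (\<lambda>x. 0, \<lambda>x. 0) E0"
    proof (rule root_equationI[where C = 0])
      show "R.csys t (\<lambda>x. - \<rho> (-x) *\<^sub>R snd (\<lambda>x. 0, \<lambda>x. 0) (-x)) (\<lambda>x. snd E0 (-x))
          (\<lambda>x. 1 * complex_of_real (R.flux t x))"
        by (rule csl_system_cong[OF R.csys_sol[of t 1]]) (auto simp: E0_def)
    qed (use G zero_mem in \<open>auto simp: E0_def\<close>)
    then show ?thesis
      using root_vectors_Suc_iff zero_in by blast
  qed
  have E0_nz: "E0 \<noteq> 0"
  proof
    assume "E0 = 0"
    obtain x where x: "x \<in> {-b..0}" "R.sol t x \<noteq> 0" using R.sol_nonzero by blast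
    have "right_part t 1 (-x) = 0" using \<open>E0 = 0\<close> by (simp add: E0_def prod_eq_iff fun_eq_iff)
    then show False using x by simp
  qed
  have "vs.dim U = limit_mult t"
  proof (cases "L.flux t 0 = 0")
    case False
    show ?thesis
    proof (cases "R.sol t 0 = 0")
      case True
      have "vs.dim U = 1"
      proof (rule dim_single[of E0])
        show "E0 \<in> U" unfolding U_def using E0_root[OF True] by blast
        fix u assume "u \<in> U"
        then obtain D where "u = (\<lambda>x. 0, right_part t D)"
          unfolding U_def using root_vectors_regular[OF False] by blast
        then show "\<exists>C. u = cpair_scale C E0"
          by (intro exI[of _ D]) (auto simp: E0_def cpair_scale_def right_part_def)
      qed (rule E0_nz)
      then show ?thesis using True False by (simp add: limit_mult_def)
    next
      case G: False
      have "U \<subseteq> {0}"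
      proof
        fix u assume "u \<in> U"
        then have "u = (\<lambda>x. 0, right_part t 0)"
          unfolding U_def using root_vectors_regular[OF False] G by blast
        then show "u \<in> {0}" by (simp add: right_part_def prod_eq_iff fun_eq_iff)
      qed
      moreover have "0 \<in> vs.span {}" by (rule vs.span_zero)
      ultimately have "vs.dim U = 0" using dim_unique[of "{}"] vs.independent_empty by auto
      then show ?thesis using G False by (simp add: limit_mult_def)
    qed
  next
    case f: True
    have F: "L.sol t 0 \<noteq> 0" by (rule rotating_nonzero[OF L_rotating f])
    show ?thesis
    proof (cases "R.sol t 0 = 0")
      case G: False
      define E :: cpair where "E = (left_part t 1, right_part t (complex_of_real (L.sol t 0 / R.sol t 0)))"
      have "root_equation t (\<lambda>x. 0, \<lambda>x. 0) E"
      proof (rule root_equationI[where C = 1])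
        show "R.csys t (\<lambda>x. - \<rho> (-x) *\<^sub>R snd (\<lambda>x. 0, \<lambda>x. 0) (-x)) (\<lambda>x. snd E (-x))
            (\<lambda>x. complex_of_real (L.sol t 0 / R.sol t 0) * complex_of_real (R.flux t x))"
          by (rule csl_system_cong[OF R.csys_sol[of t "complex_of_real (L.sol t 0 / R.sol t 0)"]])
            (auto simp: E_def)
      qed (use f G zero_mem in \<open>auto simp: E_def\<close>)
      then have "E \<in> U"
        unfolding U_def using root_vectors_Suc_iff zero_in by blast
      moreover have "fst E 0 \<noteq> 0" using F zero_mem by (simp add: E_def)
      then have "E \<noteq> 0" by auto
      moreover have "\<exists>C. u = cpair_scale C E" if "u \<in> U" for u
      proof -
        obtain m where "u \<in> root_vectors \<A> (complex_of_real t) m"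
          using \<open>u \<in> U\<close> by (auto simp: U_def)
        then obtain C where "u = (left_part t C, right_part t (C * complex_of_real (L.sol t 0 / R.sol t 0)))"
          using root_vectors_simple_left[OF f G] by blast
        then show ?thesis
          by (intro exI[of _ C]) (auto simp: E_def cpair_scale_def left_part_def right_part_def)
      qed
      ultimately have "vs.dim U = 1" by (rule dim_single)
      then show ?thesis using f G by (simp add: limit_mult_def)
    next
      case G: True
      obtain w W where w: "R.sys t (\<lambda>x. - \<rho> (-x) * R.sol t x) w W" "w (-b) = 0" "W (-b) = 0"
        by (rule generalized_right_solution)
      define E1 :: cpair where
        "E1 = (left_part t (complex_of_real (w 0 / L.sol t 0)), zero_ext 0 b (\<lambda>x. w (-x)))"
      have w0: "w 0 \<noteq> 0" by (rule generalized_right_solution_nonzero[OF w(1,2) G])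
      \<comment> \<open>The second vector of the Jordan chain over the eigenvector \<open>E0\<close>.\<close>
      have "root_equation t E0 E1"
      proof (rule root_equationI[where C = "complex_of_real (w 0 / L.sol t 0)"])
        show "R.csys t (\<lambda>x. - \<rho> (-x) *\<^sub>R snd E0 (-x)) (\<lambda>x. snd E1 (-x)) (\<lambda>x. 1 * complex_of_real (W x))"
          by (rule csl_system_cong[OF csl_system_complex_multiple[OF w(1), of 1]])
            (auto simp: E0_def E1_def zero_ext_def scaleR_conv_of_real)
      qed (use f F w zero_mem in \<open>auto simp: E0_def E1_def zero_ext_def\<close>)
      then have E1_root: "E1 \<in> root_vectors \<A> (complex_of_real t) (Suc (Suc 0))"
        using root_vectors_Suc_iff E0_root[OF G] by blast
      have "fst E1 0 \<noteq> 0" using F w0 zero_mem by (simp add: E1_def)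
      moreover have "fst (cpair_scale C E0) 0 = 0" for C by (simp add: E0_def cpair_scale_def)
      ultimately have nspan: "E1 \<notin> vs.span {E0}"
        unfolding vs.span_singleton by auto
      then have indep: "vs.independent {E1, E0}"
        by (intro vs.independent_insertI) (use E0_nz vs.independent_empty in auto)
      have "E1 \<noteq> E0" using nspan vs.span_base by blast
      have "vs.dim U = card {E1, E0}"
      proof (rule dim_unique[OF _ _ indep])
        show "{E1, E0} \<subseteq> U" unfolding U_def using E0_root[OF G] E1_root by blast
        show "U \<subseteq> vs.span {E1, E0}"
        proof
          fix u assume "u \<in> U"
          then obtain C D where "u = (left_part t (D * complex_of_real (w 0 / L.sol t 0)),
              \<lambda>x. right_part t C x + D * zero_ext 0 b (\<lambda>x. w (-x)) x)"
            unfolding U_def using root_vectors_double[OF f G w(1,2)] by blast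
          then have "u = cpair_scale C E0 + cpair_scale D E1"
            by (auto simp: E0_def E1_def cpair_scale_def left_part_def right_part_def prod_eq_iff fun_eq_iff)
          moreover have "cpair_scale C E0 + cpair_scale D E1 \<in> vs.span {E1, E0}"
            by (intro vs.span_add vs.span_scale vs.span_base) auto
          ultimately show "u \<in> vs.span {E1, E0}" by simp
        qed
      qed
      then show ?thesis using f G \<open>E1 \<noteq> E0\<close> by (simp add: limit_mult_def)
    qed
  qed
  then show ?thesis by (simp add: alg_mult_def U_def)
qed

end

section \<open>Perturbed eigenvalues\<close>

lemma sl_system_divide_coefficients:
  assumes "sl_system c d (\<lambda>x. e * p x) (\<lambda>x. e * q x) (\<lambda>x. 0) u v" "e \<noteq> 0"
  shows "sl_system c d p q (\<lambda>x. 0) u (\<lambda>x. v x / e)"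
  unfolding sl_system_def
proof (intro ballI conjI)
  fix x assume x: "x \<in> {c..d}"
  show "(u has_real_derivative v x / e / p x) (at x within {c..d})"
    using sl_systemD(1)[OF assms(1) x] by simp
  show "((\<lambda>x. v x / e) has_real_derivative 0 - q x * u x) (at x within {c..d})"
    using DERIV_cdivide[OF sl_systemD(2)[OF assms(1) x], of e] assms(2) by simp
qed

lemma sl_system_multiply_coefficients:
  assumes "sl_system c d p q (\<lambda>x. 0) u v" "e \<noteq> 0"
  shows "sl_system c d (\<lambda>x. e * p x) (\<lambda>x. e * q x) (\<lambda>x. 0) u (\<lambda>x. e * v x)"
  unfolding sl_system_def
proof (intro ballI conjI)
  fix x assume x: "x \<in> {c..d}"
  show "(u has_real_derivative e * v x / (e * p x)) (at x within {c..d})"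
    using sl_systemD(1)[OF assms(1) x] assms(2) by simp
  show "((\<lambda>x. e * v x) has_real_derivative 0 - e * q x * u x) (at x within {c..d})"
    using DERIV_cmult[OF sl_systemD(2)[OF assms(1) x], of e] by (simp add: mult.assoc)
qed

text \<open>
  A nondecreasing enumeration is determined by its counting function.
\<close>
lemma mono_on_count_below:
  fixes f :: "nat \<Rightarrow> real"
  assumes "mono_on {1..} f" "finite {i. 1 \<le> i \<and> f i < X}" "1 \<le> j"
  shows "f j < X \<longleftrightarrow> j \<le> card {i. 1 \<le> i \<and> f i < X}"
proof
  assume "f j < X"
  then have "{1..j} \<subseteq> {i. 1 \<le> i \<and> f i < X}"
    using mono_onD[OF assms(1), of _ j] assms(3) by force
  from card_mono[OF assms(2) this] show "j \<le> card {i. 1 \<le> i \<and> f i < X}" by simp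
next
  assume le: "j \<le> card {i. 1 \<le> i \<and> f i < X}"
  show "f j < X"
  proof (rule ccontr)
    assume n: "\<not> f j < X"
    have "i < j" if "1 \<le> i" "f i < X" for i
      using mono_onD[OF assms(1), of j i] that assms(3) n by (cases "j \<le> i") auto
    then have "{i. 1 \<le> i \<and> f i < X} \<subseteq> {1..<j}" by auto
    from card_mono[OF _ this] have "card {i. 1 \<le> i \<and> f i < X} \<le> j - 1" by simp
    then show False using le assms(3) by linarith
  qed
qed

context two_phase
begin

lemma left_solves_iff:
  "solves_SL a 0 k q g u \<longleftrightarrow> sl_system a 0 k q g u (\<lambda>x. k x * Dv a 0 u x)"
  by (rule solves_SL_iff_sl_system[OF a_neg]) (use kr_pos in blast)

lemma right_solves_iff:
  "solves_SL 0 b \<kappa> q g u \<longleftrightarrow> sl_system 0 b \<kappa> q g u (\<lambda>x. \<kappa> x * Dv 0 b u x)"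
  by (rule solves_SL_iff_sl_system[OF b_pos]) (use \<kappa>\<rho>_pos in blast)

lemma right_homogeneous_eq_sol:
  assumes "sl_system 0 b \<kappa> (\<lambda>x. t * \<rho> x) (\<lambda>x. 0) u v" "u b = 0" "x \<in> {0..b}"
  shows "u x = - v b * R.sol t (-x)" "v x = v b * R.flux t (-x)"
proof -
  have sys: "R.sys t (\<lambda>x. 0) (\<lambda>x. u (-x)) (\<lambda>x. - v (-x))"
    using sl_system_reflect[OF assms(1)] by simp
  have x: "- x \<in> {-b..0}" using assms(3) by simp
  show "u x = - v b * R.sol t (-x)" "v x = v b * R.flux t (-x)"
    using R.homogeneous_eq_sol[OF sys _ x] assms(2) by simp_all
qed

lemma right_sol_sys:
  "sl_system 0 b \<kappa> (\<lambda>x. t * \<rho> x) (\<lambda>x. 0) (\<lambda>x. R.sol t (-x)) (\<lambda>x. - R.flux t (-x))"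
  using sl_system_reflect[OF R.sol_sys[of t]] by simp

text \<open>
  \<open>\<alpha>\<close> and \<open>\<beta>\<close> are the fluxes at the outer ends, hence the amplitudes relative to the
  shooting solutions; the sign in \<open>- \<beta>\<close> comes from the reflection.
\<close>
lemma perturbed_eigenfunction_form:
  assumes "0 < \<epsilon>" and eig: "perturbed_eigenfunction a b k r \<kappa> \<rho> \<epsilon> l u"
  defines "t \<equiv> l / \<epsilon>" and "\<alpha> \<equiv> k a * Dv a 0 u a" and "\<beta> \<equiv> \<kappa> b * Dv 0 b u b"
  shows "sl_system a 0 k (\<lambda>x. t * r x) (\<lambda>x. 0) u (\<lambda>x. k x * Dv a 0 u x)"
    and "sl_system 0 b \<kappa> (\<lambda>x. t * \<rho> x) (\<lambda>x. 0) u (\<lambda>x. \<kappa> x * Dv 0 b u x)"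
    and "\<And>x. x \<in> {a..0} \<Longrightarrow> u x = \<alpha> * L.sol t x"
    and "\<And>x. x \<in> {a..0} \<Longrightarrow> k x * Dv a 0 u x = \<alpha> * L.flux t x"
    and "\<And>x. x \<in> {0..b} \<Longrightarrow> u x = - \<beta> * R.sol t (-x)"
    and "\<And>x. x \<in> {0..b} \<Longrightarrow> \<kappa> x * Dv 0 b u x = \<beta> * R.flux t (-x)"
    and "\<alpha> * L.flux t 0 = \<epsilon> * (\<beta> * R.flux t 0)"
    and "matching \<epsilon> t = 0"
proof -
  show sys1: "sl_system a 0 k (\<lambda>x. t * r x) (\<lambda>x. 0) u (\<lambda>x. k x * Dv a 0 u x)"
    unfolding left_solves_iff[symmetric] t_def
    using eig unfolding perturbed_eigenfunction_def by blast
  have "solves_SL 0 b (\<lambda>x. \<epsilon> * \<kappa> x) (\<lambda>x. l * \<rho> x) (\<lambda>x. 0) u"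
    using eig unfolding perturbed_eigenfunction_def by blast
  moreover have "\<epsilon> * \<kappa> x > 0" if "x \<in> {0..b}" for x
    using \<kappa>\<rho>_pos[OF that] assms(1) by simp
  ultimately have "sl_system 0 b (\<lambda>x. \<epsilon> * \<kappa> x) (\<lambda>x. l * \<rho> x) (\<lambda>x. 0) u (\<lambda>x. \<epsilon> * \<kappa> x * Dv 0 b u x)"
    using solves_SL_iff_sl_system[OF b_pos, of "\<lambda>x. \<epsilon> * \<kappa> x"] by blast
  then have "sl_system 0 b (\<lambda>x. \<epsilon> * \<kappa> x) (\<lambda>x. \<epsilon> * (t * \<rho> x)) (\<lambda>x. 0) u (\<lambda>x. \<epsilon> * \<kappa> x * Dv 0 b u x)"
    using assms(1) by (simp add: t_def)
  from sl_system_divide_coefficients[OF this]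
  show sys2: "sl_system 0 b \<kappa> (\<lambda>x. t * \<rho> x) (\<lambda>x. 0) u (\<lambda>x. \<kappa> x * Dv 0 b u x)"
    using assms(1) by simp
  have bc: "u a = 0" "u b = 0" "k 0 * Dv a 0 u 0 = \<epsilon> * (\<kappa> 0 * Dv 0 b u 0)"
    using eig unfolding perturbed_eigenfunction_def by auto
  show L1: "u x = \<alpha> * L.sol t x" and L2: "k x * Dv a 0 u x = \<alpha> * L.flux t x" if "x \<in> {a..0}" for x
    unfolding \<alpha>_def by (fact L.homogeneous_eq_sol[OF sys1 bc(1) that])+
  show R1: "u x = - \<beta> * R.sol t (-x)" and R2: "\<kappa> x * Dv 0 b u x = \<beta> * R.flux t (-x)"
    if "x \<in> {0..b}" for x
    unfolding \<beta>_def by (fact right_homogeneous_eq_sol[OF sys2 bc(2) that])+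
  show flux: "\<alpha> * L.flux t 0 = \<epsilon> * (\<beta> * R.flux t 0)"
    using bc(3) L2[OF zero_mem(1)] R2[OF zero_mem(2)] by simp
  have val: "\<alpha> * L.sol t 0 = - \<beta> * R.sol t 0"
    using L1[OF zero_mem(1)] R1[OF zero_mem(2)] by simp
  obtain x where x: "x \<in> {a..b}" "u x \<noteq> 0"
    using eig unfolding perturbed_eigenfunction_def by blast
  then have "\<alpha> \<noteq> 0 \<or> \<beta> \<noteq> 0"
    using L1[of x] R1[of x] by (cases "x \<le> 0") auto
  moreover have "\<alpha> * matching \<epsilon> t = 0"
  proof -
    have "\<alpha> * matching \<epsilon> t = \<epsilon> * R.flux t 0 * (\<alpha> * L.sol t 0) + (\<alpha> * L.flux t 0) * R.sol t 0"
      unfolding matching_def by algebra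
    then show ?thesis unfolding val flux by simp
  qed
  moreover have "\<beta> * matching \<epsilon> t = 0"
  proof -
    have "\<beta> * matching \<epsilon> t = L.sol t 0 * (\<epsilon> * (\<beta> * R.flux t 0)) - L.flux t 0 * (- \<beta> * R.sol t 0)"
      unfolding matching_def by algebra
    then show ?thesis unfolding val[symmetric] flux[symmetric] by simp
  qed
  ultimately show "matching \<epsilon> t = 0" by auto
qed

text \<open>
  The vanishing determinant yields nontrivial amplitudes \<open>\<alpha>, \<beta>\<close> satisfying both interface conditions.
\<close>
lemma matching_zero_imp_eigenvalue:
  assumes "0 < \<epsilon>" "matching \<epsilon> t = 0"
  shows "\<exists>u. perturbed_eigenfunction a b k r \<kappa> \<rho> \<epsilon> (\<epsilon> * t) u"
proof -
  obtain \<alpha> \<beta> where \<alpha>\<beta>: "\<alpha> * L.sol t 0 = \<beta> * R.sol t 0" "\<alpha> * L.flux t 0 = - \<epsilon> * \<beta> * R.flux t 0"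
    "\<alpha> \<noteq> 0 \<or> \<beta> \<noteq> 0"
  proof (cases "L.sol t 0 = 0 \<and> R.sol t 0 = 0")
    case True
    then have "L.flux t 0 \<noteq> 0" using rotating_nonzero[OF L_rotating] by blast
    then show ?thesis using that[of "- \<epsilon> * R.flux t 0" "L.flux t 0"] True by simp
  next
    case False
    then show ?thesis
      using that[of "R.sol t 0" "L.sol t 0"] assms(2) by (auto simp: matching_def algebra_simps)
  qed
  define u where "u = (\<lambda>x. if x \<le> 0 then \<alpha> * L.sol t x else \<beta> * R.sol t (-x))"
  have uL: "u x = \<alpha> * L.sol t x" if "x \<in> {a..0}" for x using that by (simp add: u_def)
  have uR: "u x = \<beta> * R.sol t (-x)" if "x \<in> {0..b}" for x
    using that \<alpha>\<beta>(1) by (cases "x = 0") (auto simp: u_def)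
  have "sl_system a 0 k (\<lambda>x. t * r x) (\<lambda>x. 0) (\<lambda>x. \<alpha> * L.sol t x) (\<lambda>x. \<alpha> * L.flux t x)"
    using sl_system_scale[OF L.sol_sys, of t \<alpha>] by simp
  then have sys1: "sl_system a 0 k (\<lambda>x. t * r x) (\<lambda>x. 0) u (\<lambda>x. \<alpha> * L.flux t x)"
    by (rule sl_system_cong) (use uL in auto)
  have "sl_system 0 b \<kappa> (\<lambda>x. t * \<rho> x) (\<lambda>x. 0) (\<lambda>x. \<beta> * R.sol t (-x)) (\<lambda>x. - \<beta> * R.flux t (-x))"
    using sl_system_scale[OF right_sol_sys, of t \<beta>] by simp
  then have sys2: "sl_system 0 b \<kappa> (\<lambda>x. t * \<rho> x) (\<lambda>x. 0) u (\<lambda>x. - \<beta> * R.flux t (-x))"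
    by (rule sl_system_cong) (use uR in auto)
  have "solves_SL a 0 k (\<lambda>x. \<epsilon> * t / \<epsilon> * r x) (\<lambda>x. 0) u"
    using sl_system_imp_solves_SL[OF a_neg L.p_pos sys1] assms(1) by simp
  moreover have "solves_SL 0 b (\<lambda>x. \<epsilon> * \<kappa> x) (\<lambda>x. \<epsilon> * t * \<rho> x) (\<lambda>x. 0) u"
    using sl_system_imp_solves_SL[OF b_pos _ sl_system_multiply_coefficients[OF sys2, of \<epsilon>]]
      \<kappa>\<rho>_pos assms(1) by (simp add: mult.assoc)
  moreover have "k 0 * Dv a 0 u 0 = \<alpha> * L.flux t 0"
    by (rule sl_system_quasi_derivative[OF a_neg L.p_pos sys1 zero_mem(1)])
  moreover have "\<kappa> 0 * Dv 0 b u 0 = - \<beta> * R.flux t 0"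
    using sl_system_quasi_derivative[OF b_pos _ sys2 zero_mem(2)] \<kappa>\<rho>_pos by auto
  moreover have "u a = 0" "u b = 0"
    using uL[OF zero_mem(3)] uR[OF zero_mem(4)] by simp_all
  moreover have "\<exists>x\<in>{a..b}. u x \<noteq> 0"
    using \<alpha>\<beta>(3)
  proof
    assume "\<alpha> \<noteq> 0"
    obtain x where x: "x \<in> {a..0}" "L.sol t x \<noteq> 0" using L.sol_nonzero by blast
    then have "u x \<noteq> 0" "x \<in> {a..b}" using \<open>\<alpha> \<noteq> 0\<close> uL[OF x(1)] b_pos by auto
    then show ?thesis by blast
  next
    assume "\<beta> \<noteq> 0"
    obtain x where x: "x \<in> {-b..0}" "R.sol t x \<noteq> 0" using R.sol_nonzero by blast
    then have "u (-x) \<noteq> 0" "-x \<in> {a..b}" using \<open>\<beta> \<noteq> 0\<close> uR[of "-x"] a_neg by auto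
    then show ?thesis by blast
  qed
  ultimately have "perturbed_eigenfunction a b k r \<kappa> \<rho> \<epsilon> (\<epsilon> * t) u"
    unfolding perturbed_eigenfunction_def using \<alpha>\<beta>(2) by simp
  then show ?thesis by blast
qed

lemma scaled_eigenvalues_eq:
  assumes "0 < \<epsilon>" "perturbed_enumeration a b k r \<kappa> \<rho> \<epsilon> ls"
  shows "(\<lambda>i. ls i / \<epsilon>) ` {1..} = {t. matching \<epsilon> t = 0}"
proof -
  have ls: "ls ` {1..} = {l. \<exists>u. perturbed_eigenfunction a b k r \<kappa> \<rho> \<epsilon> l u}"
    using assms(2) by (simp add: perturbed_enumeration_def)
  show ?thesis
  proof (intro equalityI subsetI)
    fix t assume "t \<in> (\<lambda>i. ls i / \<epsilon>) ` {1..}"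
    then obtain l u where "t = l / \<epsilon>" "perturbed_eigenfunction a b k r \<kappa> \<rho> \<epsilon> l u"
      using ls by blast
    then show "t \<in> {t. matching \<epsilon> t = 0}"
      using perturbed_eigenfunction_form(8)[OF assms(1)] by simp
  next
    fix t assume "t \<in> {t. matching \<epsilon> t = 0}"
    then have "\<epsilon> * t \<in> ls ` {1..}"
      unfolding ls using matching_zero_imp_eigenvalue[OF assms(1)] by simp
    then obtain i where "i \<in> {1..}" "\<epsilon> * t = ls i" by blast
    then show "t \<in> (\<lambda>i. ls i / \<epsilon>) ` {1..}"
      using assms(1) by (intro image_eqI[of _ _ i]) (auto simp: field_simps)
  qed
qed

lemma perturbed_count_below:
  assumes "0 < \<epsilon>" "perturbed_enumeration a b k r \<kappa> \<rho> \<epsilon> ls" "zeros_count \<epsilon> {..<X} n" "1 \<le> j"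
  shows "ls j / \<epsilon> < X \<longleftrightarrow> j \<le> n"
proof -
  have sm: "strict_mono_on {1..} ls" using assms(2) by (simp add: perturbed_enumeration_def)
  define f where "f = (\<lambda>i. ls i / \<epsilon>)"
  have mono: "mono_on {1..} f"
    using strict_mono_on_leD[OF sm] assms(1) by (intro mono_onI) (simp add: f_def divide_right_mono)
  have inj: "inj_on f {1..}"
    using strict_mono_on_imp_inj_on[OF sm] assms(1) by (auto simp: inj_on_def f_def)
  have img: "f ` {i. 1 \<le> i \<and> f i < X} = {t \<in> {..<X}. matching \<epsilon> t = 0}"
    using scaled_eigenvalues_eq[OF assms(1,2)] unfolding f_def[symmetric] by auto
  have inj': "inj_on f {i. 1 \<le> i \<and> f i < X}"
    by (rule inj_on_subset[OF inj]) auto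
  have "finite {i. 1 \<le> i \<and> f i < X}" "card {i. 1 \<le> i \<and> f i < X} = n"
    using assms(3) img finite_imageD[OF _ inj'] card_image[OF inj'] by (auto simp: zeros_count_def)
  then show ?thesis
    using mono_on_count_below[OF mono _ assms(4), of X] by (simp add: f_def)
qed

lemma limit_count_below:
  assumes "eigenvalue_enumeration \<A> \<mu>" "L.flux X 0 \<noteq> 0" "R.sol X 0 \<noteq> 0" "1 \<le> j"
  shows "\<mu> j < X \<longleftrightarrow> j \<le> (\<Sum>p\<in>{p. p < X \<and> (L.flux p 0 = 0 \<or> R.sol p 0 = 0)}. limit_mult p)"
proof -
  define S where "S = {p. p < X \<and> (L.flux p 0 = 0 \<or> R.sol p 0 = 0)}"
  have fin: "finite S"
    unfolding S_def
    by (rule count_below(1)) (use L.sol_flux_pos R.sol_flux_pos assms(2,3) in auto)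
  have mult: "finite {i. 1 \<le> i \<and> \<mu> i = p}" "card {i. 1 \<le> i \<and> \<mu> i = p} = limit_mult p" for p
  proof -
    have "finite {i. 1 \<le> i \<and> complex_of_real (\<mu> i) = complex_of_real p} \<and>
        card {i. 1 \<le> i \<and> complex_of_real (\<mu> i) = complex_of_real p} = alg_mult \<A> (complex_of_real p)"
      using assms(1) unfolding eigenvalue_enumeration_def by blast
    then show "finite {i. 1 \<le> i \<and> \<mu> i = p}" "card {i. 1 \<le> i \<and> \<mu> i = p} = limit_mult p"
      by (simp_all add: alg_mult_eq_limit_mult)
  qed
  have "p \<in> S" if "1 \<le> i" "\<mu> i = p" "p < X" for i p
  proof (rule ccontr)
    assume "p \<notin> S"
    then have "limit_mult p = 0" using that(3) by (auto simp: S_def limit_mult_def)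
    then show False using mult[of p] that by auto
  qed
  then have eq: "{i. 1 \<le> i \<and> \<mu> i < X} = (\<Union>p\<in>S. {i. 1 \<le> i \<and> \<mu> i = p})"
    by (auto simp: S_def)
  have "card {i. 1 \<le> i \<and> \<mu> i < X} = (\<Sum>p\<in>S. card {i. 1 \<le> i \<and> \<mu> i = p})"
    unfolding eq using fin mult(1) by (intro card_UN_disjoint) auto
  moreover have "finite {i. 1 \<le> i \<and> \<mu> i < X}"
    unfolding eq using fin mult(1) by auto
  moreover have "mono_on {1..} \<mu>" using assms(1) by (simp add: eigenvalue_enumeration_def)
  ultimately show ?thesis
    using mono_on_count_below[OF _ _ assms(4), of \<mu> X] mult(2) by (simp add: S_def)
qed

text \<open>
  For every regular level \<open>X\<close>, the numbers of perturbed eigenvalues and of limit eigenvalues below \<open>X\<close>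
  agree for small \<open>\<epsilon>\<close>, so \<open>lam \<epsilon> j / \<epsilon>\<close> and \<open>\<mu> j\<close> lie on the same side of \<open>X\<close>. Regular levels are dense.
\<close>
lemma scaled_eigenvalue_tendsto:
  assumes "eigenvalue_enumeration \<A> \<mu>" "1 \<le> j"
    and "\<forall>\<epsilon>>0. perturbed_enumeration a b k r \<kappa> \<rho> \<epsilon> (lam \<epsilon>)"
  shows "((\<lambda>\<epsilon>. lam \<epsilon> j / \<epsilon>) \<longlongrightarrow> \<mu> j) (at_right 0)"
proof -
  have same_side: "\<forall>\<^sub>F \<epsilon> in at_right 0. lam \<epsilon> j / \<epsilon> < X \<longleftrightarrow> \<mu> j < X"
    if "L.flux X 0 \<noteq> 0" "R.sol X 0 \<noteq> 0" for X
  proof -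
    have "\<forall>\<^sub>F \<epsilon> in at_right 0. zeros_count \<epsilon> {..<X}
        (\<Sum>p\<in>{p. p < X \<and> (L.flux p 0 = 0 \<or> R.sol p 0 = 0)}. limit_mult p)"
      by (rule count_below(2)) (use L.sol_flux_pos R.sol_flux_pos that in auto)
    then show ?thesis
      using eventually_at_right_less[of 0]
    proof eventually_elim
      case (elim \<epsilon>)
      then show ?case
        using perturbed_count_below[OF elim(2) _ elim(1) assms(2)] assms(3)
          limit_count_below[OF assms(1) that assms(2)] by blast
    qed
  qed
  have regular: "\<exists>X. x < X \<and> X < y \<and> L.flux X 0 \<noteq> 0 \<and> R.sol X 0 \<noteq> 0" if "x < y" for x y
  proof (rule ccontr)
    assume "\<not> ?thesis"
    then have "{x<..<y} \<subseteq> {x..y} \<inter> {p. L.flux p 0 = 0 \<or> R.sol p 0 = 0}" by auto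
    then have "finite {x<..<y}" using finite_limit_zeros finite_subset by blast
    then show False using that infinite_Ioo[OF that] by blast
  qed
  show ?thesis
  proof (rule order_tendstoI)
    fix y assume "y < \<mu> j"
    then obtain X where X: "y < X" "X < \<mu> j" "L.flux X 0 \<noteq> 0" "R.sol X 0 \<noteq> 0"
      using regular by blast
    from same_side[OF X(3,4)] show "\<forall>\<^sub>F \<epsilon> in at_right 0. y < lam \<epsilon> j / \<epsilon>"
      by eventually_elim (use X in auto)
  next
    fix y assume "\<mu> j < y"
    then obtain X where X: "\<mu> j < X" "X < y" "L.flux X 0 \<noteq> 0" "R.sol X 0 \<noteq> 0"
      using regular by blast
    from same_side[OF X(3,4)] show "\<forall>\<^sub>F \<epsilon> in at_right 0. lam \<epsilon> j / \<epsilon> < y"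
      by eventually_elim (use X in auto)
  qed
qed

text \<open>
  If the flux vanishes, the shooting solution is an eigenfunction of \<open>A1\<close>, and the equation with
  right-hand side 0 has two solutions.
\<close>
lemma resolvent_imp_flux_nonzero:
  assumes "complex_of_real t \<notin> op_spectrum a 0 r (A1 a k r)"
  shows "L.flux t 0 \<noteq> 0"
proof
  assume f: "L.flux t 0 = 0"
  have graph: "(u, \<lambda>x. 0 + complex_of_real t * u x) \<in> A1 a k r"
    if u: "\<And>x. x \<notin> {a..0} \<Longrightarrow> u x = 0" "\<And>x. x \<in> {a..0} \<Longrightarrow> u x = C * complex_of_real (L.sol t x)" for u C
  proof -
    have sys: "L.csys t (\<lambda>x. 0) u (\<lambda>x. C * complex_of_real (L.flux t x))"
      by (rule csl_system_cong[OF L.csys_sol[of t C]]) (use u in auto)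
    have quasi: "k x *\<^sub>R Dv a 0 u x = C * complex_of_real (L.flux t x)" if "x \<in> {a..0}" for x
      by (rule csl_system_quasi_derivative[OF a_neg L.p_pos sys that])
    have sys': "L.csys t (\<lambda>x. - r x *\<^sub>R 0) u (\<lambda>x. k x *\<^sub>R Dv a 0 u x)"
      by (rule csl_system_cong[OF sys]) (use quasi in auto)
    have "(u, \<lambda>x. 0 + complex_of_real t * u x) \<in> SL_graph a 0 k r"
      by (subst SL_graph_iff) (use a_neg k_smooth kr_pos coeff_cont u sys' in auto)
    moreover have "k 0 \<noteq> 0" using L.p_pos[OF zero_mem(1)] by simp
    then have "Dv a 0 u 0 = 0" using quasi[OF zero_mem(1)] f by simp
    moreover have "u a = 0" using u(2)[OF zero_mem(3)] by simp
    ultimately show ?thesis by (simp add: A1_def)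
  qed
  have "(\<lambda>x. 0) \<in> L2 a 0" by (intro continuous_on_imp_L2 continuous_intros)
  moreover have "\<forall>f \<in> L2 a 0. \<exists>!u. (u, \<lambda>x. f x + complex_of_real t * u x) \<in> A1 a k r"
    using assms unfolding op_spectrum_def resolvent_set_def Compl_iff mem_Collect_eq not_not by (rule conjunct1)
  ultimately have ex1: "\<exists>!u. (u, \<lambda>x. 0 + complex_of_real t * u x) \<in> A1 a k r"
    by (rule bspec[rotated])
  have trivial: "(\<lambda>x. 0, \<lambda>x. 0 + complex_of_real t * 0) \<in> A1 a k r"
    by (rule graph[where u = "\<lambda>x. 0" and C = 0]) auto
  have nontrivial: "(left_part t 1, \<lambda>x. 0 + complex_of_real t * left_part t 1 x) \<in> A1 a k r"
    by (rule graph[where u = "left_part t 1" and C = 1]) auto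
  have "left_part t 1 = (\<lambda>x. 0)"
    by (rule alt_ex1E[OF ex1]) (use trivial nontrivial in auto)
  moreover obtain x where "x \<in> {a..0}" "L.sol t x \<noteq> 0" using L.sol_nonzero by blast
  ultimately show False using part_simps(1)[of x t 1] by simp
qed

lemma eigenvalue_imp_right_zero:
  assumes "eigenvalue_enumeration \<A> \<mu>" "1 \<le> j" "L.flux (\<mu> j) 0 \<noteq> 0"
  shows "R.sol (\<mu> j) 0 = 0"
proof -
  have "finite {i. 1 \<le> i \<and> complex_of_real (\<mu> i) = complex_of_real (\<mu> j)}"
    "card {i. 1 \<le> i \<and> complex_of_real (\<mu> i) = complex_of_real (\<mu> j)} = limit_mult (\<mu> j)"
    using assms(1) unfolding eigenvalue_enumeration_def alg_mult_eq_limit_mult[symmetric] by blast+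
  moreover have "j \<in> {i. 1 \<le> i \<and> complex_of_real (\<mu> i) = complex_of_real (\<mu> j)}"
    using assms(2) by simp
  ultimately have "limit_mult (\<mu> j) \<noteq> 0" by (metis card_0_eq empty_iff)
  then show ?thesis using assms(3) by (auto simp: limit_mult_def split: if_splits)
qed

end

section \<open>Sobolev norms and truncated expansions\<close>

lemma H1_norm_nonneg: "0 \<le> H1_norm c d f"
proof -
  have "0 \<le> integral {c..d} (\<lambda>x. (h x)\<^sup>2)" for h :: "real \<Rightarrow> real"
    by (cases "(\<lambda>x. (h x)\<^sup>2) integrable_on {c..d}")
      (auto simp: integral_nonneg not_integrable_integral)
  then show ?thesis unfolding H1_norm_def by simp
qed

lemma piecewise_C1_H1:
  fixes f f1 f2 :: "real \<Rightarrow> real"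
  assumes ab: "a < 0" "0 < b"
    and f1: "continuous_on {a..0} f1" "\<And>x. x \<in> {a..0} \<Longrightarrow> (f has_real_derivative f1 x) (at x within {a..0})"
    and f2: "continuous_on {0..b} f2" "\<And>x. x \<in> {0..b} \<Longrightarrow> (f has_real_derivative f2 x) (at x within {0..b})"
    and bound: "\<And>x. x \<in> {a..b} \<Longrightarrow> \<bar>f x\<bar> \<le> N" "\<And>x. x \<in> {a..0} \<Longrightarrow> \<bar>f1 x\<bar> \<le> N" "\<And>x. x \<in> {0..b} \<Longrightarrow> \<bar>f2 x\<bar> \<le> N"
  shows "f \<in> H1 a b" "H1_norm a b f \<le> sqrt (2 * (b - a)) * N"
proof -
  define g where "g = (\<lambda>x. if x \<le> 0 then f1 x else f2 x)"
  have N: "0 \<le> N" using bound(1)[of a] ab by simp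
  have cont: "continuous_on {a..b} f"
  proof -
    have "continuous_on {a..0} f" "continuous_on {0..b} f"
      by (rule DERIV_continuous_on, erule f1(2) f2(2))+
    then have "continuous_on ({a..0} \<union> {0..b}) f" by (intro continuous_on_closed_Un) auto
    moreover have "{a..0} \<union> {0..b} = {a..b}" using ab by auto
    ultimately show ?thesis by simp
  qed
  have deriv: "(f has_real_derivative g x) (at x)" if "x \<in> {a<..<b} - {0}" for x
  proof (cases "x < 0")
    case True
    then have "at x within {a..0} = at x" using that by (auto simp: at_within_Icc_at)
    then show ?thesis using f1(2)[of x] that True by (auto simp: g_def)
  next
    case False
    then have "at x within {0..b} = at x" using that by (auto simp: at_within_Icc_at)
    then show ?thesis using f2(2)[of x] that False by (auto simp: g_def)
  qed
  have gN: "\<bar>g x\<bar> \<le> N" if "x \<in> {a..b}" for x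
    using bound(2,3)[of x] that by (auto simp: g_def)
  have meas: "g \<in> borel_measurable (lebesgue_on {a..b})"
  proof -
    have "continuous_on {a..b} (\<lambda>x. f1 (min x 0))" "continuous_on {a..b} (\<lambda>x. f2 (max x 0))"
      by (rule continuous_on_compose2[OF f1(1)] continuous_on_compose2[OF f2(1)];
          use ab in \<open>auto intro!: continuous_intros\<close>)+
    then have m: "(\<lambda>x. f1 (min x 0)) \<in> borel_measurable (lebesgue_on {a..b})"
      "(\<lambda>x. f2 (max x 0)) \<in> borel_measurable (lebesgue_on {a..b})"
      by (auto intro: continuous_imp_measurable_on_sets_lebesgue)
    have id: "(\<lambda>x. x) \<in> borel_measurable (lebesgue_on {a..b})"
      by (rule continuous_imp_measurable_on_sets_lebesgue) (auto intro: continuous_intros)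
    have "(\<lambda>x. if x \<le> 0 then f1 (min x 0) else f2 (max x 0)) \<in> borel_measurable (lebesgue_on {a..b})"
      by (intro measurable_If m) (use id in measurable)
    also have "(\<lambda>x. if x \<le> 0 then f1 (min x 0) else f2 (max x 0)) = g"
      by (auto simp: g_def fun_eq_iff min_def max_def)
    finally show ?thesis .
  qed
  interpret finite_measure "lebesgue_on {a..b}"
    by (intro finite_measure_lebesgue_on) auto
  have sq: "\<bar>(g x)\<^sup>2\<bar> \<le> N\<^sup>2" if "x \<in> {a..b}" for x
    using power_mono[OF gN[OF that], of 2] by simp
  have int: "integrable (lebesgue_on {a..b}) (\<lambda>x. (g x)\<^sup>2)"
    by (rule integrable_const_bound[where B = "N\<^sup>2"]) (use sq meas in \<open>auto intro!: AE_I2\<close>)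
  have L2: "g \<in> L2 a b" using meas int by (simp add: L2_def)
  have "has_weak_deriv a b f g"
    unfolding has_weak_deriv_def
  proof (intro conjI ballI L2)
    fix x assume x: "x \<in> {a..b}"
    have "(g has_integral f x - f a) {a..x}"
    proof (rule fundamental_theorem_of_calculus_interior_strong[where S = "{0}"])
      show "continuous_on {a..x} f" by (rule continuous_on_subset[OF cont]) (use x in auto)
      fix y assume "y \<in> {a<..<x} - {0}"
      then show "(f has_vector_derivative g y) (at y)"
        using deriv[of y] x by (simp add: has_real_derivative_iff_has_vector_derivative)
    qed (use x in auto)
    then show "f x = f a + integral {a..x} g" by (simp add: integral_unique)
  qed
  then show "f \<in> H1 a b" unfolding H1_def by blast
  have "integral {a..b} (\<lambda>x. (f x)\<^sup>2) \<le> N\<^sup>2 * (b - a)"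
  proof -
    have "norm (integral {a..b} (\<lambda>x. (f x)\<^sup>2)) \<le> N\<^sup>2 * (b - a)"
    proof (rule integral_bound)
      fix x assume "x \<in> {a..b}"
      from power_mono[OF bound(1)[OF this], of 2] show "norm ((f x)\<^sup>2) \<le> N\<^sup>2" by simp
    qed (use ab in \<open>auto intro!: continuous_intros cont\<close>)
    then show ?thesis by simp
  qed
  moreover have "integral {a..b} (\<lambda>x. (vector_derivative f (at x))\<^sup>2) \<le> N\<^sup>2 * (b - a)"
  proof -
    have "integral {a..b} (\<lambda>x. (vector_derivative f (at x))\<^sup>2) = integral {a..b} (\<lambda>x. (g x)\<^sup>2)"
    proof (rule integral_spike[of "{a, 0, b}"])
      fix x assume "x \<in> {a..b} - {a, 0, b}"
      then have "(f has_vector_derivative g x) (at x)"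
        using deriv[of x] by (simp add: has_real_derivative_iff_has_vector_derivative)
      then show "(g x)\<^sup>2 = (vector_derivative f (at x))\<^sup>2" by (simp add: vector_derivative_at)
    qed simp
    also have "\<dots> \<le> integral {a..b} (\<lambda>x. N\<^sup>2)"
      by (rule integral_le) (use int sq in \<open>auto intro: integrable_on_lebesgue_on\<close>)
    also have "\<dots> = N\<^sup>2 * (b - a)" using ab by simp
    finally show ?thesis .
  qed
  ultimately have "H1_norm a b f \<le> sqrt (2 * (b - a) * N\<^sup>2)"
    unfolding H1_norm_def by (intro real_sqrt_le_mono) (simp add: algebra_simps)
  then show "H1_norm a b f \<le> sqrt (2 * (b - a)) * N"
    using N by (simp add: real_sqrt_mult)
qed

lemma sum_triangle_swap:
  fixes h :: "nat \<Rightarrow> nat \<Rightarrow> 'a::comm_monoid_add"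
  shows "(\<Sum>i\<le>n. \<Sum>l=1..i. h l (i - l)) = (\<Sum>l=1..n. \<Sum>m\<le>n - l. h l m)"
  unfolding sum.Sigma[OF finite_atMost ballI[OF finite_atLeastAtMost]]
    sum.Sigma[OF finite_atLeastAtMost ballI[OF finite_atMost]]
  by (rule sum.reindex_bij_witness[where i = "\<lambda>(l, m). (l + m, l)" and j = "\<lambda>(i, l). (l, i - l)"]) auto

text \<open>
  The terms of total order at most \<open>n\<close> in the product of the two polynomials are exactly the
  convolution sum; every other term contains \<open>\<epsilon>^(n+1)\<close>.
\<close>
lemma truncated_product_remainder:
  fixes \<nu> F :: "nat \<Rightarrow> real"
  assumes \<epsilon>: "0 < \<epsilon>" "\<epsilon> \<le> 1" and B: "\<And>i. i \<le> n \<Longrightarrow> \<bar>F i\<bar> \<le> B"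
  shows "\<bar>(\<Sum>l=1..n. \<epsilon> ^ l * \<nu> l) * (\<Sum>m\<le>n. \<epsilon> ^ m * F m)
      - (\<Sum>i\<le>n. \<epsilon> ^ i * (\<Sum>l=1..i. \<nu> l * F (i - l)))\<bar>
    \<le> ((\<Sum>l=1..n. \<bar>\<nu> l\<bar>) * (real n + 1) * B) * \<epsilon> ^ (n + 1)"
proof -
  define h where "h = (\<lambda>l m. \<epsilon> ^ (l + m) * (\<nu> l * F m))"
  have "(\<Sum>i\<le>n. \<epsilon> ^ i * (\<Sum>l=1..i. \<nu> l * F (i - l))) = (\<Sum>i\<le>n. \<Sum>l=1..i. h l (i - l))"
    by (auto simp: h_def sum_distrib_left intro!: sum.cong)
  then have 1: "(\<Sum>i\<le>n. \<epsilon> ^ i * (\<Sum>l=1..i. \<nu> l * F (i - l))) = (\<Sum>l=1..n. \<Sum>m\<le>n - l. h l m)"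
    by (simp only: sum_triangle_swap)
  have 2: "(\<Sum>l=1..n. \<epsilon> ^ l * \<nu> l) * (\<Sum>m\<le>n. \<epsilon> ^ m * F m) = (\<Sum>l=1..n. \<Sum>m\<le>n. h l m)"
    unfolding sum_product by (simp add: h_def power_add mult_ac)
  have 3: "(\<Sum>m\<le>n. h l m) - (\<Sum>m\<le>n - l. h l m) = (\<Sum>m\<in>{..n} - {..n - l}. h l m)" for l
    by (rule sum_diff[symmetric]) auto
  have "\<bar>\<Sum>m\<in>{..n} - {..n - l}. h l m\<bar> \<le> \<bar>\<nu> l\<bar> * ((real n + 1) * B) * \<epsilon> ^ (n + 1)"
    if l: "l \<in> {1..n}" for l
  proof -
    have B0: "0 \<le> B" using B[of 0] by linarith
    have "\<bar>\<Sum>m\<in>{..n} - {..n - l}. h l m\<bar> \<le> (\<Sum>m\<in>{..n} - {..n - l}. \<bar>\<nu> l\<bar> * B * \<epsilon> ^ (n + 1))"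
    proof (rule order_trans[OF sum_abs sum_mono])
      fix m assume m: "m \<in> {..n} - {..n - l}"
      then have "n + 1 \<le> l + m" by auto
      then have pow: "\<epsilon> ^ (l + m) \<le> \<epsilon> ^ (n + 1)"
        using \<epsilon> by (intro power_decreasing) auto
      have coeff: "\<bar>\<nu> l\<bar> * \<bar>F m\<bar> \<le> \<bar>\<nu> l\<bar> * B"
        using B m by (intro mult_left_mono) auto
      have "\<epsilon> ^ (l + m) * (\<bar>\<nu> l\<bar> * \<bar>F m\<bar>) \<le> \<epsilon> ^ (n + 1) * (\<bar>\<nu> l\<bar> * B)"
        by (rule mult_mono[OF pow coeff]) (use \<epsilon> in auto)
      then show "\<bar>h l m\<bar> \<le> \<bar>\<nu> l\<bar> * B * \<epsilon> ^ (n + 1)"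
        using \<epsilon> by (simp add: h_def abs_mult mult_ac)
    qed
    also have "\<dots> = real (card ({..n} - {..n - l})) * (\<bar>\<nu> l\<bar> * B * \<epsilon> ^ (n + 1))"
      by simp
    also have "\<dots> \<le> (real n + 1) * (\<bar>\<nu> l\<bar> * B * \<epsilon> ^ (n + 1))"
    proof (rule mult_right_mono)
      have "card ({..n} - {..n - l}) \<le> card {..n}" by (rule card_mono) auto
      then show "real (card ({..n} - {..n - l})) \<le> real n + 1" by simp
    qed (use B0 \<epsilon> in auto)
    finally show ?thesis by (simp add: mult_ac)
  qed
  then have "\<bar>\<Sum>l=1..n. \<Sum>m\<in>{..n} - {..n - l}. h l m\<bar>
      \<le> (\<Sum>l=1..n. \<bar>\<nu> l\<bar> * ((real n + 1) * B) * \<epsilon> ^ (n + 1))"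
    by (intro order_trans[OF sum_abs sum_mono])
  also have "\<dots> = ((\<Sum>l=1..n. \<bar>\<nu> l\<bar>) * (real n + 1) * B) * \<epsilon> ^ (n + 1)"
    by (simp only: sum_distrib_right mult.assoc)
  finally show ?thesis
    unfolding 1 2 sum_subtractf[symmetric] 3 .
qed

text \<open>
  The recursion for the coefficients cancels all terms up to order \<open>n\<close> in the equation with the
  truncated spectral parameter; only the remainder of a product of two polynomials is left.
\<close>
lemma truncated_expansion:
  fixes F Fq :: "nat \<Rightarrow> real \<Rightarrow> real"
  assumes w: "continuous_on {c..d} w"
    and sys: "\<And>i. i \<le> n \<Longrightarrow> sl_system c d p (\<lambda>x. \<mu> * w x) (\<lambda>x. - w x * (\<Sum>l=1..i. \<nu> l * F (i - l) x)) (F i) (Fq i)"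
  shows "\<exists>K>0. \<forall>\<epsilon>. 0 < \<epsilon> \<and> \<epsilon> \<le> 1 \<longrightarrow> (\<exists>g.
      sl_system c d p (\<lambda>x. (\<mu> + (\<Sum>l=1..n. \<epsilon> ^ l * \<nu> l)) * w x) g
        (\<lambda>x. \<Sum>i\<le>n. \<epsilon> ^ i * F i x) (\<lambda>x. \<Sum>i\<le>n. \<epsilon> ^ i * Fq i x) \<and>
      (\<forall>x\<in>{c..d}. \<bar>g x\<bar> \<le> K * \<epsilon> ^ (n + 1)))"
proof -
  obtain W where W: "0 < W" "\<And>x. x \<in> {c..d} \<Longrightarrow> \<bar>w x\<bar> \<le> W"
    using continuous_on_Icc_bounded[OF w] by blast
  have "\<exists>B>0. \<forall>x\<in>{c..d}. \<bar>F i x\<bar> \<le> B" if "i \<le> n" for i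
    using continuous_on_Icc_bounded[OF sl_system_continuous(1)[OF sys[OF that]]] by metis
  then obtain b where b: "\<And>i x. i \<le> n \<Longrightarrow> x \<in> {c..d} \<Longrightarrow> \<bar>F i x\<bar> \<le> b i" "\<And>i. i \<le> n \<Longrightarrow> 0 < b i"
    by metis
  define B where "B = (\<Sum>i\<le>n. b i)"
  have "b i \<le> B" if "i \<le> n" for i
    unfolding B_def by (rule member_le_sum) (use that b(2) in \<open>auto simp: less_imp_le\<close>)
  then have B: "\<bar>F i x\<bar> \<le> B" if "i \<le> n" "x \<in> {c..d}" for i x
    using b(1)[OF that] that(1) by fastforce
  define K where "K = W * ((\<Sum>l=1..n. \<bar>\<nu> l\<bar>) * (real n + 1) * B) + 1"
  have B0: "0 \<le> B" unfolding B_def using b(2) by (intro sum_nonneg) (auto simp: less_imp_le)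
  have K: "0 < K"
    unfolding K_def using W(1) B0 by (intro add_nonneg_pos mult_nonneg_nonneg sum_nonneg) auto
  have "\<exists>g. sl_system c d p (\<lambda>x. (\<mu> + (\<Sum>l=1..n. \<epsilon> ^ l * \<nu> l)) * w x) g
        (\<lambda>x. \<Sum>i\<le>n. \<epsilon> ^ i * F i x) (\<lambda>x. \<Sum>i\<le>n. \<epsilon> ^ i * Fq i x) \<and>
      (\<forall>x\<in>{c..d}. \<bar>g x\<bar> \<le> K * \<epsilon> ^ (n + 1))" if \<epsilon>: "0 < \<epsilon>" "\<epsilon> \<le> 1" for \<epsilon>
  proof -
    define rem where "rem = (\<lambda>x. (\<Sum>l=1..n. \<epsilon> ^ l * \<nu> l) * (\<Sum>m\<le>n. \<epsilon> ^ m * F m x)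
      - (\<Sum>i\<le>n. \<epsilon> ^ i * (\<Sum>l=1..i. \<nu> l * F (i - l) x)))"
    have "sl_system c d p (\<lambda>x. \<mu> * w x)
        (\<lambda>x. \<Sum>i\<le>n. \<epsilon> ^ i * (- w x * (\<Sum>l=1..i. \<nu> l * F (i - l) x)))
        (\<lambda>x. \<Sum>i\<le>n. \<epsilon> ^ i * F i x) (\<lambda>x. \<Sum>i\<le>n. \<epsilon> ^ i * Fq i x)"
      by (intro sl_system_sum sl_system_scale sys) auto
    then have "sl_system c d p (\<lambda>x. (\<mu> + (\<Sum>l=1..n. \<epsilon> ^ l * \<nu> l)) * w x) (\<lambda>x. w x * rem x)
        (\<lambda>x. \<Sum>i\<le>n. \<epsilon> ^ i * F i x) (\<lambda>x. \<Sum>i\<le>n. \<epsilon> ^ i * Fq i x)"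
    proof (rule sl_system_cong)
      fix x
      have "(\<Sum>i\<le>n. \<epsilon> ^ i * (- w x * (\<Sum>l=1..i. \<nu> l * F (i - l) x)))
          = - w x * (\<Sum>i\<le>n. \<epsilon> ^ i * (\<Sum>l=1..i. \<nu> l * F (i - l) x))"
        unfolding sum_distrib_left by (intro sum.cong refl) (simp add: mult_ac)
      then show "w x * rem x - (\<mu> + (\<Sum>l=1..n. \<epsilon> ^ l * \<nu> l)) * w x * (\<Sum>i\<le>n. \<epsilon> ^ i * F i x)
          = (\<Sum>i\<le>n. \<epsilon> ^ i * (- w x * (\<Sum>l=1..i. \<nu> l * F (i - l) x)))
            - \<mu> * w x * (\<Sum>i\<le>n. \<epsilon> ^ i * F i x)"
        unfolding rem_def by (simp add: algebra_simps)
    qed auto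
    moreover have "\<bar>w x * rem x\<bar> \<le> K * \<epsilon> ^ (n + 1)" if x: "x \<in> {c..d}" for x
    proof -
      have "\<bar>rem x\<bar> \<le> ((\<Sum>l=1..n. \<bar>\<nu> l\<bar>) * (real n + 1) * B) * \<epsilon> ^ (n + 1)"
        unfolding rem_def by (rule truncated_product_remainder[OF \<epsilon>]) (rule B[OF _ x])
      then have "\<bar>w x\<bar> * \<bar>rem x\<bar> \<le> W * (((\<Sum>l=1..n. \<bar>\<nu> l\<bar>) * (real n + 1) * B) * \<epsilon> ^ (n + 1))"
        using W x by (intro mult_mono) auto
      also have "\<dots> \<le> K * \<epsilon> ^ (n + 1)"
        unfolding K_def using \<epsilon> by (simp add: algebra_simps)
      finally show ?thesis by (simp add: abs_mult)
    qed
    ultimately show ?thesis by blast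
  qed
  then show ?thesis using K by blast
qed

section \<open>Eigenfunctions near a simple limit eigenvalue\<close>

context two_phase
begin

text \<open>
  A function on \<open>[a, b]\<close> whose fluxes on the two halves may have a jump at 0, with a common bound for
  the function and both fluxes.
\<close>
definition flux_bounded :: "(real \<Rightarrow> real) \<Rightarrow> (real \<Rightarrow> real) \<Rightarrow> (real \<Rightarrow> real) \<Rightarrow> real \<Rightarrow> bool" where
  "flux_bounded f V W N \<longleftrightarrow> continuous_on {a..0} V \<and> continuous_on {0..b} W \<and>
     (\<forall>x\<in>{a..0}. (f has_real_derivative V x / k x) (at x within {a..0}) \<and> \<bar>f x\<bar> \<le> N \<and> \<bar>V x\<bar> \<le> N) \<and>
     (\<forall>x\<in>{0..b}. (f has_real_derivative W x / \<kappa> x) (at x within {0..b}) \<and> \<bar>f x\<bar> \<le> N \<and> \<bar>W x\<bar> \<le> N)"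

lemma flux_bounded_H1:
  "\<exists>C\<ge>0. \<forall>f V W N. flux_bounded f V W N \<longrightarrow> f \<in> H1 a b \<and> H1_norm a b f \<le> C * N"
proof -
  have nz: "k x \<noteq> 0" if "x \<in> {a..0}" for x using kr_pos[OF that] by simp
  have nz': "\<kappa> x \<noteq> 0" if "x \<in> {0..b}" for x using \<kappa>\<rho>_pos[OF that] by simp
  have "continuous_on {a..0} (\<lambda>x. 1 / k x)" "continuous_on {0..b} (\<lambda>x. 1 / \<kappa> x)"
    by (intro continuous_intros coeff_cont; use nz nz' in blast)+
  then obtain P Q where P: "0 < P" "\<And>x. x \<in> {a..0} \<Longrightarrow> \<bar>1 / k x\<bar> \<le> P"
    and Q: "0 < Q" "\<And>x. x \<in> {0..b} \<Longrightarrow> \<bar>1 / \<kappa> x\<bar> \<le> Q"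
    by (metis continuous_on_Icc_bounded)
  define D where "D = 1 + P + Q"
  have "f \<in> H1 a b \<and> H1_norm a b f \<le> sqrt (2 * (b - a)) * D * N" if fb: "flux_bounded f V W N" for f V W N
  proof -
    have cont: "continuous_on {a..0} V" "continuous_on {0..b} W"
      and L: "\<And>x. x \<in> {a..0} \<Longrightarrow> (f has_real_derivative V x / k x) (at x within {a..0})"
        "\<And>x. x \<in> {a..0} \<Longrightarrow> \<bar>f x\<bar> \<le> N" "\<And>x. x \<in> {a..0} \<Longrightarrow> \<bar>V x\<bar> \<le> N"
      and R: "\<And>x. x \<in> {0..b} \<Longrightarrow> (f has_real_derivative W x / \<kappa> x) (at x within {0..b})"
        "\<And>x. x \<in> {0..b} \<Longrightarrow> \<bar>f x\<bar> \<le> N" "\<And>x. x \<in> {0..b} \<Longrightarrow> \<bar>W x\<bar> \<le> N"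
      using fb unfolding flux_bounded_def by auto
    have N: "0 \<le> N" using L(2)[OF zero_mem(1)] by linarith
    have D: "N \<le> D * N" "P * N \<le> D * N" "Q * N \<le> D * N"
      using N P(1) Q(1) unfolding D_def by (simp_all add: algebra_simps)
    have "\<bar>f x\<bar> \<le> D * N" if "x \<in> {a..b}" for x
      using L(2)[of x] R(2)[of x] that D(1) by (cases "x \<le> 0") auto
    moreover have "\<bar>V x / k x\<bar> \<le> D * N" if x: "x \<in> {a..0}" for x
    proof -
      have "\<bar>1 / k x\<bar> * \<bar>V x\<bar> \<le> P * N" by (intro mult_mono P L x) (use P(1) in auto)
      then show ?thesis using D(2) by (simp add: abs_mult)
    qed
    moreover have "\<bar>W x / \<kappa> x\<bar> \<le> D * N" if x: "x \<in> {0..b}" for x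
    proof -
      have "\<bar>1 / \<kappa> x\<bar> * \<bar>W x\<bar> \<le> Q * N" by (intro mult_mono Q R x) (use Q(1) in auto)
      then show ?thesis using D(3) by (simp add: abs_mult)
    qed
    moreover have "continuous_on {a..0} (\<lambda>x. V x / k x)" "continuous_on {0..b} (\<lambda>x. W x / \<kappa> x)"
      by (intro continuous_intros coeff_cont cont; use nz nz' in blast)+
    ultimately show ?thesis
      using piecewise_C1_H1[OF a_neg b_pos _ L(1) _ R(1), of "D * N"] by (simp add: mult.assoc)
  qed
  moreover have "0 \<le> sqrt (2 * (b - a)) * D"
    using P(1) Q(1) a_neg b_pos unfolding D_def by simp
  ultimately show ?thesis by blast
qed

text \<open>
  Near \<open>m\<close>, \<open>matching \<epsilon> / (f g) = G / g + \<epsilon> F / f\<close> is a sum of increasing functions, and the slope of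
  \<open>G / g\<close> is bounded below by the Wronskian formula. So the zero is simple uniformly in \<open>\<epsilon>\<close>, and
  an approximate zero is close to it.
\<close>
lemma simple_zero_stability:
  assumes f: "L.flux m 0 \<noteq> 0" and G: "R.sol m 0 = 0"
  shows "\<exists>\<delta>>0. \<exists>K>0. \<forall>\<epsilon> s t. 0 < \<epsilon> \<longrightarrow> \<bar>s - m\<bar> < \<delta> \<longrightarrow> \<bar>t - m\<bar> < \<delta> \<longrightarrow> matching \<epsilon> t = 0 \<longrightarrow>
    \<bar>t - s\<bar> \<le> K * \<bar>matching \<epsilon> s\<bar>"
proof -
  have g: "R.flux m 0 \<noteq> 0"
    using rotating_nonzero[OF rotating_quarter_turn(1)[OF R_rotating], of m] G by simp
  obtain d1 where d1: "0 < d1" "\<And>s. \<bar>s - m\<bar> < d1 \<Longrightarrow> L.flux s 0 * L.flux m 0 > 0"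
    using same_sign_near[OF L.endpoint_isCont(2) f] by metis
  obtain d2 where d2: "0 < d2" "\<And>s. \<bar>s - m\<bar> < d2 \<Longrightarrow> R.flux s 0 * R.flux m 0 > 0"
    using same_sign_near[OF R.endpoint_isCont(2) g] by metis
  have "((\<lambda>s. \<bar>L.flux s 0\<bar>) \<longlongrightarrow> \<bar>L.flux m 0\<bar>) (at m)"
    using L.endpoint_isCont(2)[of m] unfolding isCont_def by (rule tendsto_rabs)
  then have "\<forall>\<^sub>F s in at m. \<bar>L.flux m 0\<bar> / 2 < \<bar>L.flux s 0\<bar>"
    by (rule order_tendstoD(1)) (use f in simp)
  then obtain d3 where d3: "0 < d3" "\<And>s. s \<noteq> m \<Longrightarrow> dist s m < d3 \<Longrightarrow> \<bar>L.flux m 0\<bar> / 2 < \<bar>L.flux s 0\<bar>"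
    unfolding eventually_at by auto
  obtain d4 mL where d4: "0 < d4" "mL > 0" "\<And>s1 s2. \<bar>s1 - m\<bar> < d4 \<Longrightarrow> \<bar>s2 - m\<bar> < d4 \<Longrightarrow>
     mL \<le> integral {a..0} (\<lambda>x. r x * L.sol s1 x * L.sol s2 x)"
    using L.product_integral_bounded_below[of m] by blast
  obtain d5 mR where d5: "0 < d5" "mR > 0" "\<And>s1 s2. \<bar>s1 - m\<bar> < d5 \<Longrightarrow> \<bar>s2 - m\<bar> < d5 \<Longrightarrow>
     mR \<le> integral {-b..0} (\<lambda>x. \<rho> (-x) * R.sol s1 x * R.sol s2 x)"
    using R.product_integral_bounded_below[of m] by blast
  obtain BL where BL: "0 < BL"
    "\<And>t x. \<bar>t\<bar> \<le> \<bar>m\<bar> + 1 \<Longrightarrow> x \<in> {a..0} \<Longrightarrow> \<bar>L.sol t x\<bar> \<le> BL \<and> \<bar>L.flux t x\<bar> \<le> BL"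
    using L.sol_bounded by blast
  obtain BR where BR: "0 < BR"
    "\<And>t x. \<bar>t\<bar> \<le> \<bar>m\<bar> + 1 \<Longrightarrow> x \<in> {-b..0} \<Longrightarrow> \<bar>R.sol t x\<bar> \<le> BR \<and> \<bar>R.flux t x\<bar> \<le> BR"
    using R.sol_bounded by blast
  define \<delta> where "\<delta> = min 1 (min d1 (min d2 (min d3 (min d4 d5))))"
  define f0 where "f0 = \<bar>L.flux m 0\<bar> / 2"
  define K where "K = BL * BR / (f0 * f0 * mR)"
  have f0: "0 < f0" using f by (simp add: f0_def)
  have low: "f0 \<le> \<bar>L.flux s 0\<bar>" if "\<bar>s - m\<bar> < \<delta>" for s
    using d3(2)[of s] that f by (cases "s = m") (auto simp: f0_def \<delta>_def dist_real_def)
  have "\<bar>t - s\<bar> \<le> K * \<bar>matching \<epsilon> s\<bar>"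
    if \<epsilon>: "0 < \<epsilon>" and s: "\<bar>s - m\<bar> < \<delta>" and t: "\<bar>t - m\<bar> < \<delta>" and zero: "matching \<epsilon> t = 0" for \<epsilon> s t
  proof -
    define I where "I = integral {a..0} (\<lambda>x. r x * L.sol s x * L.sol t x)"
    define J where "J = integral {-b..0} (\<lambda>x. \<rho> (-x) * R.sol s x * R.sol t x)"
    have I: "mL \<le> I" and J: "mR \<le> J"
      unfolding I_def J_def using d4(3)[of s t] d5(3)[of s t] s t by (auto simp: \<delta>_def)
    have wL: "L.flux s 0 * L.sol t 0 - L.sol s 0 * L.flux t 0 = (t - s) * I"
      and wR: "R.flux s 0 * R.sol t 0 - R.sol s 0 * R.flux t 0 = (t - s) * J"
      unfolding I_def J_def by (rule L.wronskian_at_0 R.wronskian_at_0)+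
    have "matching \<epsilon> s * (L.flux t 0 * R.flux t 0) - matching \<epsilon> t * (L.flux s 0 * R.flux s 0)
        = - (\<epsilon> * (R.flux s 0 * R.flux t 0) * (L.flux s 0 * L.sol t 0 - L.sol s 0 * L.flux t 0)
          + (L.flux s 0 * L.flux t 0) * (R.flux s 0 * R.sol t 0 - R.sol s 0 * R.flux t 0))"
      unfolding matching_def by algebra
    also have "\<dots> = - ((t - s) * (\<epsilon> * (R.flux s 0 * R.flux t 0) * I + (L.flux s 0 * L.flux t 0) * J))"
      unfolding wL wR by algebra
    finally have eq: "\<bar>matching \<epsilon> s\<bar> * \<bar>L.flux t 0 * R.flux t 0\<bar>
        = \<bar>t - s\<bar> * \<bar>\<epsilon> * (R.flux s 0 * R.flux t 0) * I + (L.flux s 0 * L.flux t 0) * J\<bar>"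
      unfolding zero by (simp add: abs_mult[symmetric])
    have gg: "0 < R.flux s 0 * R.flux t 0" and ff: "0 < L.flux s 0 * L.flux t 0"
      using d1(2)[of s] d1(2)[of t] d2(2)[of s] d2(2)[of t] s t
      by (auto simp: zero_less_mult_iff \<delta>_def)
    have "f0 * f0 \<le> \<bar>L.flux s 0\<bar> * \<bar>L.flux t 0\<bar>"
      using low[OF s] low[OF t] f0 by (intro mult_mono) auto
    also have "\<dots> = L.flux s 0 * L.flux t 0" using ff by (simp add: abs_mult[symmetric])
    finally have ff_low: "f0 * f0 \<le> L.flux s 0 * L.flux t 0" .
    have "f0 * f0 * mR \<le> (L.flux s 0 * L.flux t 0) * J"
      by (rule mult_mono[OF ff_low J]) (use d5(2) ff in auto)
    moreover have "0 \<le> \<epsilon> * (R.flux s 0 * R.flux t 0) * I"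
      using mult_nonneg_nonneg[OF mult_nonneg_nonneg[OF less_imp_le[OF \<epsilon>] less_imp_le[OF gg]], of I]
        I d4(2) by simp
    ultimately have "\<bar>t - s\<bar> * (f0 * f0 * mR) \<le> \<bar>matching \<epsilon> s\<bar> * \<bar>L.flux t 0 * R.flux t 0\<bar>"
      unfolding eq by (intro mult_left_mono) auto
    also have "\<dots> \<le> \<bar>matching \<epsilon> s\<bar> * (BL * BR)"
    proof (intro mult_left_mono)
      have "\<bar>t\<bar> \<le> \<bar>m\<bar> + 1" using t unfolding \<delta>_def by auto
      then have "\<bar>L.flux t 0\<bar> \<le> BL" "\<bar>R.flux t 0\<bar> \<le> BR" using BL(2) BR(2) a_neg b_pos by auto
      then show "\<bar>L.flux t 0 * R.flux t 0\<bar> \<le> BL * BR"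
        unfolding abs_mult using BL(1) by (intro mult_mono) auto
    qed simp
    finally have "\<bar>t - s\<bar> * (f0 * f0 * mR) \<le> \<bar>matching \<epsilon> s\<bar> * (BL * BR)" .
    moreover have "0 < f0 * f0 * mR" using f0 d5(2) by simp
    ultimately show ?thesis
      unfolding K_def by (simp add: pos_le_divide_eq mult_ac)
  qed
  moreover have "\<delta> > 0" "K > 0"
    using d1(1) d2(1) d3(1) d4(1) d5(1,2) f0 BL(1) BR(1) unfolding \<delta>_def K_def by simp_all
  ultimately show ?thesis by blast
qed

lemma normalization_identity:
  assumes "\<And>x. x \<in> {a..0} \<Longrightarrow> v x = \<alpha> * L.sol t x" "\<And>x. x \<in> {0..b} \<Longrightarrow> v x = - \<beta> * R.sol t (-x)"
  shows "integral {a..b} (\<lambda>x. (if x < 0 then r x else \<rho> x) * (v x)\<^sup>2)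
    = \<alpha>\<^sup>2 * L.sol_norm2 t + \<beta>\<^sup>2 * R.sol_norm2 t"
proof -
  define h where "h = (\<lambda>x. (if x < 0 then r x else \<rho> x) * (v x)\<^sup>2)"
  have "(\<lambda>x. r x * (L.sol t x)\<^sup>2) integrable_on {a..0}"
    by (intro integrable_continuous_real continuous_intros coeff_cont L.sol_cont)
  then have "((\<lambda>x. \<alpha>\<^sup>2 * (r x * (L.sol t x)\<^sup>2)) has_integral \<alpha>\<^sup>2 * L.sol_norm2 t) {a..0}"
    unfolding L.sol_norm2_def by (intro has_integral_mult_right integrable_integral)
  then have left: "(h has_integral \<alpha>\<^sup>2 * L.sol_norm2 t) {a..0}"
    by (rule has_integral_spike_finite[of "{0}", rotated 2])
      (use assms(1) in \<open>auto simp: h_def power_mult_distrib\<close>)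
  have "(\<lambda>x. \<rho> (-x) * (R.sol t x)\<^sup>2) integrable_on {-b..0}"
    by (intro integrable_continuous_real continuous_intros R.w_cont R.sol_cont)
  then have "((\<lambda>x. \<beta>\<^sup>2 * (\<rho> (-x) * (R.sol t x)\<^sup>2)) has_integral \<beta>\<^sup>2 * R.sol_norm2 t) {-b..0}"
    unfolding R.sol_norm2_def by (intro has_integral_mult_right integrable_integral)
  then have "((\<lambda>x. h (-x)) has_integral \<beta>\<^sup>2 * R.sol_norm2 t) {-b..0}"
    by (rule has_integral_eq[rotated]) (use assms(2) in \<open>auto simp: h_def power_mult_distrib\<close>)
  then have right: "(h has_integral \<beta>\<^sup>2 * R.sol_norm2 t) {0..b}"
    using has_integral_reflect_real[of h _ b 0] by simp
  have "(h has_integral \<alpha>\<^sup>2 * L.sol_norm2 t + \<beta>\<^sup>2 * R.sol_norm2 t) {a..b}"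
    by (rule has_integral_combine[OF _ _ left right]) (use a_neg b_pos in auto)
  then show ?thesis unfolding h_def by (rule integral_unique)
qed

end

text \<open>
  A branch of eigenvalues \<open>l \<epsilon>\<close> for which \<open>l \<epsilon> / \<epsilon>\<close> tends to an eigenvalue \<open>m\<close> of \<open>A2_hat\<close> that is not
  an eigenvalue of \<open>A1\<close>.
\<close>
locale eigenvalue_branch = two_phase +
  fixes m :: real and l :: "real \<Rightarrow> real" and u :: "real \<Rightarrow> real \<Rightarrow> real"
  assumes flux_nz: "L.flux m 0 \<noteq> 0" and sol_zero: "R.sol m 0 = 0"
    and l_limit: "((\<lambda>\<epsilon>. l \<epsilon> / \<epsilon>) \<longlongrightarrow> m) (at_right 0)"
    and u_eigen: "\<And>\<epsilon>. 0 < \<epsilon> \<Longrightarrow> normalized_eigenfunction a b k r \<kappa> \<rho> \<epsilon> (l \<epsilon>) (u \<epsilon>)"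
begin

definition t where "t \<epsilon> = l \<epsilon> / \<epsilon>"
definition \<alpha> where "\<alpha> \<epsilon> = k a * Dv a 0 (u \<epsilon>) a"
definition \<beta> where "\<beta> \<epsilon> = \<kappa> b * Dv 0 b (u \<epsilon>) b"
text \<open>
  The limit of the amplitude \<open>\<beta>\<close>: it normalizes the limit eigenfunction in the weighted space.
\<close>
definition \<beta>0 where "\<beta>0 = 1 / sqrt (R.sol_norm2 m)"

lemma u_form:
  assumes "0 < \<epsilon>"
  shows "sl_system a 0 k (\<lambda>x. t \<epsilon> * r x) (\<lambda>x. 0) (u \<epsilon>) (\<lambda>x. k x * Dv a 0 (u \<epsilon>) x)"
    and "sl_system 0 b \<kappa> (\<lambda>x. t \<epsilon> * \<rho> x) (\<lambda>x. 0) (u \<epsilon>) (\<lambda>x. \<kappa> x * Dv 0 b (u \<epsilon>) x)"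
    and "\<And>x. x \<in> {a..0} \<Longrightarrow> u \<epsilon> x = \<alpha> \<epsilon> * L.sol (t \<epsilon>) x"
    and "\<And>x. x \<in> {a..0} \<Longrightarrow> k x * Dv a 0 (u \<epsilon>) x = \<alpha> \<epsilon> * L.flux (t \<epsilon>) x"
    and "\<And>x. x \<in> {0..b} \<Longrightarrow> u \<epsilon> x = - \<beta> \<epsilon> * R.sol (t \<epsilon>) (-x)"
    and "\<And>x. x \<in> {0..b} \<Longrightarrow> \<kappa> x * Dv 0 b (u \<epsilon>) x = \<beta> \<epsilon> * R.flux (t \<epsilon>) (-x)"
    and "\<alpha> \<epsilon> * L.flux (t \<epsilon>) 0 = \<epsilon> * (\<beta> \<epsilon> * R.flux (t \<epsilon>) 0)"
    and "matching \<epsilon> (t \<epsilon>) = 0"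
proof -
  have eig: "perturbed_eigenfunction a b k r \<kappa> \<rho> \<epsilon> (l \<epsilon>) (u \<epsilon>)"
    using u_eigen[OF assms] by (simp add: normalized_eigenfunction_def)
  note form = perturbed_eigenfunction_form[OF assms eig, folded t_def \<alpha>_def \<beta>_def]
  show "sl_system a 0 k (\<lambda>x. t \<epsilon> * r x) (\<lambda>x. 0) (u \<epsilon>) (\<lambda>x. k x * Dv a 0 (u \<epsilon>) x)"
    "sl_system 0 b \<kappa> (\<lambda>x. t \<epsilon> * \<rho> x) (\<lambda>x. 0) (u \<epsilon>) (\<lambda>x. \<kappa> x * Dv 0 b (u \<epsilon>) x)"
    "\<alpha> \<epsilon> * L.flux (t \<epsilon>) 0 = \<epsilon> * (\<beta> \<epsilon> * R.flux (t \<epsilon>) 0)"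
    "matching \<epsilon> (t \<epsilon>) = 0"
    by (fact form(1) form(2) form(7) form(8))+
  fix x
  show "u \<epsilon> x = \<alpha> \<epsilon> * L.sol (t \<epsilon>) x" "k x * Dv a 0 (u \<epsilon>) x = \<alpha> \<epsilon> * L.flux (t \<epsilon>) x" if "x \<in> {a..0}"
    by (fact form(3)[OF that] form(4)[OF that])+
  show "u \<epsilon> x = - \<beta> \<epsilon> * R.sol (t \<epsilon>) (-x)" "\<kappa> x * Dv 0 b (u \<epsilon>) x = \<beta> \<epsilon> * R.flux (t \<epsilon>) (-x)"
    if "x \<in> {0..b}"
    by (fact form(5)[OF that] form(6)[OF that])+
qed

lemma t_limit: "(t \<longlongrightarrow> m) (at_right 0)"
  using l_limit by (simp add: t_def[abs_def])

lemma endpoint_limits: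
  "((\<lambda>\<epsilon>. L.flux (t \<epsilon>) 0) \<longlongrightarrow> L.flux m 0) (at_right 0)"
  "((\<lambda>\<epsilon>. R.flux (t \<epsilon>) 0) \<longlongrightarrow> R.flux m 0) (at_right 0)"
  "((\<lambda>\<epsilon>. L.sol_norm2 (t \<epsilon>)) \<longlongrightarrow> L.sol_norm2 m) (at_right 0)"
  "((\<lambda>\<epsilon>. R.sol_norm2 (t \<epsilon>)) \<longlongrightarrow> R.sol_norm2 m) (at_right 0)"
  using isCont_tendsto_compose[OF L.endpoint_isCont(2) t_limit]
    isCont_tendsto_compose[OF R.endpoint_isCont(2) t_limit]
    isCont_tendsto_compose[OF L.sol_norm2_isCont t_limit]
    isCont_tendsto_compose[OF R.sol_norm2_isCont t_limit] by auto

lemma \<beta>0_pos: "0 < \<beta>0"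
  using R.sol_norm2_pos[of m] by (simp add: \<beta>0_def)

text \<open>
  The flux condition gives \<open>\<alpha> = \<epsilon> \<gamma> \<beta>\<close> with convergent \<open>\<gamma>\<close>, and then the normalization is a
  quadratic equation for \<open>\<beta>\<close> with convergent coefficients; \<open>\<beta>\<close> is its positive root.
\<close>
lemma amplitude_limits:
  "(\<beta> \<longlongrightarrow> \<beta>0) (at_right 0)" "(\<alpha> \<longlongrightarrow> 0) (at_right 0)"
proof -
  define \<gamma> where "\<gamma> = (\<lambda>\<epsilon>. R.flux (t \<epsilon>) 0 / L.flux (t \<epsilon>) 0)"
  define D where "D = (\<lambda>\<epsilon>. (\<epsilon> * \<gamma> \<epsilon>)\<^sup>2 * L.sol_norm2 (t \<epsilon>) + R.sol_norm2 (t \<epsilon>))"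
  have \<gamma>: "(\<gamma> \<longlongrightarrow> R.flux m 0 / L.flux m 0) (at_right 0)"
    unfolding \<gamma>_def by (intro tendsto_divide endpoint_limits flux_nz)
  have "(D \<longlongrightarrow> (0 * (R.flux m 0 / L.flux m 0))\<^sup>2 * L.sol_norm2 m + R.sol_norm2 m) (at_right 0)"
    unfolding D_def by (intro tendsto_intros endpoint_limits \<gamma>)
  then have "((\<lambda>\<epsilon>. 1 / sqrt (D \<epsilon>)) \<longlongrightarrow> \<beta>0) (at_right 0)"
    unfolding \<beta>0_def using R.sol_norm2_pos[of m] by (intro tendsto_intros) auto
  moreover have nz: "\<forall>\<^sub>F \<epsilon> in at_right 0. L.flux (t \<epsilon>) 0 \<noteq> 0"
    by (rule tendsto_imp_eventually_ne[OF endpoint_limits(1) flux_nz])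
  have \<alpha>_eq: "\<forall>\<^sub>F \<epsilon> in at_right 0. \<alpha> \<epsilon> = \<epsilon> * \<gamma> \<epsilon> * \<beta> \<epsilon>"
    using nz eventually_at_right_less[of 0]
  proof eventually_elim
    case (elim \<epsilon>)
    then show ?case using u_form(7)[OF elim(2)] by (simp add: \<gamma>_def field_simps)
  qed
  have "\<forall>\<^sub>F \<epsilon> in at_right 0. 1 / sqrt (D \<epsilon>) = \<beta> \<epsilon>"
    using \<alpha>_eq eventually_at_right_less[of 0]
  proof eventually_elim
    case (elim \<epsilon>)
    have "(\<alpha> \<epsilon>)\<^sup>2 * L.sol_norm2 (t \<epsilon>) + (\<beta> \<epsilon>)\<^sup>2 * R.sol_norm2 (t \<epsilon>) = 1"
      using normalization_identity[OF u_form(3,5)[OF elim(2)]] u_eigen[OF elim(2)]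
      by (simp add: normalized_eigenfunction_def)
    then have "(\<beta> \<epsilon>)\<^sup>2 * D \<epsilon> = 1"
      unfolding elim(1) D_def by (simp add: power_mult_distrib algebra_simps)
    moreover have "0 < \<beta> \<epsilon>"
      using u_eigen[OF elim(2)] \<kappa>\<rho>_pos[OF zero_mem(4)] by (simp add: normalized_eigenfunction_def \<beta>_def)
    moreover have "0 \<le> D \<epsilon>"
      unfolding D_def using less_imp_le[OF L.sol_norm2_pos] less_imp_le[OF R.sol_norm2_pos]
      by (intro add_nonneg_nonneg mult_nonneg_nonneg) auto
    ultimately have "\<beta> \<epsilon> * sqrt (D \<epsilon>) = 1"
      by (metis abs_of_pos real_sqrt_abs real_sqrt_mult real_sqrt_one)
    then show ?case by (metis nonzero_eq_divide_eq mult_zero_right zero_neq_one)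
  qed
  ultimately show \<beta>: "(\<beta> \<longlongrightarrow> \<beta>0) (at_right 0)"
    using Lim_transform_eventually by blast
  have "((\<lambda>\<epsilon>. \<epsilon> * \<gamma> \<epsilon> * \<beta> \<epsilon>) \<longlongrightarrow> 0 * (R.flux m 0 / L.flux m 0) * \<beta>0) (at_right 0)"
    by (intro tendsto_intros \<gamma> \<beta>)
  then have "((\<lambda>\<epsilon>. \<epsilon> * \<gamma> \<epsilon> * \<beta> \<epsilon>) \<longlongrightarrow> 0) (at_right 0)" by simp
  moreover have "\<forall>\<^sub>F \<epsilon> in at_right 0. \<epsilon> * \<gamma> \<epsilon> * \<beta> \<epsilon> = \<alpha> \<epsilon>"
    using \<alpha>_eq by eventually_elim simp
  ultimately show "(\<alpha> \<longlongrightarrow> 0) (at_right 0)"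
    by (rule Lim_transform_eventually)
qed

end

lemma power_sum_tendsto_at_0:
  fixes f :: "nat \<Rightarrow> real"
  shows "((\<lambda>\<epsilon>. \<Sum>i\<le>n. \<epsilon> ^ i * f i) \<longlongrightarrow> f 0) (at_right 0)"
proof -
  have "((\<lambda>\<epsilon>. \<Sum>i\<le>n. \<epsilon> ^ i * f i) \<longlongrightarrow> (\<Sum>i\<le>n. 0 ^ i * f i)) (at_right 0)"
    by (intro tendsto_intros)
  moreover have "(\<Sum>i\<le>n. 0 ^ i * f i) = f 0"
    by (simp add: power_0_left if_distrib[of "\<lambda>x. x * _"] cong: if_cong)
  ultimately show ?thesis by simp
qed

context eigenvalue_branch
begin

lemma limit_eigenfunction:
  "dirichlet_eigenfunction b \<kappa> \<rho> m (\<lambda>x. - \<beta>0 * R.sol m (-x))"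
  unfolding dirichlet_eigenfunction_def
proof (intro conjI)
  have "sl_system 0 b \<kappa> (\<lambda>x. m * \<rho> x) (\<lambda>x. 0) (\<lambda>x. - \<beta>0 * R.sol m (-x)) (\<lambda>x. - \<beta>0 * (- R.flux m (-x)))"
    using sl_system_scale[OF right_sol_sys, of m "- \<beta>0"] by simp
  then show "solves_SL 0 b \<kappa> (\<lambda>x. m * \<rho> x) (\<lambda>x. 0) (\<lambda>x. - \<beta>0 * R.sol m (-x))"
    by (rule sl_system_imp_solves_SL[OF b_pos _, rotated]) (use \<kappa>\<rho>_pos in blast)
  show "- \<beta>0 * R.sol m (- 0) = 0" "- \<beta>0 * R.sol m (- b) = 0"
    using sol_zero by simp_all
  obtain x where "x \<in> {-b..0}" "R.sol m x \<noteq> 0" using R.sol_nonzero by blast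
  then show "\<exists>x\<in>{0..b}. - \<beta>0 * R.sol m (- x) \<noteq> 0"
    using \<beta>0_pos by (intro bexI[of _ "-x"]) auto
qed

lemma derivative_of_system:
  assumes "sl_system c d p q g v V" "x \<in> {c..d}" "\<And>x. x \<in> {c..d} \<Longrightarrow> f x = v x"
  shows "(f has_real_derivative V x / p x) (at x within {c..d})"
  by (rule has_real_derivative_transform[OF assms(2,3) sl_systemD(1)[OF assms(1,2)]])

text \<open>
  Both functions are multiples of shooting solutions on each half, with converging amplitudes and
  parameters, so values and fluxes converge uniformly.
\<close>
lemma H1_convergence:
  defines "u0 \<equiv> (\<lambda>x. if x < 0 then 0 else - \<beta>0 * R.sol m (-x))"
  shows "u0 \<in> H1 a b" "\<And>\<epsilon>. 0 < \<epsilon> \<Longrightarrow> u \<epsilon> \<in> H1 a b"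
    "((\<lambda>\<epsilon>. H1_norm a b (\<lambda>x. u \<epsilon> x - u0 x)) \<longlongrightarrow> 0) (at_right 0)"
proof -
  obtain C where C: "0 \<le> C" "\<And>f V W N. flux_bounded f V W N \<Longrightarrow> f \<in> H1 a b \<and> H1_norm a b f \<le> C * N"
    using flux_bounded_H1 by blast
  have u0L: "u0 x = 0" if "x \<in> {a..0}" for x
    using that sol_zero by (auto simp: u0_def)
  have u0R: "u0 x = - \<beta>0 * R.sol m (-x)" if "x \<in> {0..b}" for x
    using that by (auto simp: u0_def)
  have sysR: "sl_system 0 b \<kappa> (\<lambda>x. t * \<rho> x) (\<lambda>x. s * 0) (\<lambda>x. s * R.sol t (-x)) (\<lambda>x. s * - R.flux t (-x))" for s t
    by (rule sl_system_scale[OF right_sol_sys])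
  have sysL: "sl_system a 0 k (\<lambda>x. t * r x) (\<lambda>x. s * 0) (\<lambda>x. s * L.sol t x) (\<lambda>x. s * L.flux t x)" for s t
    by (rule sl_system_scale[OF L.sol_sys])
  obtain BL where BL: "0 < BL"
    "\<And>t x. \<bar>t\<bar> \<le> \<bar>m\<bar> + 1 \<Longrightarrow> x \<in> {a..0} \<Longrightarrow> \<bar>L.sol t x\<bar> \<le> BL \<and> \<bar>L.flux t x\<bar> \<le> BL"
    using L.sol_bounded by blast
  obtain BR where BR: "0 < BR"
    "\<And>t x. \<bar>t\<bar> \<le> \<bar>m\<bar> + 1 \<Longrightarrow> x \<in> {-b..0} \<Longrightarrow> \<bar>R.sol t x\<bar> \<le> BR \<and> \<bar>R.flux t x\<bar> \<le> BR"
    using R.sol_bounded by blast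
  obtain K where K: "0 < K" "\<And>s t x. \<bar>s\<bar> \<le> \<bar>m\<bar> + 1 \<Longrightarrow> \<bar>t\<bar> \<le> \<bar>m\<bar> + 1 \<Longrightarrow> x \<in> {-b..0} \<Longrightarrow>
      \<bar>R.sol s x - R.sol t x\<bar> \<le> K * \<bar>s - t\<bar> \<and> \<bar>R.flux s x - R.flux t x\<bar> \<le> K * \<bar>s - t\<bar>"
    using R.sol_Lipschitz by blast
  have derivL: "(f has_real_derivative (s * L.flux t x) / k x) (at x within {a..0})"
    if "x \<in> {a..0}" "\<And>x. x \<in> {a..0} \<Longrightarrow> f x = s * L.sol t x" for f s t x
    by (rule derivative_of_system[OF sysL that])
  have derivR: "(f has_real_derivative (s * - R.flux t (-x)) / \<kappa> x) (at x within {0..b})"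
    if "x \<in> {0..b}" "\<And>x. x \<in> {0..b} \<Longrightarrow> f x = s * R.sol t (-x)" for f s t x
    by (rule derivative_of_system[OF sysR that])
  have contL: "continuous_on {a..0} (\<lambda>x. s * L.flux t x)" for s t
    by (intro continuous_intros L.flux_cont)
  have contR: "continuous_on {0..b} (\<lambda>x. s * - R.flux t (-x))" for s t
    using sl_system_continuous(2)[OF sysR] .
  have H1: "f \<in> H1 a b"
    if fL: "\<And>x. x \<in> {a..0} \<Longrightarrow> f x = s * L.sol t x" and fR: "\<And>x. x \<in> {0..b} \<Longrightarrow> f x = s' * R.sol t' (-x)" for f s t s' t'
  proof -
    have "continuous_on {a..0} f"
      by (rule DERIV_continuous_on, erule derivL[OF _ fL])
    moreover have "continuous_on {0..b} f"
      by (rule DERIV_continuous_on, erule derivR[OF _ fR])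
    ultimately obtain N1 N2 N3 N4 where N: "\<And>x. x \<in> {a..0} \<Longrightarrow> \<bar>f x\<bar> \<le> N1" "\<And>x. x \<in> {0..b} \<Longrightarrow> \<bar>f x\<bar> \<le> N2"
      "\<And>x. x \<in> {a..0} \<Longrightarrow> \<bar>s * L.flux t x\<bar> \<le> N3" "\<And>x. x \<in> {0..b} \<Longrightarrow> \<bar>s' * - R.flux t' (-x)\<bar> \<le> N4"
      using continuous_on_Icc_bounded contL contR by metis
    have "flux_bounded f (\<lambda>x. s * L.flux t x) (\<lambda>x. s' * - R.flux t' (-x)) (max (max N1 N2) (max N3 N4))"
      unfolding flux_bounded_def
    proof (intro conjI ballI contL contR)
      fix x assume x: "x \<in> {a..0}"
      show "(f has_real_derivative s * L.flux t x / k x) (at x within {a..0})" by (rule derivL[OF x fL])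
      show "\<bar>f x\<bar> \<le> max (max N1 N2) (max N3 N4)" "\<bar>s * L.flux t x\<bar> \<le> max (max N1 N2) (max N3 N4)"
        using N(1,3)[OF x] by linarith+
    next
      fix x assume x: "x \<in> {0..b}"
      show "(f has_real_derivative s' * - R.flux t' (-x) / \<kappa> x) (at x within {0..b})" by (rule derivR[OF x fR])
      show "\<bar>f x\<bar> \<le> max (max N1 N2) (max N3 N4)" "\<bar>s' * - R.flux t' (-x)\<bar> \<le> max (max N1 N2) (max N3 N4)"
        using N(2,4)[OF x] by linarith+
    qed
    then show ?thesis using C(2) by blast
  qed
  show "u0 \<in> H1 a b"
    by (rule H1[where s = 0 and s' = "- \<beta>0" and t = 0 and t' = m]) (use u0L u0R in auto)
  show "u \<epsilon> \<in> H1 a b" if "0 < \<epsilon>" for \<epsilon>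
    by (rule H1[where s = "\<alpha> \<epsilon>" and s' = "- \<beta> \<epsilon>" and t = "t \<epsilon>" and t' = "t \<epsilon>"])
      (use u_form(3,5)[OF that] in auto)
  define N where "N = (\<lambda>\<epsilon>. \<bar>\<alpha> \<epsilon>\<bar> * BL + (\<bar>\<beta> \<epsilon> - \<beta>0\<bar> * BR + \<beta>0 * (K * \<bar>t \<epsilon> - m\<bar>)))"
  have "\<forall>\<^sub>F \<epsilon> in at_right 0. \<bar>t \<epsilon> - m\<bar> < 1"
    using tendstoD[OF t_limit, of 1] by (simp add: dist_real_def)
  then have "\<forall>\<^sub>F \<epsilon> in at_right 0. norm (H1_norm a b (\<lambda>x. u \<epsilon> x - u0 x)) \<le> C * N \<epsilon>"
    using eventually_at_right_less[of 0]
  proof eventually_elim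
    case (elim \<epsilon>)
    have T: "\<bar>t \<epsilon>\<bar> \<le> \<bar>m\<bar> + 1" "\<bar>m\<bar> \<le> \<bar>m\<bar> + 1" using elim(1) by auto
    have NL: "\<bar>\<alpha> \<epsilon>\<bar> * BL \<le> N \<epsilon>" and NR: "\<bar>\<beta> \<epsilon> - \<beta>0\<bar> * BR + \<beta>0 * (K * \<bar>t \<epsilon> - m\<bar>) \<le> N \<epsilon>"
      using BL(1) BR(1) K(1) \<beta>0_pos by (auto simp: N_def)
    have left: "\<bar>\<alpha> \<epsilon> * y\<bar> \<le> N \<epsilon>" if "\<bar>y\<bar> \<le> BL" for y
    proof -
      have "\<bar>\<alpha> \<epsilon>\<bar> * \<bar>y\<bar> \<le> \<bar>\<alpha> \<epsilon>\<bar> * BL" using that by (intro mult_left_mono) auto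
      then show ?thesis using NL by (simp add: abs_mult)
    qed
    have right: "\<bar>\<beta> \<epsilon> * y - \<beta>0 * y'\<bar> \<le> N \<epsilon>" if "\<bar>y\<bar> \<le> BR" "\<bar>y - y'\<bar> \<le> K * \<bar>t \<epsilon> - m\<bar>" for y y'
    proof -
      have "\<beta> \<epsilon> * y - \<beta>0 * y' = (\<beta> \<epsilon> - \<beta>0) * y + \<beta>0 * (y - y')" by algebra
      then have "\<bar>\<beta> \<epsilon> * y - \<beta>0 * y'\<bar> \<le> \<bar>\<beta> \<epsilon> - \<beta>0\<bar> * \<bar>y\<bar> + \<beta>0 * \<bar>y - y'\<bar>"
        using abs_triangle_ineq[of "(\<beta> \<epsilon> - \<beta>0) * y" "\<beta>0 * (y - y')"] \<beta>0_pos by (simp add: abs_mult)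
      also have "\<dots> \<le> \<bar>\<beta> \<epsilon> - \<beta>0\<bar> * BR + \<beta>0 * (K * \<bar>t \<epsilon> - m\<bar>)"
        using that \<beta>0_pos by (intro add_mono mult_left_mono) auto
      finally show ?thesis using NR by linarith
    qed
    define V where "V = (\<lambda>x. \<alpha> \<epsilon> * L.flux (t \<epsilon>) x)"
    define W where "W = (\<lambda>x. - \<beta> \<epsilon> * - R.flux (t \<epsilon>) (-x) - - \<beta>0 * - R.flux m (-x))"
    have "flux_bounded (\<lambda>x. u \<epsilon> x - u0 x) V W (N \<epsilon>)"
      unfolding flux_bounded_def
    proof (intro conjI ballI)
      show "continuous_on {a..0} V" unfolding V_def by (rule contL)
      show "continuous_on {0..b} W" unfolding W_def by (intro continuous_on_diff contR)
      fix x assume x: "x \<in> {a..0}"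
      show "((\<lambda>x. u \<epsilon> x - u0 x) has_real_derivative V x / k x) (at x within {a..0})"
        unfolding V_def by (rule derivL[OF x]) (use u_form(3)[OF elim(2)] u0L in simp)
      show "\<bar>u \<epsilon> x - u0 x\<bar> \<le> N \<epsilon>" "\<bar>V x\<bar> \<le> N \<epsilon>"
        unfolding V_def u0L[OF x] u_form(3)[OF elim(2) x] using left BL(2)[OF T(1) x] by simp_all
    next
      fix x assume x: "x \<in> {0..b}"
      then have y: "-x \<in> {-b..0}" by simp
      have "((\<lambda>x. u \<epsilon> x - u0 x) has_real_derivative
          (- \<beta> \<epsilon> * - R.flux (t \<epsilon>) (-x)) / \<kappa> x - (- \<beta>0 * - R.flux m (-x)) / \<kappa> x) (at x within {0..b})"
        by (intro DERIV_diff derivR x) (use u_form(5)[OF elim(2)] u0R in auto)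
      then show "((\<lambda>x. u \<epsilon> x - u0 x) has_real_derivative W x / \<kappa> x) (at x within {0..b})"
        by (simp only: W_def diff_divide_distrib)
      have "\<bar>u \<epsilon> x - u0 x\<bar> = \<bar>\<beta> \<epsilon> * R.sol (t \<epsilon>) (-x) - \<beta>0 * R.sol m (-x)\<bar>"
        unfolding u0R[OF x] u_form(5)[OF elim(2) x] by simp
      then show "\<bar>u \<epsilon> x - u0 x\<bar> \<le> N \<epsilon>"
        using right BR(2)[OF T(1) y] K(2)[OF T y] by simp
      show "\<bar>W x\<bar> \<le> N \<epsilon>"
        using right BR(2)[OF T(1) y] K(2)[OF T y] by (simp add: W_def)
    qed
    then show ?case using C(2) H1_norm_nonneg by simp
  qed
  moreover have "((\<lambda>\<epsilon>. C * N \<epsilon>) \<longlongrightarrow> 0) (at_right 0)"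
  proof -
    have "((\<lambda>\<epsilon>. C * N \<epsilon>) \<longlongrightarrow> C * (\<bar>0\<bar> * BL + (\<bar>\<beta>0 - \<beta>0\<bar> * BR + \<beta>0 * (K * \<bar>m - m\<bar>)))) (at_right 0)"
      unfolding N_def by (intro tendsto_intros amplitude_limits t_limit)
    then show ?thesis by simp
  qed
  ultimately show "((\<lambda>\<epsilon>. H1_norm a b (\<lambda>x. u \<epsilon> x - u0 x)) \<longlongrightarrow> 0) (at_right 0)"
    by (rule Lim_null_comparison)
qed

end

section \<open>Asymptotic expansions\<close>

lemma abs_mult_le:
  fixes x y :: real
  assumes "\<bar>x\<bar> \<le> X" "\<bar>y\<bar> \<le> Y"
  shows "\<bar>x * y\<bar> \<le> X * Y"
  unfolding abs_mult using assms by (intro mult_mono) auto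

context eigenvalue_branch
begin

text \<open>
  Because \<open>y 0 = 0\<close> on \<open>[a, 0]\<close>, the term \<open>\<nu> i y 0\<close> may be added to the equation on the left. Both
  halves then have the same recursion, including the index 0.
\<close>
lemma expansion_systems:
  assumes coeffs: "expansion_coeffs a b k r \<kappa> \<rho> m \<nu> y z"
  shows "\<And>i. sl_system a 0 k (\<lambda>x. m * r x) (\<lambda>x. - r x * (\<Sum>l=1..i. \<nu> l * y (i - l) x))
      (y i) (\<lambda>x. k x * Dv a 0 (y i) x)"
    and "\<And>i. sl_system 0 b \<kappa> (\<lambda>x. m * \<rho> x) (\<lambda>x. - \<rho> x * (\<Sum>l=1..i. \<nu> l * z (i - l) x))
      (z i) (\<lambda>x. \<kappa> x * Dv 0 b (z i) x)"
    and "\<And>i. y i a = 0" "\<And>i. z i b = 0" "\<And>i. y i 0 = z i 0"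
    and "k 0 * Dv a 0 (y 0) 0 = 0"
    and "\<And>i. k 0 * Dv a 0 (y (Suc i)) 0 = \<kappa> 0 * Dv 0 b (z i) 0"
    and "0 < \<kappa> b * Dv 0 b (z 0) b"
proof -
  have y0: "y 0 x = 0" if "x \<in> {a..0}" for x
    using coeffs that unfolding expansion_coeffs_def by blast
  have z0: "(zero_ext 0 b (z 0), \<lambda>x. complex_of_real m * zero_ext 0 b (z 0) x) \<in> A2_hat b \<kappa> \<rho>"
    and z0': "Dv 0 b (z 0) b > 0"
    using coeffs unfolding expansion_coeffs_def by blast+
  have step: "solves_SL a 0 k (\<lambda>x. m * r x) (\<lambda>x. - r x * (\<Sum>i = 1..n - 1. \<nu> i * y (n - i) x)) (y n)"
      "y n a = 0" "k 0 * Dv a 0 (y n) 0 = \<kappa> 0 * Dv 0 b (z (n - 1)) 0"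
      "solves_SL 0 b \<kappa> (\<lambda>x. m * \<rho> x)
          (\<lambda>x. - \<nu> n * \<rho> x * z 0 x - \<rho> x * (\<Sum>i = 1..n - 1. \<nu> i * z (n - i) x)) (z n)"
      "z n 0 = y n 0" "z n b = 0" if "1 \<le> n" for n
    using coeffs that unfolding expansion_coeffs_def by blast+
  have sum_split: "(\<Sum>l=1..i. h l) = (\<Sum>l=1..i - 1. h l) + h i" if "1 \<le> i" for i and h :: "nat \<Rightarrow> real"
    using that by (cases i) auto
  have zero: "sl_system a 0 k (\<lambda>x. m * r x) (\<lambda>x. 0) (y 0) (\<lambda>x. 0)"
    by (rule sl_system_cong[where u = "\<lambda>x. 0" and v = "\<lambda>x. 0" and g = "\<lambda>x. 0" and q = "\<lambda>x. m * r x" and p = k])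
      (auto simp: sl_system_def y0)
  have yq0: "k x * Dv a 0 (y 0) x = 0" if "x \<in> {a..0}" for x
    by (rule sl_system_quasi_derivative[OF a_neg L.p_pos zero that])
  show "k 0 * Dv a 0 (y 0) 0 = 0" by (rule yq0[OF zero_mem(1)])
  show "sl_system a 0 k (\<lambda>x. m * r x) (\<lambda>x. - r x * (\<Sum>l=1..i. \<nu> l * y (i - l) x))
      (y i) (\<lambda>x. k x * Dv a 0 (y i) x)" for i
  proof (cases "i = 0")
    case True
    show ?thesis unfolding True by (rule sl_system_cong[OF zero]) (auto simp: yq0)
  next
    case False
    then have i: "1 \<le> i" by simp
    show ?thesis
      by (rule sl_system_cong[OF step(1)[OF i, unfolded left_solves_iff]])
        (auto simp only: sum_split[OF i] y0 diff_self_eq_0 mult_zero_right add_0_right)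
  qed
  have csys: "csl_system 0 b \<kappa> (\<lambda>x. m * \<rho> x) (\<lambda>x. - \<rho> x *\<^sub>R 0) (zero_ext 0 b (z 0))
      (\<lambda>x. \<kappa> x *\<^sub>R Dv 0 b (zero_ext 0 b (z 0)) x)"
  proof -
    have "(zero_ext 0 b (z 0), \<lambda>x. 0 + complex_of_real m * zero_ext 0 b (z 0) x) \<in> SL_graph 0 b \<kappa> \<rho>"
      using z0 by (simp add: A2_hat_def)
    then show ?thesis
      by (subst (asm) SL_graph_iff) (use b_pos \<kappa>_smooth \<kappa>\<rho>_pos coeff_cont in auto)
  qed
  define V where "V = (\<lambda>x. Re (\<kappa> x *\<^sub>R Dv 0 b (zero_ext 0 b (z 0)) x))"
  have "sl_system 0 b \<kappa> (\<lambda>x. m * \<rho> x) (\<lambda>x. 0) (\<lambda>x. Re (zero_ext 0 b (z 0) x)) V"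
    using csys by (simp add: csl_system_def V_def)
  then have sysV: "sl_system 0 b \<kappa> (\<lambda>x. m * \<rho> x) (\<lambda>x. 0) (z 0) V"
    by (rule sl_system_cong) (auto simp: zero_ext_def)
  have zq0: "\<kappa> x * Dv 0 b (z 0) x = V x" if "x \<in> {0..b}" for x
    using sl_system_quasi_derivative[OF b_pos _ sysV that] \<kappa>\<rho>_pos by blast
  show "sl_system 0 b \<kappa> (\<lambda>x. m * \<rho> x) (\<lambda>x. - \<rho> x * (\<Sum>l=1..i. \<nu> l * z (i - l) x))
      (z i) (\<lambda>x. \<kappa> x * Dv 0 b (z i) x)" for i
  proof (cases "i = 0")
    case True
    show ?thesis unfolding True by (rule sl_system_cong[OF sysV]) (auto simp: zq0)
  next
    case False
    then have i: "1 \<le> i" by simp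
    have rhs: "- \<rho> x * (\<Sum>l=1..i. \<nu> l * z (i - l) x)
        = - \<nu> i * \<rho> x * z 0 x - \<rho> x * (\<Sum>l=1..i - 1. \<nu> l * z (i - l) x)" for x
      unfolding sum_split[OF i] by (simp add: distrib_left mult_ac del: One_nat_def)
    show ?thesis
      unfolding rhs using step(4)[OF i] unfolding right_solves_iff .
  qed
  have "zero_ext 0 b (z 0) 0 = 0" "zero_ext 0 b (z 0) b = 0"
    using z0 by (auto simp: A2_hat_def)
  then have z0_ends: "z 0 0 = 0" "z 0 b = 0"
    using b_pos by (auto simp: zero_ext_def)
  show "y i a = 0" "z i b = 0" "y i 0 = z i 0" for i
    using step[of i] y0[OF zero_mem(3)] y0[OF zero_mem(1)] z0_ends by (cases "i = 0"; auto)+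
  show "k 0 * Dv a 0 (y (Suc i)) 0 = \<kappa> 0 * Dv 0 b (z i) 0" for i
    using step(3)[of "Suc i"] by simp
  show "0 < \<kappa> b * Dv 0 b (z 0) b"
    using z0' \<kappa>\<rho>_pos[OF zero_mem(4)] by simp
qed

text \<open>
  The multiplier \<open>\<theta>\<close> is chosen so that the flux at \<open>b\<close> is reproduced exactly. The constants
  \<open>eL, eR\<close> measure the deviation of the truncated series from multiples of shooting solutions for the
  truncated parameter \<open>M\<close>, the constant \<open>c\<close> the error of \<open>M\<close>, and \<open>eA\<close> the mismatch of the amplitudes
  on the left.
\<close>
lemma asymptotic_expansion:
  assumes coeffs: "expansion_coeffs a b k r \<kappa> \<rho> m \<nu> y z"
  shows "\<exists>c C \<theta> \<theta>0. 0 < \<theta>0 \<and> (\<theta> \<longlongrightarrow> \<theta>0) (at_right 0) \<and>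
    (\<forall>\<^sub>F \<epsilon> in at_right 0.
      \<bar>l \<epsilon> / \<epsilon> - (m + (\<Sum>i=1..n. \<epsilon> ^ i * \<nu> i))\<bar> \<le> c * \<epsilon> ^ (n + 1) \<and>
      (\<lambda>x. u \<epsilon> x - \<theta> \<epsilon> * partial_expansion y z n \<epsilon> x) \<in> H1 a b \<and>
      H1_norm a b (\<lambda>x. u \<epsilon> x - \<theta> \<epsilon> * partial_expansion y z n \<epsilon> x) \<le> C * \<epsilon> ^ (n + 1))"
proof -
  note coeff = expansion_systems[OF coeffs]
  define yq where "yq = (\<lambda>i x. k x * Dv a 0 (y i) x)"
  define zq where "zq = (\<lambda>i x. \<kappa> x * Dv 0 b (z i) x)"
  define Y Yq Z Zq where "Y = (\<lambda>\<epsilon> x. \<Sum>i\<le>n. \<epsilon> ^ i * y i x)" and "Yq = (\<lambda>\<epsilon> x. \<Sum>i\<le>n. \<epsilon> ^ i * yq i x)"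
    and "Z = (\<lambda>\<epsilon> x. \<Sum>i\<le>n. \<epsilon> ^ i * z i x)" and "Zq = (\<lambda>\<epsilon> x. \<Sum>i\<le>n. \<epsilon> ^ i * zq i x)"
  define M where "M = (\<lambda>\<epsilon>. m + (\<Sum>i=1..n. \<epsilon> ^ i * \<nu> i))"
  define \<zeta> where "\<zeta> = zq 0 b"
  define \<theta> where "\<theta> = (\<lambda>\<epsilon>. \<beta> \<epsilon> / Zq \<epsilon> b)"
  have \<zeta>: "0 < \<zeta>" using coeff(8) by (simp add: \<zeta>_def zq_def)
  have Zq_lim: "((\<lambda>\<epsilon>. Zq \<epsilon> b) \<longlongrightarrow> \<zeta>) (at_right 0)"
    unfolding Zq_def \<zeta>_def by (rule power_sum_tendsto_at_0)
  have \<theta>_lim: "(\<theta> \<longlongrightarrow> \<beta>0 / \<zeta>) (at_right 0)"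
    unfolding \<theta>_def using \<zeta> by (intro tendsto_divide amplitude_limits Zq_lim) auto
  have M_lim: "(M \<longlongrightarrow> m) (at_right 0)"
  proof -
    have "(M \<longlongrightarrow> m + (\<Sum>i=1..n. 0 ^ i * \<nu> i)) (at_right 0)"
      unfolding M_def by (intro tendsto_intros)
    moreover have "(\<Sum>i=1..n. 0 ^ i * \<nu> i) = 0"
      by (rule sum.neutral) auto
    ultimately show ?thesis by simp
  qed
  have fM_lim: "((\<lambda>\<epsilon>. \<bar>L.flux (M \<epsilon>) 0\<bar>) \<longlongrightarrow> \<bar>L.flux m 0\<bar>) (at_right 0)"
    by (intro tendsto_rabs isCont_tendsto_compose[OF L.endpoint_isCont(2) M_lim])
  \<comment> \<open>Boundary conditions of the truncated series; only the last flux term is unmatched.\<close>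
  have Ya: "Y \<epsilon> a = 0" and Zb: "Z \<epsilon> b = 0" and YZ0: "Y \<epsilon> 0 = Z \<epsilon> 0" for \<epsilon>
    using coeff(3,4,5) by (simp_all add: Y_def Z_def)
  have flux0: "Yq \<epsilon> 0 = \<epsilon> * Zq \<epsilon> 0 - \<epsilon> ^ (n + 1) * zq n 0" for \<epsilon>
  proof -
    have "Yq \<epsilon> 0 = (\<Sum>i<n. \<epsilon> ^ Suc i * yq (Suc i) 0)"
      unfolding Yq_def sum.atMost_shift using coeff(6) by (simp add: yq_def)
    also have "\<dots> = \<epsilon> * (\<Sum>i<n. \<epsilon> ^ i * zq i 0)"
      using coeff(7) by (simp add: yq_def zq_def sum_distrib_left mult.assoc)
    also have "(\<Sum>i<n. \<epsilon> ^ i * zq i 0) = Zq \<epsilon> 0 - \<epsilon> ^ n * zq n 0"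
      unfolding Zq_def by (simp add: lessThan_Suc_atMost[symmetric])
    finally show ?thesis by (simp add: algebra_simps)
  qed
  have "\<exists>K>0. \<forall>\<epsilon>. 0 < \<epsilon> \<and> \<epsilon> \<le> 1 \<longrightarrow> (\<exists>g. L.sys (M \<epsilon>) g (Y \<epsilon>) (Yq \<epsilon>) \<and>
      (\<forall>x\<in>{a..0}. \<bar>g x\<bar> \<le> K * \<epsilon> ^ (n + 1)))"
    unfolding M_def Y_def Yq_def yq_def by (rule truncated_expansion[OF coeff_cont(2) coeff(1)])
  then obtain KL where KL: "0 < KL" "\<forall>\<epsilon>. 0 < \<epsilon> \<and> \<epsilon> \<le> 1 \<longrightarrow> (\<exists>g. L.sys (M \<epsilon>) g (Y \<epsilon>) (Yq \<epsilon>) \<and>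
      (\<forall>x\<in>{a..0}. \<bar>g x\<bar> \<le> KL * \<epsilon> ^ (n + 1)))"
    by (elim exE conjE)
  have "\<exists>K>0. \<forall>\<epsilon>. 0 < \<epsilon> \<and> \<epsilon> \<le> 1 \<longrightarrow> (\<exists>g. sl_system 0 b \<kappa> (\<lambda>x. M \<epsilon> * \<rho> x) g (Z \<epsilon>) (Zq \<epsilon>) \<and>
      (\<forall>x\<in>{0..b}. \<bar>g x\<bar> \<le> K * \<epsilon> ^ (n + 1)))"
    unfolding M_def Z_def Zq_def zq_def by (rule truncated_expansion[OF coeff_cont(4) coeff(2)])
  then obtain KR where KR: "0 < KR" "\<forall>\<epsilon>. 0 < \<epsilon> \<and> \<epsilon> \<le> 1 \<longrightarrow> (\<exists>g. sl_system 0 b \<kappa> (\<lambda>x. M \<epsilon> * \<rho> x) g (Z \<epsilon>) (Zq \<epsilon>) \<and>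
      (\<forall>x\<in>{0..b}. \<bar>g x\<bar> \<le> KR * \<epsilon> ^ (n + 1)))"
    by (elim exE conjE)
  define T where "T = \<bar>m\<bar> + 1"
  obtain CL where CL: "L.stability_constant T CL" using L.stability by blast
  obtain CR where CR: "R.stability_constant T CR" using R.stability by blast
  obtain BL where BL: "0 < BL"
    "\<And>t x. \<bar>t\<bar> \<le> T \<Longrightarrow> x \<in> {a..0} \<Longrightarrow> \<bar>L.sol t x\<bar> \<le> BL \<and> \<bar>L.flux t x\<bar> \<le> BL"
    using L.sol_bounded by blast
  obtain BR where BR: "0 < BR"
    "\<And>t x. \<bar>t\<bar> \<le> T \<Longrightarrow> x \<in> {-b..0} \<Longrightarrow> \<bar>R.sol t x\<bar> \<le> BR \<and> \<bar>R.flux t x\<bar> \<le> BR"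
    using R.sol_bounded by blast
  obtain PL where PL: "0 < PL" "\<And>s t x. \<bar>s\<bar> \<le> T \<Longrightarrow> \<bar>t\<bar> \<le> T \<Longrightarrow> x \<in> {a..0} \<Longrightarrow>
      \<bar>L.sol s x - L.sol t x\<bar> \<le> PL * \<bar>s - t\<bar> \<and> \<bar>L.flux s x - L.flux t x\<bar> \<le> PL * \<bar>s - t\<bar>"
    using L.sol_Lipschitz by blast
  obtain PR where PR: "0 < PR" "\<And>s t x. \<bar>s\<bar> \<le> T \<Longrightarrow> \<bar>t\<bar> \<le> T \<Longrightarrow> x \<in> {-b..0} \<Longrightarrow>
      \<bar>R.sol s x - R.sol t x\<bar> \<le> PR * \<bar>s - t\<bar> \<and> \<bar>R.flux s x - R.flux t x\<bar> \<le> PR * \<bar>s - t\<bar>"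
    using R.sol_Lipschitz by blast
  obtain \<delta> S where S: "0 < \<delta>" "0 < S" "\<And>\<epsilon> s t. 0 < \<epsilon> \<Longrightarrow> \<bar>s - m\<bar> < \<delta> \<Longrightarrow> \<bar>t - m\<bar> < \<delta> \<Longrightarrow>
      matching \<epsilon> t = 0 \<Longrightarrow> \<bar>t - s\<bar> \<le> S * \<bar>matching \<epsilon> s\<bar>"
    using simple_zero_stability[OF flux_nz sol_zero] by blast
  obtain C1 where C1: "0 \<le> C1" "\<And>f V W N. flux_bounded f V W N \<Longrightarrow> f \<in> H1 a b \<and> H1_norm a b f \<le> C1 * N"
    using flux_bounded_H1 by blast
  define eL eR f0 \<beta>1 \<theta>1 where "eL = CL * KL" and "eR = CR * KR" and "f0 = \<bar>L.flux m 0\<bar> / 2"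
    and "\<beta>1 = \<beta>0 + 1" and "\<theta>1 = \<beta>0 / \<zeta> + 1"
  define c where "c = S * (2 / \<zeta> * (BL * (eL + \<bar>zq n 0\<bar> + eR) + BL * (eR + eL)))"
  define eA where "eA = 1 / f0 * (1 * (PL * c) + \<beta>1 * (PR * c) + \<theta>1 * (eR + \<bar>zq n 0\<bar> + eL))"
  define NL where "NL = 1 * (PL * c) + eA * BL + \<theta>1 * eL"
  define NR where "NR = \<beta>1 * (PR * c) + \<theta>1 * eR"
  have f0: "0 < f0" using flux_nz by (simp add: f0_def)
  have "\<forall>\<^sub>F \<epsilon> in at_right 0. 0 < \<epsilon> \<and> \<epsilon> < 1 \<and> \<bar>t \<epsilon> - m\<bar> < min \<delta> 1 \<and> \<bar>M \<epsilon> - m\<bar> < min \<delta> 1 \<and>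
      \<zeta> / 2 < Zq \<epsilon> b \<and> \<bar>\<alpha> \<epsilon>\<bar> < 1 \<and> \<bar>\<beta> \<epsilon> - \<beta>0\<bar> < 1 \<and>
      \<bar>\<theta> \<epsilon> - \<beta>0 / \<zeta>\<bar> < 1 \<and> f0 < \<bar>L.flux (M \<epsilon>) 0\<bar>"
  proof (intro eventually_conj)
    show "\<forall>\<^sub>F \<epsilon> in at_right (0::real). 0 < \<epsilon>" by (rule eventually_at_right_less)
    show "\<forall>\<^sub>F \<epsilon> in at_right (0::real). \<epsilon> < 1" by (rule order_tendstoD(2)[OF tendsto_ident_at]) simp
    show "\<forall>\<^sub>F \<epsilon> in at_right 0. \<bar>t \<epsilon> - m\<bar> < min \<delta> 1" "\<forall>\<^sub>F \<epsilon> in at_right 0. \<bar>M \<epsilon> - m\<bar> < min \<delta> 1"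
      using tendstoD[OF t_limit, of "min \<delta> 1"] tendstoD[OF M_lim, of "min \<delta> 1"] S(1)
      by (auto simp: dist_real_def)
    show "\<forall>\<^sub>F \<epsilon> in at_right 0. \<zeta> / 2 < Zq \<epsilon> b"
      by (rule order_tendstoD(1)[OF Zq_lim]) (use \<zeta> in simp)
    show "\<forall>\<^sub>F \<epsilon> in at_right 0. \<bar>\<alpha> \<epsilon>\<bar> < 1"
      using tendstoD[OF amplitude_limits(2), of 1] by (simp add: dist_real_def)
    show "\<forall>\<^sub>F \<epsilon> in at_right 0. \<bar>\<beta> \<epsilon> - \<beta>0\<bar> < 1"
      using tendstoD[OF amplitude_limits(1), of 1] by (simp add: dist_real_def)
    show "\<forall>\<^sub>F \<epsilon> in at_right 0. \<bar>\<theta> \<epsilon> - \<beta>0 / \<zeta>\<bar> < 1"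
      using tendstoD[OF \<theta>_lim, of 1] by (simp add: dist_real_def)
    show "\<forall>\<^sub>F \<epsilon> in at_right 0. f0 < \<bar>L.flux (M \<epsilon>) 0\<bar>"
      by (rule order_tendstoD(1)[OF fM_lim]) (use flux_nz in \<open>simp add: f0_def\<close>)
  qed
  then have "\<forall>\<^sub>F \<epsilon> in at_right 0.
      \<bar>l \<epsilon> / \<epsilon> - (m + (\<Sum>i=1..n. \<epsilon> ^ i * \<nu> i))\<bar> \<le> c * \<epsilon> ^ (n + 1) \<and>
      (\<lambda>x. u \<epsilon> x - \<theta> \<epsilon> * partial_expansion y z n \<epsilon> x) \<in> H1 a b \<and>
      H1_norm a b (\<lambda>x. u \<epsilon> x - \<theta> \<epsilon> * partial_expansion y z n \<epsilon> x) \<le> C1 * max NL NR * \<epsilon> ^ (n + 1)"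
  proof eventually_elim
    case (elim \<epsilon>)
    then have \<epsilon>: "0 < \<epsilon>" "\<epsilon> \<le> 1" and near: "\<bar>t \<epsilon> - m\<bar> < \<delta>" "\<bar>M \<epsilon> - m\<bar> < \<delta>"
      and near1: "\<bar>t \<epsilon> - m\<bar> < 1" "\<bar>M \<epsilon> - m\<bar> < 1"
      and Zb_low: "\<zeta> / 2 < Zq \<epsilon> b" and \<alpha>: "\<bar>\<alpha> \<epsilon>\<bar> \<le> 1"
      and \<beta>\<theta>: "\<bar>\<beta> \<epsilon> - \<beta>0\<bar> < 1" "\<bar>\<theta> \<epsilon> - \<beta>0 / \<zeta>\<bar> < 1"
      and fM: "f0 \<le> \<bar>L.flux (M \<epsilon>) 0\<bar>"
      by (simp_all add: less_imp_le)
    have T: "\<bar>t \<epsilon>\<bar> \<le> T" "\<bar>M \<epsilon>\<bar> \<le> T"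
      unfolding T_def using near1 by linarith+
    have \<beta>: "\<bar>\<beta> \<epsilon>\<bar> \<le> \<beta>1" and \<theta>: "\<bar>\<theta> \<epsilon>\<bar> \<le> \<theta>1"
      unfolding \<beta>1_def \<theta>1_def using \<beta>\<theta> \<beta>0_pos divide_pos_pos[OF \<beta>0_pos \<zeta>] by linarith+
    define p where "p = \<epsilon> ^ (n + 1)"
    have p: "0 < p" using \<epsilon> by (simp add: p_def)
    define A where "A = Yq \<epsilon> a"
    define B where "B = Zq \<epsilon> b"
    have B: "0 < B" "\<bar>1 / B\<bar> \<le> 2 / \<zeta>" "\<beta> \<epsilon> = \<theta> \<epsilon> * B"
      using Zb_low \<zeta> by (auto simp: B_def \<theta>_def field_simps)
    \<comment> \<open>The truncated series are multiples of the exact solutions with parameter \<open>M \<epsilon>\<close>, up to the residual.\<close>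
    have approxL: "\<bar>Y \<epsilon> x - A * L.sol (M \<epsilon>) x\<bar> \<le> eL * p" "\<bar>Yq \<epsilon> x - A * L.flux (M \<epsilon>) x\<bar> \<le> eL * p"
      if x: "x \<in> {a..0}" for x
    proof -
      obtain g where g: "L.sys (M \<epsilon>) g (Y \<epsilon>) (Yq \<epsilon>)" "\<forall>x\<in>{a..0}. \<bar>g x\<bar> \<le> KL * \<epsilon> ^ (n + 1)"
        using KL(2) \<epsilon> by blast
      have "L.sys (M \<epsilon>) (\<lambda>x. g x - A * 0) (\<lambda>x. Y \<epsilon> x - A * L.sol (M \<epsilon>) x) (\<lambda>x. Yq \<epsilon> x - A * L.flux (M \<epsilon>) x)"
        by (intro sl_system_diff g(1) sl_system_scale L.sol_sys)
      note stab = L.stability_constantD[OF CL T(2) this _ _ x, of "KL * p"]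
      show "\<bar>Y \<epsilon> x - A * L.sol (M \<epsilon>) x\<bar> \<le> eL * p" "\<bar>Yq \<epsilon> x - A * L.flux (M \<epsilon>) x\<bar> \<le> eL * p"
        using stab g(2) Ya by (simp_all add: A_def eL_def p_def mult.assoc)
    qed
    have approxR: "\<bar>Z \<epsilon> x + B * R.sol (M \<epsilon>) (-x)\<bar> \<le> eR * p" "\<bar>B * R.flux (M \<epsilon>) (-x) - Zq \<epsilon> x\<bar> \<le> eR * p"
      if x: "x \<in> {0..b}" for x
    proof -
      obtain g where g: "sl_system 0 b \<kappa> (\<lambda>x. M \<epsilon> * \<rho> x) g (Z \<epsilon>) (Zq \<epsilon>)" "\<forall>x\<in>{0..b}. \<bar>g x\<bar> \<le> KR * \<epsilon> ^ (n + 1)"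
        using KR(2) \<epsilon> by blast
      have "R.sys (M \<epsilon>) (\<lambda>x. g (-x)) (\<lambda>x. Z \<epsilon> (-x)) (\<lambda>x. - Zq \<epsilon> (-x))"
        using sl_system_reflect[OF g(1)] by simp
      then have sys: "R.sys (M \<epsilon>) (\<lambda>x. g (-x) + B * 0) (\<lambda>x. Z \<epsilon> (-x) + B * R.sol (M \<epsilon>) x)
          (\<lambda>x. - Zq \<epsilon> (-x) + B * R.flux (M \<epsilon>) x)"
        by (intro sl_system_add sl_system_scale R.sol_sys)
      have mx: "-x \<in> {-b..0}" using x by simp
      note stab = R.stability_constantD[OF CR T(2) sys _ _ mx, of "KR * p"]
      show "\<bar>Z \<epsilon> x + B * R.sol (M \<epsilon>) (-x)\<bar> \<le> eR * p" "\<bar>B * R.flux (M \<epsilon>) (-x) - Zq \<epsilon> x\<bar> \<le> eR * p"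
        using stab g(2) Zb by (simp_all add: B_def eR_def p_def mult.assoc)
    qed
    define d1 d2 d3 d4 where "d1 = Y \<epsilon> 0 - A * L.sol (M \<epsilon>) 0" and "d2 = Yq \<epsilon> 0 - A * L.flux (M \<epsilon>) 0"
      and "d3 = Z \<epsilon> 0 + B * R.sol (M \<epsilon>) 0" and "d4 = B * R.flux (M \<epsilon>) 0 - Zq \<epsilon> 0"
    have d: "\<bar>d1\<bar> \<le> eL * p" "\<bar>d2\<bar> \<le> eL * p" "\<bar>d3\<bar> \<le> eR * p" "\<bar>d4\<bar> \<le> eR * p"
      using approxL[OF zero_mem(1)] approxR[OF zero_mem(2)] by (simp_all add: d1_def d2_def d3_def d4_def)
    have \<epsilon>d4: "\<bar>\<epsilon> * d4\<bar> \<le> eR * p"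
      using abs_mult_le[OF _ d(4), of \<epsilon> 1] \<epsilon> by simp
    have pz: "\<bar>p * zq n 0\<bar> = \<bar>zq n 0\<bar> * p" using p by (simp add: abs_mult)
    have FM: "\<bar>L.sol (M \<epsilon>) 0\<bar> \<le> BL" "\<bar>L.flux (M \<epsilon>) 0\<bar> \<le> BL"
      using BL(2)[OF T(2) zero_mem(1)] by auto
    have "B * matching \<epsilon> (M \<epsilon>) = L.sol (M \<epsilon>) 0 * (d2 + p * zq n 0 + \<epsilon> * d4) + L.flux (M \<epsilon>) 0 * (d3 - d1)"
    proof -
      have 1: "\<epsilon> * (B * R.flux (M \<epsilon>) 0) = A * L.flux (M \<epsilon>) 0 + d2 + p * zq n 0 + \<epsilon> * d4"
        using flux0[of \<epsilon>] by (simp add: d2_def d4_def p_def algebra_simps)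
      have 2: "B * R.sol (M \<epsilon>) 0 = - (A * L.sol (M \<epsilon>) 0) - d1 + d3"
        using YZ0[of \<epsilon>] by (simp add: d1_def d3_def)
      have 3: "B * matching \<epsilon> (M \<epsilon>) = L.sol (M \<epsilon>) 0 * (\<epsilon> * (B * R.flux (M \<epsilon>) 0))
          + L.flux (M \<epsilon>) 0 * (B * R.sol (M \<epsilon>) 0)"
        unfolding matching_def by algebra
      show ?thesis unfolding 3 1 2 by algebra
    qed
    moreover have "\<bar>L.sol (M \<epsilon>) 0 * (d2 + p * zq n 0 + \<epsilon> * d4)\<bar> \<le> BL * ((eL + \<bar>zq n 0\<bar> + eR) * p)"
      by (rule abs_mult_le[OF FM(1)]) (use d(2) pz \<epsilon>d4 in \<open>simp add: distrib_right\<close>)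
    moreover have "\<bar>L.flux (M \<epsilon>) 0 * (d3 - d1)\<bar> \<le> BL * ((eR + eL) * p)"
      by (rule abs_mult_le[OF FM(2)]) (use d(1,3) in \<open>simp add: distrib_right\<close>)
    ultimately have "\<bar>B * matching \<epsilon> (M \<epsilon>)\<bar> \<le> (BL * (eL + \<bar>zq n 0\<bar> + eR) + BL * (eR + eL)) * p"
      by (simp add: distrib_right mult.assoc)
    from abs_mult_le[OF B(2) this]
    have "\<bar>matching \<epsilon> (M \<epsilon>)\<bar> \<le> 2 / \<zeta> * ((BL * (eL + \<bar>zq n 0\<bar> + eR) + BL * (eR + eL)) * p)"
      using B(1) by simp
    then have "S * \<bar>matching \<epsilon> (M \<epsilon>)\<bar> \<le> c * p"
      unfolding c_def mult.assoc using S(2) by (intro mult_left_mono) (auto simp: mult.assoc)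
    then have tM: "\<bar>t \<epsilon> - M \<epsilon>\<bar> \<le> c * p"
      using S(3)[OF \<epsilon>(1) near(2,1) u_form(8)[OF \<epsilon>(1)]] by linarith
    have diffL: "\<bar>L.sol (t \<epsilon>) x - L.sol (M \<epsilon>) x\<bar> \<le> PL * c * p" "\<bar>L.flux (t \<epsilon>) x - L.flux (M \<epsilon>) x\<bar> \<le> PL * c * p"
      if x: "x \<in> {a..0}" for x
    proof -
      have "PL * \<bar>t \<epsilon> - M \<epsilon>\<bar> \<le> PL * c * p"
        unfolding mult.assoc using tM PL(1) by (intro mult_left_mono) auto
      then show "\<bar>L.sol (t \<epsilon>) x - L.sol (M \<epsilon>) x\<bar> \<le> PL * c * p" "\<bar>L.flux (t \<epsilon>) x - L.flux (M \<epsilon>) x\<bar> \<le> PL * c * p"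
        using PL(2)[OF T x] by linarith+
    qed
    have diffR: "\<bar>R.sol (t \<epsilon>) (-x) - R.sol (M \<epsilon>) (-x)\<bar> \<le> PR * c * p"
        "\<bar>R.flux (t \<epsilon>) (-x) - R.flux (M \<epsilon>) (-x)\<bar> \<le> PR * c * p"
      if x: "x \<in> {0..b}" for x
    proof -
      have mx: "-x \<in> {-b..0}" using x by simp
      have "PR * \<bar>t \<epsilon> - M \<epsilon>\<bar> \<le> PR * c * p"
        unfolding mult.assoc using tM PR(1) by (intro mult_left_mono) auto
      then show "\<bar>R.sol (t \<epsilon>) (-x) - R.sol (M \<epsilon>) (-x)\<bar> \<le> PR * c * p"
        "\<bar>R.flux (t \<epsilon>) (-x) - R.flux (M \<epsilon>) (-x)\<bar> \<le> PR * c * p"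
        using PR(2)[OF T mx] by linarith+
    qed
    \<comment> \<open>The multiplier is fixed by the flux at \<open>b\<close>; on the left the amplitudes agree because the fluxes at 0 do.\<close>
    define \<eta> where "\<eta> = \<alpha> \<epsilon> - \<theta> \<epsilon> * A"
    have "\<bar>\<eta>\<bar> \<le> eA * p"
    proof -
      define D1 D2 D3 where "D1 = \<alpha> \<epsilon> * (L.flux (M \<epsilon>) 0 - L.flux (t \<epsilon>) 0)"
        and "D2 = \<beta> \<epsilon> * (\<epsilon> * (R.flux (t \<epsilon>) 0 - R.flux (M \<epsilon>) 0))"
        and "D3 = \<theta> \<epsilon> * (\<epsilon> * d4 + p * zq n 0 + d2)"
      have "\<eta> * L.flux (M \<epsilon>) 0 = D1 + D2 + D3"
      proof -
        have "\<theta> \<epsilon> * (A * L.flux (M \<epsilon>) 0)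
            = \<epsilon> * (\<theta> \<epsilon> * B * R.flux (M \<epsilon>) 0) - \<theta> \<epsilon> * (\<epsilon> * d4 + p * zq n 0 + d2)"
        proof -
          have A_eq: "A * L.flux (M \<epsilon>) 0 = \<epsilon> * (B * R.flux (M \<epsilon>) 0) - \<epsilon> * d4 - p * zq n 0 - d2"
            using flux0[of \<epsilon>] by (simp add: d2_def d4_def p_def algebra_simps)
          show ?thesis unfolding A_eq by algebra
        qed
        then show ?thesis
          using u_form(7)[OF \<epsilon>(1)] unfolding \<eta>_def D1_def D2_def D3_def B(3)
          by (simp add: algebra_simps)
      qed
      moreover have "\<bar>D1\<bar> \<le> 1 * (PL * c * p)"
        unfolding D1_def by (rule abs_mult_le[OF \<alpha>]) (use diffL(2)[OF zero_mem(1)] in linarith)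
      moreover have "\<bar>D2\<bar> \<le> \<beta>1 * (PR * c * p)"
        unfolding D2_def
      proof (rule abs_mult_le[OF \<beta>])
        show "\<bar>\<epsilon> * (R.flux (t \<epsilon>) 0 - R.flux (M \<epsilon>) 0)\<bar> \<le> PR * c * p"
          using abs_mult_le[of \<epsilon> 1, OF _ diffR(2)[OF zero_mem(2)]] \<epsilon> by simp
      qed
      moreover have "\<bar>D3\<bar> \<le> \<theta>1 * ((eR + \<bar>zq n 0\<bar> + eL) * p)"
        unfolding D3_def by (rule abs_mult_le[OF \<theta>]) (use d(2) pz \<epsilon>d4 in \<open>simp add: distrib_right\<close>)
      ultimately have "\<bar>\<eta> * L.flux (M \<epsilon>) 0\<bar>
          \<le> (1 * (PL * c) + \<beta>1 * (PR * c) + \<theta>1 * (eR + \<bar>zq n 0\<bar> + eL)) * p"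
        by (simp add: distrib_right mult.assoc)
      moreover have "\<bar>\<eta>\<bar> * f0 \<le> \<bar>\<eta> * L.flux (M \<epsilon>) 0\<bar>"
        unfolding abs_mult using fM by (intro mult_left_mono) auto
      ultimately have "\<bar>\<eta>\<bar> * f0 \<le> (1 * (PL * c) + \<beta>1 * (PR * c) + \<theta>1 * (eR + \<bar>zq n 0\<bar> + eL)) * p"
        by linarith
      then show ?thesis using f0 by (simp add: eA_def pos_le_divide_eq)
    qed
    have left: "\<bar>\<alpha> \<epsilon> * s - \<theta> \<epsilon> * v\<bar> \<le> max NL NR * p"
      if "\<bar>s - s'\<bar> \<le> PL * c * p" "\<bar>s'\<bar> \<le> BL" "\<bar>v - A * s'\<bar> \<le> eL * p" for s s' v
    proof -
      have "\<alpha> \<epsilon> * s - \<theta> \<epsilon> * v = \<alpha> \<epsilon> * (s - s') + \<eta> * s' - \<theta> \<epsilon> * (v - A * s')"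
        unfolding \<eta>_def by algebra
      moreover have "\<bar>\<alpha> \<epsilon> * (s - s')\<bar> \<le> 1 * (PL * c * p)" by (rule abs_mult_le[OF \<alpha> that(1)])
      moreover have "\<bar>\<eta> * s'\<bar> \<le> (eA * p) * BL" by (rule abs_mult_le[OF \<open>\<bar>\<eta>\<bar> \<le> eA * p\<close> that(2)])
      moreover have "\<bar>\<theta> \<epsilon> * (v - A * s')\<bar> \<le> \<theta>1 * (eL * p)" by (rule abs_mult_le[OF \<theta> that(3)])
      moreover have "NL * p = 1 * (PL * c * p) + (eA * p) * BL + \<theta>1 * (eL * p)"
        unfolding NL_def by algebra
      ultimately have "\<bar>\<alpha> \<epsilon> * s - \<theta> \<epsilon> * v\<bar> \<le> NL * p" by linarith
      also have "\<dots> \<le> max NL NR * p" using p by (intro mult_right_mono) auto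
      finally show ?thesis .
    qed
    have right: "\<bar>\<beta> \<epsilon> * s - \<theta> \<epsilon> * v\<bar> \<le> max NL NR * p"
      if "\<bar>s - s'\<bar> \<le> PR * c * p" "\<bar>B * s' - v\<bar> \<le> eR * p" for s s' v
    proof -
      have "\<beta> \<epsilon> * s - \<theta> \<epsilon> * v = \<beta> \<epsilon> * (s - s') + \<theta> \<epsilon> * (B * s' - v)"
        unfolding B(3) by algebra
      moreover have "\<bar>\<beta> \<epsilon> * (s - s')\<bar> \<le> \<beta>1 * (PR * c * p)" by (rule abs_mult_le[OF \<beta> that(1)])
      moreover have "\<bar>\<theta> \<epsilon> * (B * s' - v)\<bar> \<le> \<theta>1 * (eR * p)" by (rule abs_mult_le[OF \<theta> that(2)])
      moreover have "NR * p = \<beta>1 * (PR * c * p) + \<theta>1 * (eR * p)"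
        unfolding NR_def by algebra
      ultimately have "\<bar>\<beta> \<epsilon> * s - \<theta> \<epsilon> * v\<bar> \<le> NR * p" by linarith
      also have "\<dots> \<le> max NL NR * p" using p by (intro mult_right_mono) auto
      finally show ?thesis .
    qed
    define f where "f = (\<lambda>x. u \<epsilon> x - \<theta> \<epsilon> * partial_expansion y z n \<epsilon> x)"
    define V where "V = (\<lambda>x. k x * Dv a 0 (u \<epsilon>) x - \<theta> \<epsilon> * Yq \<epsilon> x)"
    define W where "W = (\<lambda>x. \<kappa> x * Dv 0 b (u \<epsilon>) x - \<theta> \<epsilon> * Zq \<epsilon> x)"
    have fL: "f x = u \<epsilon> x - \<theta> \<epsilon> * Y \<epsilon> x" if "x \<in> {a..0}" for x
      using that YZ0[of \<epsilon>] by (cases "x = 0") (auto simp: f_def partial_expansion_def Y_def Z_def)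
    have fR: "f x = u \<epsilon> x - \<theta> \<epsilon> * Z \<epsilon> x" if "x \<in> {0..b}" for x
      using that by (auto simp: f_def partial_expansion_def Z_def)
    obtain gL where gL: "L.sys (M \<epsilon>) gL (Y \<epsilon>) (Yq \<epsilon>)" using KL(2) \<epsilon> by blast
    obtain gR where gR: "sl_system 0 b \<kappa> (\<lambda>x. M \<epsilon> * \<rho> x) gR (Z \<epsilon>) (Zq \<epsilon>)" using KR(2) \<epsilon> by blast
    note uL = u_form(1)[OF \<epsilon>(1)] and uR = u_form(2)[OF \<epsilon>(1)]
    have "flux_bounded f V W (max NL NR * p)"
      unfolding flux_bounded_def
    proof (intro conjI ballI)
      show "continuous_on {a..0} V"
        unfolding V_def by (intro continuous_on_diff continuous_on_mult continuous_on_const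
            sl_system_continuous(2)[OF uL] sl_system_continuous(2)[OF gL])
      show "continuous_on {0..b} W"
        unfolding W_def by (intro continuous_on_diff continuous_on_mult continuous_on_const
            sl_system_continuous(2)[OF uR] sl_system_continuous(2)[OF gR])
    next
      fix x assume x: "x \<in> {a..0}"
      have "((\<lambda>x. u \<epsilon> x - \<theta> \<epsilon> * Y \<epsilon> x) has_real_derivative V x / k x) (at x within {a..0})"
        using DERIV_diff[OF sl_systemD(1)[OF uL x] DERIV_cmult[OF sl_systemD(1)[OF gL x], of "\<theta> \<epsilon>"]]
        by (simp add: V_def diff_divide_distrib)
      then show "(f has_real_derivative V x / k x) (at x within {a..0})"
        by (rule has_real_derivative_transform[OF x, rotated]) (rule fL)
      show "\<bar>f x\<bar> \<le> max NL NR * p"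
        unfolding fL[OF x] u_form(3)[OF \<epsilon>(1) x]
        by (rule left[OF diffL(1)[OF x] _ approxL(1)[OF x]]) (use BL(2)[OF T(2) x] in blast)
      show "\<bar>V x\<bar> \<le> max NL NR * p"
        unfolding V_def u_form(4)[OF \<epsilon>(1) x]
        by (rule left[OF diffL(2)[OF x] _ approxL(2)[OF x]]) (use BL(2)[OF T(2) x] in blast)
    next
      fix x assume x: "x \<in> {0..b}"
      have "((\<lambda>x. u \<epsilon> x - \<theta> \<epsilon> * Z \<epsilon> x) has_real_derivative W x / \<kappa> x) (at x within {0..b})"
        using DERIV_diff[OF sl_systemD(1)[OF uR x] DERIV_cmult[OF sl_systemD(1)[OF gR x], of "\<theta> \<epsilon>"]]
        by (simp add: W_def diff_divide_distrib)
      then show "(f has_real_derivative W x / \<kappa> x) (at x within {0..b})"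
        by (rule has_real_derivative_transform[OF x, rotated]) (rule fR)
      have "\<bar>\<beta> \<epsilon> * R.sol (t \<epsilon>) (-x) - \<theta> \<epsilon> * (- Z \<epsilon> x)\<bar> \<le> max NL NR * p"
        by (rule right[OF diffR(1)[OF x]]) (use approxR(1)[OF x] in \<open>simp add: add.commute\<close>)
      moreover have "f x = - (\<beta> \<epsilon> * R.sol (t \<epsilon>) (-x) - \<theta> \<epsilon> * (- Z \<epsilon> x))"
        unfolding fR[OF x] u_form(5)[OF \<epsilon>(1) x] by simp
      ultimately show "\<bar>f x\<bar> \<le> max NL NR * p" by (simp only: abs_minus_cancel)
      show "\<bar>W x\<bar> \<le> max NL NR * p"
        unfolding W_def u_form(6)[OF \<epsilon>(1) x] by (rule right[OF diffR(2)[OF x] approxR(2)[OF x]])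
    qed
    then have "f \<in> H1 a b" "H1_norm a b f \<le> C1 * (max NL NR * p)" using C1(2) by blast+
    then show ?case
      using tM by (simp add: f_def p_def t_def M_def mult.assoc)
  qed
  moreover have "0 < \<beta>0 / \<zeta>" using \<beta>0_pos \<zeta> by simp
  ultimately show ?thesis using \<theta>_lim by blast
qed

end

theorem theorem4:
  fixes a b :: real
    and k r \<kappa> \<rho> :: "real \<Rightarrow> real"
    and \<mu> :: "nat \<Rightarrow> real"
    and lam :: "real \<Rightarrow> nat \<Rightarrow> real"
    and u :: "real \<Rightarrow> real \<Rightarrow> real"
    and j :: nat
  assumes "a < 0" and "0 < b"
    and "smooth_on_Icc a 0 k" and "smooth_on_Icc a 0 r"
    and "smooth_on_Icc 0 b \<kappa>" and "smooth_on_Icc 0 b \<rho>"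
    and "\<forall>x\<in>{a..0}. k x > 0 \<and> r x > 0"
    and "\<forall>x\<in>{0..b}. \<kappa> x > 0 \<and> \<rho> x > 0"
    and "eigenvalue_enumeration (A_op a b k r \<kappa> \<rho>) \<mu>"
    and "\<forall>\<epsilon>>0. perturbed_enumeration a b k r \<kappa> \<rho> \<epsilon> (lam \<epsilon>)"
    and "j \<ge> 1"
    and "complex_of_real (\<mu> j) \<in> op_spectrum 0 b \<rho> (A2_hat b \<kappa> \<rho>) - op_spectrum a 0 r (A1 a k r)"
    and "\<forall>\<epsilon>>0. normalized_eigenfunction a b k r \<kappa> \<rho> \<epsilon> (lam \<epsilon> j) (u \<epsilon>)"
  shows "(\<exists>z. dirichlet_eigenfunction b \<kappa> \<rho> (\<mu> j) z \<and>
            (let u0 = (\<lambda>x. if x < 0 then 0 else z x)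
             in u0 \<in> H1 a b \<and> (\<forall>\<epsilon>>0. u \<epsilon> \<in> H1 a b) \<and>
                ((\<lambda>\<epsilon>. H1_norm a b (\<lambda>x. u \<epsilon> x - u0 x)) \<longlongrightarrow> 0) (at_right 0)))
       \<and> (\<forall>\<nu> y z. expansion_coeffs a b k r \<kappa> \<rho> (\<mu> j) \<nu> y z \<longrightarrow>
            (\<forall>n::nat. \<exists>c C :: real. \<exists>\<theta> :: real \<Rightarrow> real. \<exists>L>0. (\<theta> \<longlongrightarrow> L) (at_right 0) \<and>
               (\<forall>\<^sub>F \<epsilon> in at_right 0.
                  \<bar>lam \<epsilon> j / \<epsilon> - (\<mu> j + (\<Sum>i = 1..n. \<epsilon> ^ i * \<nu> i))\<bar> \<le> c * \<epsilon> ^ (n + 1) \<and>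
                  (\<lambda>x. u \<epsilon> x - \<theta> \<epsilon> * partial_expansion y z n \<epsilon> x) \<in> H1 a b \<and>
                  H1_norm a b (\<lambda>x. u \<epsilon> x - \<theta> \<epsilon> * partial_expansion y z n \<epsilon> x) \<le> C * \<epsilon> ^ (n + 1))))"
proof -
  interpret tp: two_phase a b k r \<kappa> \<rho>
    by unfold_locales (use assms in auto)
  have flux: "tp.L.flux (\<mu> j) 0 \<noteq> 0"
    by (rule tp.resolvent_imp_flux_nonzero) (use assms(12) in blast)
  interpret eb: eigenvalue_branch a b k r \<kappa> \<rho> "\<mu> j" "\<lambda>\<epsilon>. lam \<epsilon> j" u
  proof unfold_locales
    show "tp.L.flux (\<mu> j) 0 \<noteq> 0" by (rule flux)
    show "tp.R.sol (\<mu> j) 0 = 0" by (rule tp.eigenvalue_imp_right_zero[OF assms(9,11) flux])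
    show "((\<lambda>\<epsilon>. lam \<epsilon> j / \<epsilon>) \<longlongrightarrow> \<mu> j) (at_right 0)"
      by (rule tp.scaled_eigenvalue_tendsto[OF assms(9,11,10)])
  qed (use assms(13) in blast)
  show ?thesis
  proof (intro conjI allI impI)
    show "\<exists>z. dirichlet_eigenfunction b \<kappa> \<rho> (\<mu> j) z \<and>
            (let u0 = (\<lambda>x. if x < 0 then 0 else z x)
             in u0 \<in> H1 a b \<and> (\<forall>\<epsilon>>0. u \<epsilon> \<in> H1 a b) \<and>
                ((\<lambda>\<epsilon>. H1_norm a b (\<lambda>x. u \<epsilon> x - u0 x)) \<longlongrightarrow> 0) (at_right 0))"
      using eb.limit_eigenfunction eb.H1_convergence unfolding Let_def
      by (intro exI[of _ "\<lambda>x. - eb.\<beta>0 * tp.R.sol (\<mu> j) (-x)"]) blast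
  qed (use eb.asymptotic_expansion in blast)
qed

end
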